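(* Let $\alpha=-1$ and $\kappa<0$. Let $z=(u,\rho)$ be a solution of the generalized two-component Hunter–Saxton system with initial datum $z^0=(u^0,\rho^0)\in H^s(\mathbb S)\times H^{s-1}(\mathbb S)$, $s\ge 2$. Assume that $u^0$ is odd with $u^0_x(0)<0$, that $\rho^0$ is even with $\rho^0(0)=0$, and that $$\|u^0_x\|^2+\kappa\|\rho^0\|^2\ge 0 .$$ Then at the origin $x=0$, $u_x(t,0)$ blows up in finite time $T_0$ (the time of break-down at the origin), and the blow-up rate is $$\lim_{t\to T_0}\big\{(T_0-t)\,u_x(t,0)\big\}=-2 .$$
   Context: $\mathbb S=\mathbb R/\mathbb Z$; $\|\cdot\|$ is the $L^2(\mathbb S)$ norm. For $(\alpha,\kappa)\in\mathbb R\times\mathbb R$, the generalized two-component Hunter–Saxton system is $$u_{txx}+(1-\alpha)u_xu_{xx}+uu_{xxx}-\kappa\rho\rho_x=0,\qquad \rho_t+u\rho_x=\alpha u_x\rho,\qquad t>0,\ x\in\mathbb R,$$ with $u(t,x+1)=u(t,x)$, $\rho(t,x+1)=\rho(t,x)$, $u(0,x)=u^0(x)$, $\rho(0,x)=\rho^0(x)$. Integrating the first equation twice in space gives $$u_t+uu_x=\partial_x^{-1}\Big(\tfrac{\kappa}{2}\rho^2+\tfrac{\alpha+2}{2}u_x^2+a(t)\Big)+h(t),\qquad \partial_x^{-1}f(x)=\int_0^x f(y)\,dy,$$ with $a(t)=-\frac{\kappa}{2}\int_{\mathbb S}\rho^2dx-\frac{\alpha+2}{2}\int_{\mathbb S}u_x^2dx$;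 here the integration constant is taken to be $h\equiv 0$, and for $s=2$ the first equation is understood in this integrated form. A solution $z$ with datum in $H^s\times H^{s-1}$ is of class $C([0,T);H^s\times H^{s-1})\cap C^1([0,T);H^{s-1}\times H^{s-2})$. The time $T_0$ refers to break-down of $u_x$ at the point $x=0$; it is not asserted to be the first time at which break-down occurs somewhere on $\mathbb S$. *)

theory Defs
  imports "HOL-Analysis.Analysis"
begin

text \<open>
  Functions on the circle \<open>\<real>/\<int>\<close> are 1-periodic functions \<open>real \<Rightarrow> real\<close>; integrals over the circle
  are integrals over one period.
\<close>

definition l2_norm :: "(real \<Rightarrow> real) \<Rightarrow> real" where
  "l2_norm f = sqrt (LBINT x:{0..1}. (f x)\<^sup>2)"

definition fourier_coeff :: "(real \<Rightarrow> real) \<Rightarrow> int \<Rightarrow> complex" where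
  "fourier_coeff f k =
     (LBINT x:{0..1}. complex_of_real (f x) * cis (- (2 * pi * real_of_int k * x)))"

definition sobolev_weight :: "real \<Rightarrow> int \<Rightarrow> real" where
  "sobolev_weight s k = (1 + (2 * pi * real_of_int k)\<^sup>2) powr s"

text \<open>
  The Sobolev space of real order \<open>s \<ge> 0\<close> on the circle. Its elements are representatives:
  functions that agree almost everywhere are not identified. Negative orders, where the
  space would contain distributions that are not functions, are not covered.
\<close>

definition sobolev :: "real \<Rightarrow> (real \<Rightarrow> real) set" where
  "sobolev s = {f. f \<in> borel_measurable borel \<and> (\<forall>x. f (x + 1) = f x) \<and>
     set_integrable lborel {0..1} (\<lambda>x. (f x)\<^sup>2) \<and>
     (\<lambda>k. sobolev_weight s k * (cmod (fourier_coeff f k))\<^sup>2) summable_on UNIV}"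

definition sobolev_norm :: "real \<Rightarrow> (real \<Rightarrow> real) \<Rightarrow> real" where
  "sobolev_norm s f =
     sqrt (\<Sum>\<^sub>\<infinity>k\<in>UNIV. sobolev_weight s k * (cmod (fourier_coeff f k))\<^sup>2)"

definition continuous_into_sobolev ::
  "real \<Rightarrow> real set \<Rightarrow> (real \<Rightarrow> real \<Rightarrow> real) \<Rightarrow> bool" where
  "continuous_into_sobolev s J f \<longleftrightarrow> (\<forall>t\<in>J. f t \<in> sobolev s \<and>
     ((\<lambda>r. sobolev_norm s (\<lambda>x. f r x - f t x)) \<longlongrightarrow> 0) (at t within J))"

definition C1_into_sobolev ::
  "real \<Rightarrow> real set \<Rightarrow> (real \<Rightarrow> real \<Rightarrow> real) \<Rightarrow> (real \<Rightarrow> real \<Rightarrow> real) \<Rightarrow> bool" where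
  "C1_into_sobolev s J f f' \<longleftrightarrow>
     continuous_into_sobolev s J f \<and> continuous_into_sobolev s J f' \<and>
     (\<forall>t\<in>J. ((\<lambda>r. sobolev_norm s (\<lambda>x. (f r x - f t x) / (r - t) - f' t x)) \<longlongrightarrow> 0)
              (at t within J))"

text \<open>The half-open interval \<open>[0,T)\<close>, where \<open>T = \<infinity>\<close> is allowed.\<close>

definition time_interval :: "ereal \<Rightarrow> real set" where
  "time_interval T = {t. 0 \<le> t \<and> ereal t < T}"

definition hs_a :: "real \<Rightarrow> real \<Rightarrow> (real \<Rightarrow> real) \<Rightarrow> (real \<Rightarrow> real) \<Rightarrow> real" where
  "hs_a \<alpha> \<kappa> v r =
     - (\<kappa> / 2) * (LBINT x:{0..1}. (r x)\<^sup>2) - ((\<alpha> + 2) / 2) * (LBINT x:{0..1}. (deriv v x)\<^sup>2)"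

text \<open>
  Solutions on \<open>[0,T)\<close> of the generalized two-component Hunter--Saxton system, with the first
  equation twice integrated in space and integration constant \<open>h = 0\<close>. At each time \<open>u t\<close> and
  \<open>\<rho> t\<close> are the continuous representatives. For \<open>s \<ge> 2\<close> this makes \<open>u t\<close> continuously
  differentiable and \<open>\<rho> t\<close> absolutely continuous, so that the pointwise derivative
  \<open>deriv (\<rho> t)\<close> exists almost everywhere and represents the weak one. The time derivatives are
  Sobolev classes, whence equations that hold almost everywhere in \<open>x\<close>.
\<close>

definition hs_solution ::
  "real \<Rightarrow> real \<Rightarrow> real \<Rightarrow> ereal \<Rightarrow> (real \<Rightarrow> real) \<Rightarrow> (real \<Rightarrow> real) \<Rightarrow>
     (real \<Rightarrow> real \<Rightarrow> real) \<Rightarrow> (real \<Rightarrow> real \<Rightarrow> real) \<Rightarrow> bool" where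
  "hs_solution \<alpha> \<kappa> s T u0 \<rho>0 u \<rho> \<longleftrightarrow>
     0 < T \<and> u 0 = u0 \<and> \<rho> 0 = \<rho>0 \<and>
     (\<forall>t\<in>time_interval T. continuous_on UNIV (u t) \<and> continuous_on UNIV (\<rho> t)) \<and>
     continuous_into_sobolev s (time_interval T) u \<and>
     continuous_into_sobolev (s - 1) (time_interval T) \<rho> \<and>
     (\<exists>ut \<rho>t.
        C1_into_sobolev (s - 1) (time_interval T) u ut \<and>
        C1_into_sobolev (s - 2) (time_interval T) \<rho> \<rho>t \<and>
        (\<forall>t\<in>time_interval T - {0}.
           (AE x in lborel. ut t x + u t x * deriv (u t) x =
              (LBINT y=ereal 0..ereal x. \<kappa> / 2 * (\<rho> t y)\<^sup>2
                 + (\<alpha> + 2) / 2 * (deriv (u t) y)\<^sup>2 + hs_a \<alpha> \<kappa> (u t) (\<rho> t))) \<and>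
           (AE x in lborel. \<rho>t t x + u t x * deriv (\<rho> t) x = \<alpha> * deriv (u t) x * \<rho> t x)))"

end

theory Submission
  imports Defs
begin

text \<open>
  For \<open>\<alpha> = -1\<close> the energy \<open>\<integral> u\<^sub>x\<^sup>2 + \<kappa> \<integral> \<rho>\<^sup>2\<close> is conserved, and the nonlocal term \<open>a\<close> is
  \<open>-1/2\<close> times the energy; so \<open>a\<close> is a constant \<open>A\<close>, and \<open>A \<le> 0\<close> by the hypothesis on the data.
  At the origin \<open>u\<close> and \<open>\<rho>\<close> stay zero. Differentiating the first equation in \<open>x\<close> at \<open>x = 0\<close>
  therefore leaves the Riccati equation \<open>w' = - w\<^sup>2 / 2 + A\<close> for \<open>w t = u\<^sub>x(t, 0)\<close>. As \<open>w 0 < 0\<close> and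
  \<open>A \<le> 0\<close>, its explicit solution (a hyperbola if \<open>A = 0\<close>, a cotangent if \<open>A < 0\<close>) tends to
  minus infinity at a finite \<open>T\<^sub>0\<close> with \<open>(T\<^sub>0 - t) w t \<longlongrightarrow> -2\<close>. A solution living past \<open>T\<^sub>0\<close>
  would have \<open>u\<^sub>x(t, 0)\<close> continuous there, so \<open>T \<le> T\<^sub>0\<close>.

  The vanishing at the origin is read off from the equations themselves. The first equation
  at \<open>x = 0\<close> is the linear ordinary differential equation
  \<open>m' = - u\<^sub>x(t, 0) m\<close> for \<open>m t = u(t, 0)\<close>, and \<open>m 0 = 0\<close> because the datum is odd (lemma \<open>u_0\<close>).
  The second equation holds only almost everywhere in \<open>x\<close>, so it cannot be evaluated at \<open>0\<close>.
  Instead (lemma \<open>\<rho>_0\<close>) the integrals \<open>\<integral> \<rho>\<^sup>2 / (x + \<delta>)\<close> grow at most exponentially,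
  uniformly in \<open>\<delta>\<close>, because \<open>u\<close> is Lipschitz and vanishes at \<open>0\<close>; at time \<open>0\<close> they are bounded,
  because a function in \<open>H\<^sup>1\<close> that vanishes at \<open>0\<close> has a square of size \<open>O(x)\<close>; and if
  \<open>\<rho>(t, 0)\<close> were different from \<open>0\<close> they would diverge logarithmically as \<open>\<delta> \<rightarrow> 0\<close>.

  The regularity is too low for pointwise differentiation of the equations, and the Sobolev
  spaces are given by Fourier coefficients. Both gaps are closed on the unit interval by the
  relation \<open>primitive F f\<close>, saying that \<open>F\<close> is an indefinite integral of \<open>f\<close>. Products of such
  functions obey the product rule (\<open>primitive_mult\<close>) and they are differentiable almost everywhere
  (\<open>primitive_AE_deriv\<close>), which gives a meaning to the pointwise derivatives in the equations
  and justifies every integration by parts. The Riesz-Fischer theorem together with uniqueness of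
  Fourier coefficients turns a Sobolev norm of order one or two into bounds on
  a continuous representative and its weak derivative (\<open>weak_derivative\<close>). Convergence in
  Sobolev norm then yields pointwise and square-mean time derivatives, from which the energy identity
  and the equations at the origin follow.
\<close>

section \<open>Integration over one period\<close>

text \<open>
  A function on the circle is studied on the period \<open>{0..1}\<close>; turning this interval into
  a measure space of its own makes integrability and the integral available without set-integral
  bookkeeping.
\<close>

definition circ :: "real measure" where
  "circ = restrict_space lborel {0..1}"

lemma space_circ [simp]: "space circ = {0..1}"
  by (simp add: circ_def space_restrict_space)

lemma borel_measurable_circ:
  "f \<in> borel_measurable borel \<Longrightarrow> f \<in> borel_measurable circ"
  by (simp add: circ_def measurable_restrict_space1)

lemma borel_measurable_circ_continuous:
  fixes f :: "real \<Rightarrow> 'b::real_normed_vector"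
  assumes "continuous_on {0..1} f"
  shows "f \<in> borel_measurable circ"
  using borel_measurable_continuous_on_restrict[OF assms]
  by (simp add: circ_def measurable_def space_restrict_space sets_restrict_space)

lemma emeasure_circ: "emeasure circ {0..1} = 1"
  by (simp add: circ_def emeasure_restrict_space)

interpretation circ: finite_measure circ
  by standard (simp add: emeasure_circ)

interpretation circ2: pair_sigma_finite circ circ
  by standard

lemma measure_circ [simp]: "measure circ {0..1} = 1"
  by (simp add: measure_def emeasure_circ)

lemma set_integral_circ:
  fixes f :: "real \<Rightarrow> 'b::{banach, second_countable_topology}"
  shows "(LBINT x:{0..1}. f x) = (LINT x|circ. f x)"
  unfolding circ_def set_lebesgue_integral_def by (subst integral_restrict_space) auto

lemma set_integrable_circ:
  fixes f :: "real \<Rightarrow> 'b::{banach, second_countable_topology}"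
  shows "set_integrable lborel {0..1} f \<longleftrightarrow> integrable circ f"
  unfolding circ_def set_integrable_def by (subst integrable_restrict_space) auto

lemma AE_circ_iff: "(AE x in circ. P x) \<longleftrightarrow> (AE x in lborel. x \<in> {0..1} \<longrightarrow> P x)"
  unfolding circ_def by (rule AE_restrict_space_iff) auto

lemma AE_circI: "(AE x in lborel. P x) \<Longrightarrow> (AE x in circ. P x)"
  unfolding AE_circ_iff by (auto elim: eventually_mono)

lemma AE_circ_neq: "AE x in circ. x \<noteq> c"
  by (rule AE_circI[OF AE_lborel_singleton])

lemma continuous_bounded_unit:
  fixes f :: "real \<Rightarrow> real"
  assumes "continuous_on {0..1} f"
  obtains B where "0 \<le> B" "\<And>x. x \<in> {0..1} \<Longrightarrow> \<bar>f x\<bar> \<le> B"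
proof -
  have "bounded (f ` {0..1})"
    using assms by (intro compact_imp_bounded compact_continuous_image) auto
  then obtain B where "\<forall>y\<in>f ` {0..1}. norm y \<le> B" by (auto simp: bounded_iff)
  then have "\<bar>f x\<bar> \<le> max B 0" if "x \<in> {0..1}" for x using that by (simp add: le_max_iff_disj)
  then show ?thesis using that[of "max B 0"] by auto
qed

lemma integrable_circ_mult_bounded:
  fixes f g :: "real \<Rightarrow> real"
  assumes f: "integrable circ f" and g: "g \<in> borel_measurable circ"
    and B: "\<And>x. x \<in> {0..1} \<Longrightarrow> \<bar>g x\<bar> \<le> B"
  shows "integrable circ (\<lambda>x. g x * f x)"
proof (rule Bochner_Integration.integrable_bound)
  show "integrable circ (\<lambda>x. B * f x)" using f by simp
  show "(\<lambda>x. g x * f x) \<in> borel_measurable circ" using f g by measurable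
  have "norm (g x * f x) \<le> norm (B * f x)" if "x \<in> {0..1}" for x
    using mult_right_mono[OF B[OF that], of "\<bar>f x\<bar>"] B[OF that] by (auto simp: abs_mult)
  then show "AE x in circ. norm (g x * f x) \<le> norm (B * f x)" by (intro AE_I2) simp
qed

lemma integrable_circ_mult_continuous:
  fixes f g :: "real \<Rightarrow> real"
  assumes f: "integrable circ f" and g: "continuous_on {0..1} g"
  shows "integrable circ (\<lambda>x. g x * f x)"
proof -
  obtain B where "\<And>x. x \<in> {0..1} \<Longrightarrow> \<bar>g x\<bar> \<le> B" using continuous_bounded_unit[OF g] by metis
  then show ?thesis
    using integrable_circ_mult_bounded[OF f borel_measurable_circ_continuous[OF g]] by blast
qed

lemma integrable_circ_continuous:
  fixes f :: "real \<Rightarrow> real"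
  shows "continuous_on {0..1} f \<Longrightarrow> integrable circ f"
  using integrable_circ_mult_continuous[of "\<lambda>_. 1" f] by simp

lemma integral_circ_le_const:
  fixes f :: "real \<Rightarrow> real"
  assumes "integrable circ f" "\<And>x. x \<in> {0..1} \<Longrightarrow> f x \<le> B"
  shows "(LINT x|circ. f x) \<le> B"
proof -
  have "(LINT x|circ. f x) \<le> (LINT x|circ. B)"
    by (rule integral_mono) (use assms in auto)
  then show ?thesis by simp
qed

section \<open>Square-integrable functions\<close>

definition L2 :: "(real \<Rightarrow> real) \<Rightarrow> bool" where
  "L2 f \<longleftrightarrow> f \<in> borel_measurable circ \<and> integrable circ (\<lambda>x. (f x)\<^sup>2)"

lemma L2_measurable [measurable_dest]: "L2 f \<Longrightarrow> f \<in> borel_measurable circ"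
  by (simp add: L2_def)

lemma L2_sq_integrable: "L2 f \<Longrightarrow> integrable circ (\<lambda>x. (f x)\<^sup>2)"
  by (simp add: L2_def)

lemma L2_integrable: "L2 f \<Longrightarrow> integrable circ f"
  by (simp add: L2_def circ.square_integrable_imp_integrable)

lemma L2_mult_integrable:
  assumes "L2 f" "L2 g"
  shows "integrable circ (\<lambda>x. f x * g x)"
proof (rule Bochner_Integration.integrable_bound)
  show "integrable circ (\<lambda>x. (f x)\<^sup>2 + (g x)\<^sup>2)" using assms by (auto intro: L2_sq_integrable)
  show "(\<lambda>x. f x * g x) \<in> borel_measurable circ" using assms by measurable
  show "AE x in circ. norm (f x * g x) \<le> norm ((f x)\<^sup>2 + (g x)\<^sup>2)"
  proof (rule AE_I2)
    fix x
    have "2 * \<bar>f x * g x\<bar> \<le> (f x)\<^sup>2 + (g x)\<^sup>2"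
      using sum_squares_bound[of "\<bar>f x\<bar>" "\<bar>g x\<bar>"] by (simp add: abs_mult)
    then show "norm (f x * g x) \<le> norm ((f x)\<^sup>2 + (g x)\<^sup>2)" by (simp)
  qed
qed

lemma L2_add [intro]: "L2 f \<Longrightarrow> L2 g \<Longrightarrow> L2 (\<lambda>x. f x + g x)"
  using L2_mult_integrable[of f g]
  by (auto simp: L2_def power2_sum mult.assoc)

lemma L2_cmult [intro]: "L2 f \<Longrightarrow> L2 (\<lambda>x. c * f x)"
  by (auto simp: L2_def power_mult_distrib)

lemma L2_uminus: "L2 f \<Longrightarrow> L2 (\<lambda>x. - f x)"
  using L2_cmult[of f "-1"] by simp

lemma L2_diff [intro]: "L2 f \<Longrightarrow> L2 g \<Longrightarrow> L2 (\<lambda>x. f x - g x)"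
  using L2_add[of f "\<lambda>x. - g x"] L2_uminus[of g] by simp

lemma L2_divide [intro]: "L2 f \<Longrightarrow> L2 (\<lambda>x. f x / c)"
  using L2_cmult[of f "1/c"] by simp

lemma L2_continuous: "continuous_on {0..1} f \<Longrightarrow> L2 f"
  unfolding L2_def
  by (auto intro!: borel_measurable_circ_continuous integrable_circ_continuous continuous_intros)

lemma L2_mult_bounded:
  assumes "L2 f" "g \<in> borel_measurable circ" "\<And>x. x \<in> {0..1} \<Longrightarrow> \<bar>g x\<bar> \<le> B"
  shows "L2 (\<lambda>x. g x * f x)"
proof -
  have "\<bar>(g x)\<^sup>2\<bar> \<le> B\<^sup>2" if "x \<in> {0..1}" for x
    using power_mono[OF assms(3)[OF that], of 2] by simp
  then have "integrable circ (\<lambda>x. (g x)\<^sup>2 * (f x)\<^sup>2)"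
    using assms by (intro integrable_circ_mult_bounded L2_sq_integrable) auto
  then show ?thesis using assms by (auto simp: L2_def power_mult_distrib)
qed

text \<open>
  The discriminant argument: the quadratic \<open>t \<mapsto> \<integral> (f - t g)\<^sup>2\<close> is nonnegative, and
  evaluating it at its minimiser gives the inequality.
\<close>

lemma L2_Cauchy_Schwarz:
  assumes f: "L2 f" and g: "L2 g"
  shows "\<bar>LINT x|circ. f x * g x\<bar> \<le> sqrt (LINT x|circ. (f x)\<^sup>2) * sqrt (LINT x|circ. (g x)\<^sup>2)"
proof -
  define A B C where "A = (LINT x|circ. (f x)\<^sup>2)" and "B = (LINT x|circ. f x * g x)"
    and "C = (LINT x|circ. (g x)\<^sup>2)"
  have "0 \<le> A" "0 \<le> C" by (auto simp: A_def C_def)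
  have quad: "0 \<le> A - 2 * t * B + t\<^sup>2 * C" for t
  proof -
    have "0 \<le> (LINT x|circ. (f x - t * g x)\<^sup>2)" by simp
    also have "(\<lambda>x. (f x - t * g x)\<^sup>2) = (\<lambda>x. (f x)\<^sup>2 - 2 * t * (f x * g x) + t\<^sup>2 * (g x)\<^sup>2)"
      by (auto simp: power2_diff power_mult_distrib algebra_simps)
    also have "(LINT x|circ. \<dots> x) = A - 2 * t * B + t\<^sup>2 * C"
      using L2_sq_integrable[OF f] L2_sq_integrable[OF g] L2_mult_integrable[OF f g]
      by (simp add: A_def B_def C_def)
    finally show ?thesis .
  qed
  have "B\<^sup>2 \<le> A * C"
  proof (cases "C = 0")
    case True
    have "B = 0"
    proof (rule ccontr)
      assume "B \<noteq> 0"
      \<comment> \<open>if \<open>C = 0\<close> the quadratic is affine in \<open>t\<close>, and this \<open>t\<close> makes it equal to \<open>- 1\<close>\<close>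
      with quad[of "(A + 1) / (2 * B)"] True show False by (simp add: field_simps)
    qed
    with True show ?thesis by simp
  next
    case False
    with \<open>0 \<le> C\<close> have "C > 0" by simp
    with quad[of "B / C"] show ?thesis by (simp add: field_simps power2_eq_square)
  qed
  then have "\<bar>B\<bar> \<le> sqrt (A * C)" by (metis real_sqrt_abs real_sqrt_le_mono)
  then show ?thesis by (simp add: A_def B_def C_def real_sqrt_mult)
qed

lemma L2_integral_abs_le:
  assumes "L2 f"
  shows "(LINT x|circ. \<bar>f x\<bar>) \<le> sqrt (LINT x|circ. (f x)\<^sup>2)"
proof -
  have "L2 (\<lambda>x. \<bar>f x\<bar>)" using assms by (auto simp: L2_def)
  from L2_Cauchy_Schwarz[OF this L2_continuous[of "\<lambda>_. 1"]] show ?thesis by simp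
qed

section \<open>Indefinite integrals\<close>

text \<open>
  \<open>F\<close> is absolutely continuous with derivative \<open>f\<close>. The value at \<open>0\<close> stands on the left
  so that the equation can be used for rewriting without looping at \<open>x = 0\<close>.
\<close>

definition primitive :: "(real \<Rightarrow> real) \<Rightarrow> (real \<Rightarrow> real) \<Rightarrow> bool" where
  "primitive F f \<longleftrightarrow> integrable circ f \<and>
     (\<forall>x\<in>{0..1}. F x - F 0 = (LINT y|circ. indicat_real {0..x} y * f y))"

lemma primitiveI:
  assumes "integrable circ f"
    "\<And>x. x \<in> {0..1} \<Longrightarrow> F x = F 0 + (LINT y|circ. indicat_real {0..x} y * f y)"
  shows "primitive F f"
  unfolding primitive_def
proof (intro conjI ballI)
  show "F x - F 0 = (LINT y|circ. indicat_real {0..x} y * f y)" if "x \<in> {0..1}" for x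
    using assms(2)[OF that] by linarith
qed (rule assms(1))

lemma primitiveD:
  "primitive F f \<Longrightarrow> x \<in> {0..1} \<Longrightarrow> F x = F 0 + (LINT y|circ. indicat_real {0..x} y * f y)"
  unfolding primitive_def by (metis add.commute diff_add_cancel)

lemma primitive_integrable: "primitive F f \<Longrightarrow> integrable circ f"
  by (simp add: primitive_def)

lemma integrable_circ_indicator:
  fixes f :: "real \<Rightarrow> real"
  assumes "integrable circ f"
  shows "integrable circ (\<lambda>y. indicat_real {a..b} y * f y)"
proof (rule integrable_circ_mult_bounded[OF assms, where B=1])
  show "indicat_real {a..b} \<in> borel_measurable circ" by (intro borel_measurable_circ) measurable
qed (auto simp: indicator_def)

lemma primitive_add: "primitive F f \<Longrightarrow> primitive G g \<Longrightarrow> primitive (\<lambda>x. F x + G x) (\<lambda>x. f x + g x)"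
  by (auto simp: primitive_def distrib_left integrable_circ_indicator add_diff_add)

lemma primitive_cmult: "primitive F f \<Longrightarrow> primitive (\<lambda>x. c * F x) (\<lambda>x. c * f x)"
proof -
  have "(\<lambda>y. indicat_real {0..x} y * (c * f y)) = (\<lambda>y. c * (indicat_real {0..x} y * f y))" for x
    by (simp add: mult.left_commute)
  then show "primitive F f \<Longrightarrow> primitive (\<lambda>x. c * F x) (\<lambda>x. c * f x)"
    by (auto simp: primitive_def right_diff_distrib[symmetric])
qed

lemma primitive_diff: "primitive F f \<Longrightarrow> primitive G g \<Longrightarrow> primitive (\<lambda>x. F x - G x) (\<lambda>x. f x - g x)"
  using primitive_add[of F f "\<lambda>x. (-1) * G x" "\<lambda>x. (-1) * g x"] primitive_cmult[of G g "-1"] by simp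

lemma primitive_const: "primitive (\<lambda>x. c) (\<lambda>x. 0)"
  by (auto simp: primitive_def)

lemma primitive_integral: 
  assumes "primitive F f" shows "(LINT x|circ. f x) = F 1 - F 0"
proof -
  have "(LINT x|circ. f x) = (LINT y|circ. indicat_real {0..1} y * f y)"
    by (rule Bochner_Integration.integral_cong) auto
  then show ?thesis using primitiveD[OF assms, of 1] by simp
qed

lemma primitive_cong:
  assumes "primitive F f" "\<And>x. x \<in> {0..1} \<Longrightarrow> F x = G x" "AE x in circ. f x = g x"
    "g \<in> borel_measurable circ"
  shows "primitive G g"
proof -
  have m: "f \<in> borel_measurable circ" using assms(1) by (auto simp: primitive_def)
  have "integrable circ g"
    using assms m by (subst integrable_cong_AE[of g circ f]) (auto simp: primitive_def)
  moreover have "(LINT y|circ. indicat_real {0..x} y * f y) = (LINT y|circ. indicat_real {0..x} y * g y)" for x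
  proof -
    have "indicat_real {0..x} \<in> borel_measurable circ" by (intro borel_measurable_circ) measurable
    then show ?thesis by (intro integral_cong_AE) (use assms m in auto)
  qed
  ultimately show ?thesis
    using assms(1) assms(2)[of 0] assms(2) by (simp add: primitive_def)
qed

lemma integral_circ_indicator_lborel:
  fixes f :: "real \<Rightarrow> real"
  assumes "0 \<le> a" "b \<le> 1"
  shows "(LINT y|circ. indicat_real {a..b} y * f y) = (LBINT y:{a..b}. f y)"
  unfolding circ_def set_lebesgue_integral_def
  by (subst integral_restrict_space) (use assms in \<open>auto intro!: Bochner_Integration.integral_cong simp: indicator_def\<close>)

lemma integral_circ_indicator_HK:
  fixes f :: "real \<Rightarrow> real"
  assumes "0 \<le> a" "b \<le> 1" "integrable circ f"
  shows "(LINT y|circ. indicat_real {a..b} y * f y) = integral {a..b} f" "f integrable_on {a..b}"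
proof -
  have "set_integrable lborel {a..b} f"
    by (rule set_integrable_subset[of _ "{0..1}"]) (use assms in \<open>auto simp: set_integrable_circ\<close>)
  from set_borel_integral_eq_integral[OF this] show "(LINT y|circ. indicat_real {a..b} y * f y) = integral {a..b} f" "f integrable_on {a..b}"
    using integral_circ_indicator_lborel[of a b f] assms by auto
qed

lemma primitive_HK: "primitive F f \<Longrightarrow> x \<in> {0..1} \<Longrightarrow> F x = F 0 + integral {0..x} f"
  using integral_circ_indicator_HK(1)[of 0 x f] primitiveD[of F f x] by (auto simp: primitive_integrable)

lemma primitive_HK_diff: 
  assumes "primitive F f" "0 \<le> x" "x \<le> y" "y \<le> 1" 
  shows "F y - F x = integral {x..y} f"
proof -
  have "integral {0..x} f + integral {x..y} f = integral {0..y} f"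
    by (rule Henstock_Kurzweil_Integration.integral_combine)
      (use assms integral_circ_indicator_HK(2)[of 0 y f] in \<open>auto simp: primitive_def\<close>)
  then show ?thesis using primitive_HK[OF assms(1), of x] primitive_HK[OF assms(1), of y] assms(2-4) by auto
qed

lemma primitive_diff_integral: 
  assumes "primitive F f" "0 \<le> x" "x \<le> y" "y \<le> 1" 
  shows "F y - F x = (LINT z|circ. indicat_real {x..y} z * f z)"
  using primitive_HK_diff[OF assms] integral_circ_indicator_HK(1)[of x y f] assms by (auto simp: primitive_def)

lemma primitive_continuous:
  assumes "primitive F f" shows "continuous_on {0..1} F"
proof -
  have "continuous_on {0..1} (\<lambda>x. F 0 + integral {0..x} f)"
    by (intro continuous_intros indefinite_integral_continuous_1 integral_circ_indicator_HK(2))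
      (use assms in \<open>auto simp: primitive_def\<close>)
  then show ?thesis
    by (rule continuous_on_cong[THEN iffD1, OF refl, rotated]) (rule primitive_HK[OF assms, symmetric])
qed

lemma primitive_of_continuous_deriv:
  assumes "\<And>x. x \<in> {0..1} \<Longrightarrow> (F has_real_derivative f x) (at x within {0..1})" "continuous_on {0..1} f"
  shows "primitive F f"
proof -
  have "F x = F 0 + (LINT y|circ. indicat_real {0..x} y * f y)" if "x \<in> {0..1}" for x
  proof -
    have "(f has_integral (F x - F 0)) {0..x}"
    proof (rule fundamental_theorem_of_calculus)
      show "(F has_vector_derivative f y) (at y within {0..x})" if "y \<in> {0..x}" for y
        using has_field_derivative_subset[OF assms(1)[of y], of "{0..x}"] that \<open>x \<in> {0..1}\<close>
        by (auto simp: has_real_derivative_iff_has_vector_derivative)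
    qed (use that in auto)
    then show ?thesis using integral_circ_indicator_HK(1)[of 0 x f] that
      integrable_circ_continuous[OF assms(2)] by (auto dest: integral_unique)
  qed
  then show ?thesis by (intro primitiveI integrable_circ_continuous[OF assms(2)])
qed

lemma primitive_deriv_at:
  assumes "primitive F f" "continuous_on {0..1} f" "x \<in> {0..1}"
  shows "(F has_real_derivative f x) (at x within {0..1})"
proof -
  have "((\<lambda>x. integral {0..x} f) has_vector_derivative f x) (at x within {0..1})"
    by (rule integral_has_vector_derivative[OF assms(2,3)])
  then have "((\<lambda>x. F 0 + integral {0..x} f) has_real_derivative f x) (at x within {0..1})"
    by (auto simp: has_real_derivative_iff_has_vector_derivative intro!: derivative_eq_intros)
  then show ?thesis
    unfolding has_real_derivative_iff_has_vector_derivative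
    by (rule has_vector_derivative_transform[rotated 2]) (rule assms(3), erule primitive_HK[OF assms(1)])
qed

text \<open>
  One-sided form of Lebesgue's differentiation theorem. The two-sided version below applies it
  also to the reflected function.
\<close>

lemma primitive_AE_right_deriv:
  fixes f0 :: "real \<Rightarrow> real"
  assumes "integrable lborel f0"
  shows "AE x in lborel. ((\<lambda>h. integral {x..x+h} f0 / h) \<longlongrightarrow> f0 x) (at_right 0)"
proof -
  have int: "f0 integrable_on cbox a b" for a b
    using integrable_on_lborel[OF assms] integrable_on_subcbox by blast
  obtain N where N: "negligible N"
       "\<And>x e. \<lbrakk>x \<notin> N; 0 < e\<rbrakk> \<Longrightarrow>
               \<exists>d>0. \<forall>h. 0 < h \<and> h < d \<longrightarrow>
                         norm(integral (cbox x (x + h *\<^sub>R One)) f0 /\<^sub>R h ^ DIM(real) - f0 x) < e"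
    using integrable_ccontinuous_explicit[OF int] by metis
  have "AE x in lebesgue. x \<notin> N" using N(1) by (simp add: negligible_iff_null_sets AE_not_in)
  then have "AE x in lborel. x \<notin> N" by (simp add: AE_completion_iff)
  then show ?thesis
  proof (rule eventually_mono)
    fix x assume x: "x \<notin> N"
    show "((\<lambda>h. integral {x..x+h} f0 / h) \<longlongrightarrow> f0 x) (at_right 0)"
    proof (rule tendstoI)
      fix e :: real assume "0 < e"
      from N(2)[OF x this] obtain d where "d > 0" and d: "\<And>h. 0 < h \<Longrightarrow> h < d \<Longrightarrow> 
         norm (integral {x..x+h} f0 /\<^sub>R h - f0 x) < e" by auto
      show "\<forall>\<^sub>F h in at_right 0. dist (integral {x..x+h} f0 / h) (f0 x) < e"
        unfolding eventually_at_right_field using \<open>d > 0\<close> d 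
        by (intro exI[of _ d]) (auto simp: dist_norm divide_inverse mult.commute)
    qed
  qed
qed

lemma AE_lborel_reflect:
  fixes P :: "real \<Rightarrow> bool"
  assumes "AE x in lborel. P x"
  shows "AE x in lborel. P (- x)"
proof -
  obtain N where N: "N \<in> null_sets lborel" "{x \<in> space lborel. \<not> P x} \<subseteq> N"
    using assms unfolding eventually_ae_filter by auto
  have [measurable]: "N \<in> sets borel" using N(1) by auto
  have "AE x in lborel. 0 + (-1) * x \<notin> N"
    by (rule AE_borel_affine) (use AE_not_in[OF N(1)] in auto)
  then show ?thesis by (rule eventually_mono) (use N(2) in auto)
qed

text \<open>
  This is what allows the pointwise derivative of a function in \<open>H\<^sup>1\<close> to be replaced by
  the weak one.
\<close>

lemma primitive_AE_deriv:
  assumes "primitive F f"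
  shows "AE x in circ. (F has_real_derivative f x) (at x)"
proof -
  define f0 where "f0 x = indicat_real {0..1} x * f x" for x
  have i0: "integrable lborel f0"
    using primitive_integrable[OF assms] unfolding f0_def set_integrable_circ[symmetric] set_integrable_def by simp
  have i1: "integrable lborel (\<lambda>x. f0 (- x))"
    using lborel_integrable_real_affine[OF i0, of "-1" 0] by simp
  have *: "AE x in lborel. ((\<lambda>h. integral {x..x+h} f0 / h) \<longlongrightarrow> f0 x) (at_right 0)"
    by (rule primitive_AE_right_deriv[OF i0])
  have "AE x in lborel. ((\<lambda>h. integral {x..x+h} (\<lambda>x. f0 (- x)) / h) \<longlongrightarrow> f0 (- x)) (at_right 0)"
    by (rule primitive_AE_right_deriv[OF i1])
  from AE_lborel_reflect[OF this]
  have **: "AE x in lborel. ((\<lambda>h. integral {-x..-x+h} (\<lambda>x. f0 (- x)) / h) \<longlongrightarrow> f0 x) (at_right 0)"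
    by simp
  have "AE x in lborel. x \<in> {0..1} \<longrightarrow> (F has_real_derivative f x) (at x)"
    using * ** AE_lborel_singleton[of 0] AE_lborel_singleton[of 1]
  proof eventually_elim
    case (elim x)
    show ?case
    proof
      assume "x \<in> {0..1}"
      with elim have x: "0 < x" "x < 1" by auto
      have R: "((\<lambda>h. (F (x + h) - F x) / h) \<longlongrightarrow> f x) (at_right 0)"
      proof (rule Lim_transform_eventually[where f="\<lambda>h. integral {x..x+h} f0 / h"])
        show "((\<lambda>h. integral {x..x + h} f0 / h) \<longlongrightarrow> f x) (at_right 0)"
          using elim(1) x by (simp add: f0_def)
        have "(F (x + h) - F x) = integral {x..x+h} f0" if "0 < h" "h < 1 - x" for h
        proof -
          have "F (x + h) - F x = integral {x..x+h} f" by (rule primitive_HK_diff[OF assms]) (use that x in auto)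
          also have "\<dots> = integral {x..x+h} f0"
            by (rule Henstock_Kurzweil_Integration.integral_cong) (use that x in \<open>auto simp: f0_def\<close>)
          finally show ?thesis .
        qed
        then show "\<forall>\<^sub>F h in at_right 0. integral {x..x + h} f0 / h = (F (x + h) - F x) / h"
          unfolding eventually_at_right_field using x by (intro exI[of _ "1 - x"]) auto
      qed
      have L: "((\<lambda>h. (F (x + h) - F x) / h) \<longlongrightarrow> f x) (at_left 0)"
        unfolding filterlim_at_left_to_right minus_zero
      proof (rule Lim_transform_eventually[where f="\<lambda>h. integral {-x..-x+h} (\<lambda>x. f0 (-x)) / h"])
        show "((\<lambda>h. integral {-x..-x + h} (\<lambda>x. f0 (-x)) / h) \<longlongrightarrow> f x) (at_right 0)"
          using elim(2) x by (simp add: f0_def)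
        have "F (x + -h) - F x = - integral {-x..-x+h} (\<lambda>x. f0 (-x))" if "0 < h" "h < x" for h
        proof -
          have "F x - F (x + -h) = integral {x - h..x} f" 
            using primitive_HK_diff[OF assms, of "x-h" x] that x by auto
          also have "\<dots> = integral {x-h..x} f0"
            by (rule Henstock_Kurzweil_Integration.integral_cong) (use that x in \<open>auto simp: f0_def\<close>)
          also have "\<dots> = integral {-x..-x+h} (\<lambda>x. f0 (-x))"
            using Henstock_Kurzweil_Integration.integral_reflect_real[of x "x-h" f0] by (simp add: algebra_simps)
          finally show ?thesis by simp
        qed
        then show "\<forall>\<^sub>F h in at_right 0. integral {-x..-x + h} (\<lambda>x. f0 (-x)) / h = (F (x + -h) - F x) / - h"
          unfolding eventually_at_right_field using x by (intro exI[of _ x]) auto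
      qed
      from R L show "(F has_real_derivative f x) (at x)"
        unfolding DERIV_def by (simp add: filterlim_split_at)
    qed
  qed
  then show ?thesis by (simp add: AE_circ_iff)
qed

text \<open>
  Two continuous functions that differ at a point differ on a whole interval, which has
  positive length.
\<close>

lemma AE_circ_eq_continuous:
  fixes F G :: "real \<Rightarrow> real"
  assumes "AE x in circ. F x = G x" "continuous_on {0..1} F" "continuous_on {0..1} G" "x \<in> {0..1}"
  shows "F x = G x"
proof (rule ccontr)
  assume ne: "F x \<noteq> G x"
  define D where "D = (\<lambda>y. \<bar>F y - G y\<bar>)"
  have cD: "continuous_on {0..1} D" unfolding D_def using assms by (intro continuous_intros)
  have "D x > 0" using ne by (simp add: D_def)
  then obtain d where d: "d > 0" "\<And>y. y \<in> {0..1} \<Longrightarrow> dist y x < d \<Longrightarrow> dist (D y) (D x) < D x"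
    using cD \<open>x \<in> {0..1}\<close> unfolding continuous_on_iff by metis
  have pos: "D y \<noteq> 0" if "y \<in> {0..1}" "dist y x < d" for y
    using d(2)[OF that] by (auto simp: dist_real_def)
  define a b where "a = max 0 (x - d / 2)" and "b = min 1 (x + d / 2)"
  have ab: "a < b" using \<open>d>0\<close> \<open>x\<in>{0..1}\<close> by (auto simp: a_def b_def)
  have "AE y in lborel. y \<notin> {a..b}"
    using assms(1)[unfolded AE_circ_iff]
  proof eventually_elim
    case (elim y)
    show ?case
    proof
      assume "y \<in> {a..b}"
      then have "y \<in> {0..1}" "dist y x < d" using d(1) by (auto simp: a_def b_def dist_real_def abs_less_iff)
      with pos elim show False by (auto simp: D_def)
    qed
  qed
  then have "emeasure lborel {a..b} = 0"
    by (subst (asm) AE_iff_measurable[of "{a..b}"]) auto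
  then show False using ab by simp
qed

lemma primitive_unique_AE:
  assumes "primitive F f" "primitive G g" "AE x in circ. F x = G x"
  shows "AE x in circ. f x = g x"
proof -
  have eq: "F x = G x" if "x \<in> {0..1}" for x
    by (rule AE_circ_eq_continuous[OF assms(3)]) (use assms that primitive_continuous in auto)
  have "primitive F g"
    by (rule primitive_cong[OF assms(2)]) (use eq assms(2) in \<open>auto simp: primitive_def\<close>)
  from primitive_AE_deriv[OF this] primitive_AE_deriv[OF assms(1)] show ?thesis
    by eventually_elim (auto intro: DERIV_unique)
qed

text \<open>
  Fubini's theorem on the square \<open>{0..x} \<times> {0..x}\<close>, cut along the diagonal: the two triangles
  give the two iterated integrals on the right.
\<close>

lemma primitive_mult_integral:
  assumes "integrable circ f" "integrable circ g" "x \<in> {0..1}"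
  shows "(LINT y|circ. indicat_real {0..x} y * f y) * (LINT y|circ. indicat_real {0..x} y * g y) =
    (LINT y|circ. indicat_real {0..x} y * (f y * (LINT z|circ. indicat_real {0..y} z * g z)))
    + (LINT z|circ. indicat_real {0..x} z * (g z * (LINT y|circ. indicat_real {0..z} y * f y)))"
proof -
  define fx gx where "fx y = indicat_real {0..x} y * f y" and "gx y = indicat_real {0..x} y * g y" for y
  have [measurable]: "fx \<in> borel_measurable circ" "gx \<in> borel_measurable circ"
    and ifx: "integrable circ fx" and igx: "integrable circ gx"
    unfolding fx_def gx_def using integrable_circ_indicator[OF assms(1)] integrable_circ_indicator[OF assms(2)]
    by auto
  have [measurable]: "(\<lambda>x. x) \<in> borel_measurable circ" by (intro borel_measurable_circ) simp
  define h where "h = (\<lambda>(y, z). fx y * gx z)"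
  have ih: "integrable (circ \<Otimes>\<^sub>M circ) h"
  proof (rule circ2.Fubini_integrable)
    show "h \<in> borel_measurable (circ \<Otimes>\<^sub>M circ)" unfolding h_def by measurable
    show "integrable circ (\<lambda>x. LINT y|circ. norm (h (x, y)))"
      using ifx by (simp add: h_def abs_mult)
    show "AE x in circ. integrable circ (\<lambda>y. h (x, y))" using igx by (simp add: h_def)
  qed
  have [measurable]: "Measurable.pred (circ \<Otimes>\<^sub>M circ) (\<lambda>p. snd p \<le> fst p)" by measurable
  define h1 h2 where "h1 p = (if snd p \<le> fst p then h p else 0)" and "h2 p = (if snd p \<le> fst p then 0 else h p)" for p
  have [measurable]: "h \<in> borel_measurable (circ \<Otimes>\<^sub>M circ)" using ih by auto
  have i1: "integrable (circ \<Otimes>\<^sub>M circ) h1"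
    by (rule Bochner_Integration.integrable_bound[OF ih]) (auto simp: h1_def[abs_def])
  have i2: "integrable (circ \<Otimes>\<^sub>M circ) h2"
    by (rule Bochner_Integration.integrable_bound[OF ih]) (auto simp: h2_def[abs_def])
  have "(LINT y|circ. fx y) * (LINT z|circ. gx z) = integral\<^sup>L (circ \<Otimes>\<^sub>M circ) h"
    unfolding circ2.integral_fst'[OF ih, symmetric] by (simp add: h_def)
  also have "\<dots> = integral\<^sup>L (circ \<Otimes>\<^sub>M circ) h1 + integral\<^sup>L (circ \<Otimes>\<^sub>M circ) h2"
    by (subst Bochner_Integration.integral_add[OF i1 i2, symmetric]) (auto intro!: Bochner_Integration.integral_cong simp: h1_def h2_def)
  also have "integral\<^sup>L (circ \<Otimes>\<^sub>M circ) h1 = (LINT y|circ. LINT z|circ. h1 (y, z))"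
    by (rule circ2.integral_fst'[OF i1, symmetric])
  also have "\<dots> = (LINT y|circ. indicat_real {0..x} y * (f y * (LINT z|circ. indicat_real {0..y} z * g z)))"
  proof (rule Bochner_Integration.integral_cong[OF refl])
    fix y assume y: "y \<in> space circ"
    have "(LINT z|circ. h1 (y, z)) = (LINT z|circ. fx y * (indicat_real {0..y} z * g z))"
      by (rule Bochner_Integration.integral_cong[OF refl]) (use assms y in \<open>auto simp: h1_def h_def fx_def gx_def indicator_def\<close>)
    then show "(LINT z|circ. h1 (y, z)) = indicat_real {0..x} y * (f y * (LINT z|circ. indicat_real {0..y} z * g z))"
      by (simp add: fx_def)
  qed
  also have "integral\<^sup>L (circ \<Otimes>\<^sub>M circ) h2 = (LINT z|circ. LINT y|circ. h2 (y, z))"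
    using circ2.integral_snd[of "\<lambda>y z. h2 (y, z)"] i2 by simp
  also have "\<dots> = (LINT z|circ. indicat_real {0..x} z * (g z * (LINT y|circ. indicat_real {0..z} y * f y)))"
  proof (rule Bochner_Integration.integral_cong[OF refl])
    fix z assume z: "z \<in> space circ"
    have mi: "indicat_real {0..z} \<in> borel_measurable circ" by (intro borel_measurable_circ) measurable
    have "(LINT y|circ. h2 (y, z)) = (LINT y|circ. gx z * (indicat_real {0..z} y * f y))"
    proof (rule integral_cong_AE)
      show "(\<lambda>y. h2 (y, z)) \<in> borel_measurable circ"
        using i2 z by (intro measurable_compose[OF _ borel_measurable_integrable[OF i2]]) measurable
      show "(\<lambda>y. gx z * (indicat_real {0..z} y * f y)) \<in> borel_measurable circ"
        using mi assms(1) by measurable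
      show "AE y in circ. h2 (y, z) = gx z * (indicat_real {0..z} y * f y)"
        using AE_circ_neq[of z] AE_space[of circ]
        by eventually_elim (use assms z in \<open>auto simp: h2_def h_def fx_def gx_def indicator_def\<close>)
    qed
    then show "(LINT y|circ. h2 (y, z)) = indicat_real {0..x} z * (g z * (LINT y|circ. indicat_real {0..z} y * f y))"
      by (simp add: gx_def)
  qed
  finally show ?thesis unfolding fx_def gx_def .
qed

text \<open>
  The product rule, hence integration by parts, for absolutely continuous functions.
\<close>

lemma primitive_mult:
  assumes F: "primitive F f" and G: "primitive G g"
  shows "primitive (\<lambda>x. F x * G x) (\<lambda>x. f x * G x + F x * g x)"
proof -
  have iF: "integrable circ f" and iG: "integrable circ g" using F G by (auto simp: primitive_def)
  have i1: "integrable circ (\<lambda>x. f x * G x)" 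
    using integrable_circ_mult_continuous[OF iF primitive_continuous[OF G]] by (simp add: mult.commute)
  have i2: "integrable circ (\<lambda>x. F x * g x)" 
    using integrable_circ_mult_continuous[OF iG primitive_continuous[OF F]] by simp
  define If Ig where "If x = (LINT y|circ. indicat_real {0..x} y * f y)" 
    and "Ig x = (LINT y|circ. indicat_real {0..x} y * g y)" for x
  have Fe: "F x = F 0 + If x" and Ge: "G x = G 0 + Ig x" if "x \<in> {0..1}" for x
    using primitiveD[OF F that] primitiveD[OF G that] by (auto simp: If_def Ig_def)
  have "F x * G x = F 0 * G 0 + (LINT y|circ. indicat_real {0..x} y * (f y * G y + F y * g y))" if x: "x \<in> {0..1}" for x
  proof -
    have j1: "integrable circ (\<lambda>y. indicat_real {0..x} y * (f y * Ig y))"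
    proof (rule integrable_circ_indicator)
      have "integrable circ (\<lambda>y. f y * G y - G 0 * f y)" using i1 iF by simp
      then show "integrable circ (\<lambda>y. f y * Ig y)"
        by (rule Bochner_Integration.integrable_cong[THEN iffD1, OF refl, rotated]) (simp only: space_circ, drule Ge, simp add: algebra_simps)
    qed
    have j2: "integrable circ (\<lambda>y. indicat_real {0..x} y * (g y * If y))"
    proof (rule integrable_circ_indicator)
      have "integrable circ (\<lambda>y. F y * g y - F 0 * g y)" using i2 iG by simp
      then show "integrable circ (\<lambda>y. g y * If y)"
        by (rule Bochner_Integration.integrable_cong[THEN iffD1, OF refl, rotated]) (simp only: space_circ, drule Fe, simp add: algebra_simps)
    qed
    have "(LINT y|circ. indicat_real {0..x} y * (f y * G y + F y * g y)) = 
      (LINT y|circ. G 0 * (indicat_real {0..x} y * f y) + F 0 * (indicat_real {0..x} y * g y) 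
        + (indicat_real {0..x} y * (f y * Ig y) + indicat_real {0..x} y * (g y * If y)))"
    proof (rule Bochner_Integration.integral_cong[OF refl])
      fix y assume "y \<in> space circ"
      then have "F y = F 0 + If y" "G y = G 0 + Ig y" using Fe[of y] Ge[of y] by simp_all
      then show "indicat_real {0..x} y * (f y * G y + F y * g y) = G 0 * (indicat_real {0..x} y * f y) + F 0 * (indicat_real {0..x} y * g y) 
        + (indicat_real {0..x} y * (f y * Ig y) + indicat_real {0..x} y * (g y * If y))" by (simp add: algebra_simps)
    qed
    also have "\<dots> = G 0 * If x + F 0 * Ig x + (LINT y|circ. indicat_real {0..x} y * (f y * Ig y)) + (LINT y|circ. indicat_real {0..x} y * (g y * If y))"
      using j1 j2 integrable_circ_indicator[OF iF] integrable_circ_indicator[OF iG] by (simp add: If_def Ig_def)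
    also have "\<dots> = G 0 * If x + F 0 * Ig x + If x * Ig x"
      using primitive_mult_integral[OF iF iG x] by (simp add: If_def Ig_def)
    finally show ?thesis using Fe[OF x] Ge[OF x] by (simp add: algebra_simps)
  qed
  then show ?thesis by (intro primitiveI Bochner_Integration.integrable_add i1 i2)
qed

lemma primitive_Lipschitz_0:
  assumes "primitive F f" "F 0 = 0" "\<And>x. x \<in> {0..1} \<Longrightarrow> \<bar>f x\<bar> \<le> B" "x \<in> {0..1}"
  shows "\<bar>F x\<bar> \<le> B * x"
proof -
  have "F x = integral {0..x} f" using primitive_HK[OF assms(1,4)] assms(2) by simp
  moreover have "f integrable_on {0..x}"
    by (rule integral_circ_indicator_HK(2)) (use assms primitive_integrable in auto)
  then have "norm (integral {0..x} f) \<le> integral {0..x} (\<lambda>_. B)"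
    by (rule integral_norm_bound_integral) (use assms in auto)
  ultimately show ?thesis using assms(4) by (simp add: mult.commute)
qed

lemma primitive_quotient_tendsto:
  assumes "primitive F f" "F 0 = 0" "continuous_on {0..1} f"
  shows "(\<lambda>n. F (inverse (real (Suc n))) / inverse (real (Suc n))) \<longlonglongrightarrow> f 0"
proof -
  have "((\<lambda>y. (F y - F 0) / (y - 0)) \<longlongrightarrow> f 0) (at 0 within {0..1})"
    using primitive_deriv_at[OF assms(1,3), of 0] by (simp add: has_field_derivative_iff)
  moreover have "filterlim (\<lambda>n. inverse (real (Suc n))) (at 0 within {0..1}) sequentially"
    using LIMSEQ_inverse_real_of_nat by (auto simp: filterlim_at inverse_le_1_iff)
  ultimately have "(\<lambda>n. (F (inverse (real (Suc n))) - F 0) / (inverse (real (Suc n)) - 0)) \<longlonglongrightarrow> f 0"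
    by (rule filterlim_compose)
  then show ?thesis using assms(2) by simp
qed

text \<open>
  The embedding of \<open>H\<^sup>1\<close> into Hoelder functions of exponent one half, at a zero of \<open>F\<close>:
  Cauchy-Schwarz applied to \<open>f\<close> and the indicator of \<open>{0..x}\<close>.
\<close>

lemma primitive_Hoelder_0:
  assumes "primitive F f" "L2 f" "F 0 = 0" "x \<in> {0..1}"
  shows "(F x)\<^sup>2 \<le> x * (LINT y|circ. (f y)\<^sup>2)"
proof -
  have mi: "indicat_real {0..x} \<in> borel_measurable circ" by (intro borel_measurable_circ) measurable
  have "L2 (\<lambda>y. indicat_real {0..x} y * 1)"
    by (rule L2_mult_bounded[OF L2_continuous mi, of _ 1]) auto
  then have Li: "L2 (indicat_real {0..x})" by simp
  have i: "(LINT y|circ. (indicat_real {0..x} y)\<^sup>2) = x"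
  proof -
    have "(\<lambda>y. (indicat_real {0..x} y)\<^sup>2) = (\<lambda>y. indicat_real {0..x} y * 1)" by (auto simp: indicator_def)
    then show ?thesis using integral_circ_indicator_HK(1)[of 0 x "\<lambda>_. 1"] assms(4) by auto
  qed
  have "\<bar>F x\<bar> \<le> sqrt x * sqrt (LINT y|circ. (f y)\<^sup>2)"
    using L2_Cauchy_Schwarz[OF Li assms(2)] primitiveD[OF assms(1,4)] assms(3) i by simp
  then have "\<bar>F x\<bar>\<^sup>2 \<le> (sqrt x * sqrt (LINT y|circ. (f y)\<^sup>2))\<^sup>2" by (intro power_mono) auto
  then show ?thesis using assms(4) by (simp add: power_mult_distrib)
qed

section \<open>Uniqueness of Fourier coefficients\<close>

lemma fourier_coeff_circ:
  "fourier_coeff f k = (LINT x|circ. complex_of_real (f x) * cis (- (2 * pi * real_of_int k * x)))"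
  by (simp add: fourier_coeff_def set_integral_circ)

lemma integrable_circ_mult_cis:
  fixes f :: "real \<Rightarrow> complex"
  assumes "integrable circ f"
  shows "integrable circ (\<lambda>x. f x * cis (c * x))"
proof (rule Bochner_Integration.integrable_bound[OF assms])
  have "(\<lambda>x. cis (c * x)) \<in> borel_measurable circ"
    by (intro borel_measurable_circ_continuous continuous_intros)
  then show "(\<lambda>x. f x * cis (c * x)) \<in> borel_measurable circ" using assms by measurable
qed (simp add: norm_mult)

lemma fourier_integrable:
  assumes "integrable circ f"
  shows "integrable circ (\<lambda>x. complex_of_real (f x) * cis (- (2 * pi * real_of_int k * x)))"
  using integrable_circ_mult_cis[of "\<lambda>x. complex_of_real (f x)" "- (2 * pi * real_of_int k)"] assms by simp

lemma fourier_coeff_add: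
  assumes "integrable circ f" "integrable circ g"
  shows "fourier_coeff (\<lambda>x. f x + g x) k = fourier_coeff f k + fourier_coeff g k"
  unfolding fourier_coeff_circ using fourier_integrable[OF assms(1)] fourier_integrable[OF assms(2)]
  by (simp add: distrib_right)

lemma fourier_coeff_cmult: "fourier_coeff (\<lambda>x. c * f x) k = of_real c * fourier_coeff f k"
  unfolding fourier_coeff_circ by (simp add: mult.assoc)

lemma fourier_coeff_diff:
  assumes "integrable circ f" "integrable circ g"
  shows "fourier_coeff (\<lambda>x. f x - g x) k = fourier_coeff f k - fourier_coeff g k"
  using fourier_coeff_add[OF assms(1), of "\<lambda>x. (-1) * g x" k] assms fourier_coeff_cmult[of "-1" g k] by simp

lemma fourier_coeff_cos_sin:
  assumes "integrable circ f"
  shows "fourier_coeff f k = Complex (LINT x|circ. f x * cos (2 * pi * real_of_int k * x))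
     (- (LINT x|circ. f x * sin (2 * pi * real_of_int k * x)))"
proof (rule complex_eqI)
  note i = fourier_integrable[OF assms, of k]
  show "Re (fourier_coeff f k) = Re (Complex (LINT x|circ. f x * cos (2 * pi * real_of_int k * x))
     (- (LINT x|circ. f x * sin (2 * pi * real_of_int k * x))))"
    unfolding fourier_coeff_circ by (simp flip: integral_Re[OF i])
  show "Im (fourier_coeff f k) = Im (Complex (LINT x|circ. f x * cos (2 * pi * real_of_int k * x))
     (- (LINT x|circ. f x * sin (2 * pi * real_of_int k * x))))"
    unfolding fourier_coeff_circ by (simp flip: integral_Im[OF i])
qed

lemma fourier_coeff_0: "fourier_coeff f 0 = of_real (LINT x|circ. f x)"
  unfolding fourier_coeff_circ by simp

lemma fourier_coeff_uminus: "fourier_coeff f (- k) = cnj (fourier_coeff f k)"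
proof -
  have "cnj (fourier_coeff f k) = (LINT x|circ. cnj (complex_of_real (f x) * cis (- (2 * pi * real_of_int k * x))))"
    unfolding fourier_coeff_circ by (rule Bochner_Integration.integral_cnj[symmetric])
  then show ?thesis unfolding fourier_coeff_circ by (simp add: cis_cnj)
qed

text \<open>
  Multiplication by a shifted cosine mixes the two neighbouring coefficients. Hence the
  functions without nonzero Fourier coefficients are closed under multiplication by
  polynomials in \<open>cos (2 \<pi> x - a)\<close>, which is the next lemma.
\<close>

lemma fourier_coeff_mult_cos:
  assumes g: "integrable circ g"
  shows "fourier_coeff (\<lambda>x. cos (2 * pi * x - a) * g x) k =
    (cis (- a) * fourier_coeff g (k - 1) + cis a * fourier_coeff g (k + 1)) / 2"
proof -
  have eq: "complex_of_real (cos (2 * pi * x - a) * g x) * cis (- (2 * pi * real_of_int k * x)) =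
     (cis (- a) * (complex_of_real (g x) * cis (- (2 * pi * real_of_int (k - 1) * x)))
      + cis a * (complex_of_real (g x) * cis (- (2 * pi * real_of_int (k + 1) * x)))) / 2" for x
  proof -
    have c: "complex_of_real (cos t) = (cis t + cis (- t)) / 2" for t
      by (simp add: complex_eq_iff)
    have e1: "cis (2 * pi * x - a) * cis (- (2 * pi * real_of_int k * x)) = 
        cis (- a) * cis (- (2 * pi * real_of_int (k - 1) * x))"
      unfolding cis_mult by (rule arg_cong[of _ _ cis]) (simp add: algebra_simps)
    have e2: "cis (- (2 * pi * x - a)) * cis (- (2 * pi * real_of_int k * x)) = 
        cis a * cis (- (2 * pi * real_of_int (k + 1) * x))"
      unfolding cis_mult by (rule arg_cong[of _ _ cis]) (simp add: algebra_simps)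
    have "complex_of_real (cos (2 * pi * x - a) * g x) * cis (- (2 * pi * real_of_int k * x)) =
       complex_of_real (g x) * ((cis (2 * pi * x - a) * cis (- (2 * pi * real_of_int k * x))
         + cis (- (2 * pi * x - a)) * cis (- (2 * pi * real_of_int k * x))) / 2)"
      unfolding of_real_mult c by (simp add: field_simps)
    also have "\<dots> = (cis (- a) * (complex_of_real (g x) * cis (- (2 * pi * real_of_int (k - 1) * x)))
      + cis a * (complex_of_real (g x) * cis (- (2 * pi * real_of_int (k + 1) * x)))) / 2"
      unfolding e1 e2 by (simp add: field_simps)
    finally show ?thesis .
  qed
  show ?thesis
    unfolding fourier_coeff_circ eq
    using fourier_integrable[OF g, of "k - 1"] fourier_integrable[OF g, of "k + 1"] by simp
qed

lemma fourier_coeff_poly_cos: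
  fixes P :: "real \<Rightarrow> real"
  assumes "real_polynomial_function P" "integrable circ g" "\<And>k. fourier_coeff g k = 0"
  shows "integrable circ (\<lambda>x. P (cos (2 * pi * x - a)) * g x)
    \<and> (\<forall>k. fourier_coeff (\<lambda>x. P (cos (2 * pi * x - a)) * g x) k = 0)"
  using assms
proof (induction arbitrary: g rule: real_polynomial_function.induct)
  case (linear f)
  have f: "f t = f 1 * t" for t
    using linear_simps(5)[OF linear(1), of t 1] by (simp add: mult.commute)
  have i: "integrable circ (\<lambda>x. cos (2 * pi * x - a) * g x)"
    by (rule integrable_circ_mult_continuous[OF linear(2)]) (intro continuous_intros)
  have e: "(\<lambda>x. f (cos (2 * pi * x - a)) * g x) = (\<lambda>x. f 1 * (cos (2 * pi * x - a) * g x))"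
    by (subst f) (simp add: mult.assoc)
  show ?case
    unfolding e fourier_coeff_cmult using i fourier_coeff_mult_cos[OF linear(2)] linear(3) by simp
next
  case (const c)
  then show ?case by (simp add: fourier_coeff_cmult)
next
  case (add f h)
  then show ?case by (simp add: distrib_right fourier_coeff_add)
next
  case (mult f h)
  have "integrable circ (\<lambda>x. h (cos (2 * pi * x - a)) * g x)" 
    "\<And>k. fourier_coeff (\<lambda>x. h (cos (2 * pi * x - a)) * g x) k = 0" using mult by auto
  from mult.IH(1)[OF this] show ?case by (simp add: mult.assoc)
qed

text \<open>
  Approximate \<open>\<psi>\<close> uniformly by polynomials on the range \<open>{-1..1}\<close> of the cosine.
\<close>

lemma integral_continuous_cos_eq_0:
  fixes \<psi> :: "real \<Rightarrow> real"
  assumes g: "integrable circ g" "\<And>k. fourier_coeff g k = 0" and \<psi>: "continuous_on {-1..1} \<psi>"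
  shows "(LINT x|circ. \<psi> (cos (2 * pi * x - a)) * g x) = 0"
proof -
  let ?c = "\<lambda>x. cos (2 * pi * x - a)"
  have c: "continuous_on {0..1} (\<lambda>x. \<psi> (?c x))"
    by (rule continuous_on_compose2[OF \<psi>]) (auto intro!: continuous_intros)
  define G where "G = (LINT x|circ. \<bar>g x\<bar>)"
  have "G \<ge> 0" by (simp add: G_def)
  have "\<bar>LINT x|circ. \<psi> (?c x) * g x\<bar> \<le> e * G" if "e > 0" for e
  proof -
    obtain P where P: "real_polynomial_function P" "\<And>x. x \<in> {-1..1} \<Longrightarrow> \<bar>\<psi> x - P x\<bar> < e"
      using Stone_Weierstrass_real_polynomial_function[OF _ \<psi> \<open>e > 0\<close>] by auto
    have P0: "integrable circ (\<lambda>x. P (?c x) * g x)" "(LINT x|circ. P (?c x) * g x) = 0"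
      using fourier_coeff_poly_cos[OF P(1) g, of a] fourier_coeff_0[of "\<lambda>x. P (?c x) * g x"] by auto
    have i1: "integrable circ (\<lambda>x. \<psi> (?c x) * g x)" by (rule integrable_circ_mult_continuous[OF g(1) c])
    have "(LINT x|circ. \<psi> (?c x) * g x) = (LINT x|circ. \<psi> (?c x) * g x - P (?c x) * g x)"
      using i1 P0 by simp
    also have "\<bar>\<dots>\<bar> \<le> (LINT x|circ. e * \<bar>g x\<bar>)"
    proof (rule integral_abs_bound_integral)
      fix x
      have "\<bar>\<psi> (?c x) - P (?c x)\<bar> \<le> e" using P(2)[of "?c x"] by simp
      then have "\<bar>\<psi> (?c x) - P (?c x)\<bar> * \<bar>g x\<bar> \<le> e * \<bar>g x\<bar>" by (rule mult_right_mono) simp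
      then show "\<bar>\<psi> (?c x) * g x - P (?c x) * g x\<bar> \<le> e * \<bar>g x\<bar>" 
        by (simp flip: abs_mult left_diff_distrib)
    qed (use i1 P0 g in auto)
    finally show ?thesis by (simp add: G_def)
  qed
  then have "\<bar>LINT x|circ. \<psi> (?c x) * g x\<bar> \<le> e" if "e > 0" for e
  proof -
    have "e / (G + 1) > 0" using that \<open>G \<ge> 0\<close> by simp
    from \<open>\<And>e. e > 0 \<Longrightarrow> _ \<le> e * G\<close>[OF this]
    have "\<bar>LINT x|circ. \<psi> (?c x) * g x\<bar> \<le> e / (G + 1) * G" .
    also have "\<dots> \<le> e" using \<open>G \<ge> 0\<close> that by (simp add: field_simps)
    finally show ?thesis .
  qed
  then show ?thesis using field_le_epsilon[of "\<bar>LINT x|circ. \<psi> (?c x) * g x\<bar>" 0] by simp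
qed

text \<open>
  On the circle an arc from \<open>0\<close> to \<open>b\<close> is a superlevel set of the cosine centred at the
  midpoint \<open>b / 2\<close>. So the indicator of \<open>{0..b}\<close> is a pointwise limit of
  continuous functions of one such cosine.
\<close>

lemma cos_arc_iff:
  assumes "0 < b" "b < 1" "0 \<le> x" "x \<le> 1" "x \<noteq> 0" "x \<noteq> b"
  shows "cos (pi * b) < cos (2 * pi * x - pi * b) \<longleftrightarrow> x < b"
proof (cases "x < b")
  case True
  have "\<bar>2 * pi * x - pi * b\<bar> < pi * b" 
    using True assms by (auto simp: abs_less_iff algebra_simps)
  moreover have "pi * b \<le> pi" using assms by simp
  ultimately have "cos (pi * b) < cos \<bar>2 * pi * x - pi * b\<bar>" by (intro cos_monotone_0_pi) auto
  then show ?thesis using True by simp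
next
  case False
  define t where "t = 2 * pi * x - pi * b"
  have t: "pi * b \<le> t" "t \<le> 2 * pi - pi * b"
  proof -
    have "pi * b \<le> pi * x" using False by (intro mult_left_mono) auto
    then show "pi * b \<le> t" by (simp add: t_def)
    have "2 * pi * x \<le> 2 * pi" using assms by simp
    then show "t \<le> 2 * pi - pi * b" by (simp add: t_def)
  qed
  have b: "0 \<le> pi * b" "pi * b \<le> pi" using assms by auto
  have "cos t \<le> cos (pi * b)"
  proof (cases "t \<le> pi")
    case True
    then show ?thesis using t b by (intro cos_monotone_0_pi_le) auto
  next
    case False
    have "cos t = cos (2 * pi - t)" by (simp add: cos_diff)
    also have "\<dots> \<le> cos (pi * b)" using t b False by (intro cos_monotone_0_pi_le) auto
    finally show ?thesis .
  qed
  then show ?thesis using False by (simp add: t_def)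
qed

text \<open>
  The integral of \<open>g\<close> over every \<open>{0..b}\<close> vanishes, so the zero function is
  a primitive of \<open>g\<close>, and the integrand of a primitive is determined almost everywhere.
\<close>

lemma fourier_coeff_unique:
  assumes g: "integrable circ g" "\<And>k. fourier_coeff g k = 0"
  shows "AE x in circ. g x = 0"
proof -
  have "(LINT y|circ. indicat_real {0..b} y * g y) = 0" if b: "b \<in> {0..1}" for b
  proof -
    consider "b = 0" | "b = 1" | "0 < b" "b < 1" using b by fastforce
    then show ?thesis
    proof cases
      case 1
      have "(LINT y|circ. indicat_real {0..b} y * g y) = (LINT y|circ. 0 * g y)"
      proof (rule integral_cong_AE)
        show "(\<lambda>y. indicat_real {0..b} y * g y) \<in> borel_measurable circ"
          using integrable_circ_indicator[OF g(1)] by auto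
        show "AE x in circ. indicat_real {0..b} x * g x = 0 * g x"
          using AE_circ_neq[of 0] by eventually_elim (simp add: 1)
      qed simp
      then show ?thesis by simp
    next
      case 2
      have "(LINT y|circ. indicat_real {0..b} y * g y) = (LINT y|circ. g y)"
        by (rule Bochner_Integration.integral_cong) (use 2 in auto)
      then show ?thesis using fourier_coeff_0[of g] g by simp
    next
      case 3
      let ?c = "\<lambda>x. cos (2 * pi * x - pi * b)"
      \<comment> \<open>these truncated ramps increase to the indicator of \<open>{cos (pi * b)<..}\<close>\<close>
      define \<psi> where "\<psi> n y = min 1 (real n * max 0 (y - cos (pi * b)))" for n y
      have c\<psi>: "continuous_on S (\<psi> n)" for n S unfolding \<psi>_def by (intro continuous_intros)
      have "(\<lambda>n. LINT x|circ. \<psi> n (?c x) * g x) \<longlonglongrightarrow> (LINT x|circ. indicat_real {0..b} x * g x)"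
      proof (rule integral_dominated_convergence[where w="\<lambda>x. \<bar>g x\<bar>"])
        show "(\<lambda>x. indicat_real {0..b} x * g x) \<in> borel_measurable circ"
          using integrable_circ_indicator[OF g(1)] by auto
        have "continuous_on {0..1} (\<lambda>x. \<psi> n (?c x))" for n
          by (rule continuous_on_compose2[OF c\<psi>[where S=UNIV]]) (auto intro!: continuous_intros)
        then show "(\<lambda>x. \<psi> n (?c x) * g x) \<in> borel_measurable circ" for n
          using integrable_circ_mult_continuous[OF g(1), of "\<lambda>x. \<psi> n (?c x)"] by auto
        show "integrable circ (\<lambda>x. \<bar>g x\<bar>)" using g by simp
        have "\<bar>\<psi> n y\<bar> \<le> 1" for n y by (auto simp: \<psi>_def min_def)
        then show "AE x in circ. norm (\<psi> n (?c x) * g x) \<le> \<bar>g x\<bar>" for n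
          by (intro AE_I2) (simp add: abs_mult mult_left_le_one_le)
        show "AE x in circ. (\<lambda>n. \<psi> n (?c x) * g x) \<longlonglongrightarrow> indicat_real {0..b} x * g x"
          using AE_circ_neq[of 0] AE_circ_neq[of b] AE_space[of circ]
        proof eventually_elim
          case (elim x)
          then have x: "0 \<le> x" "x \<le> 1" "x \<noteq> 0" "x \<noteq> b" by auto
          have "(\<lambda>n. \<psi> n (?c x)) \<longlonglongrightarrow> indicat_real {0..b} x"
          proof (cases "x < b")
            case True
            then have p: "?c x - cos (pi * b) > 0" using cos_arc_iff[OF 3 x] by simp
            then obtain N :: nat where N: "1 < real N * (?c x - cos (pi * b))" using reals_Archimedean3 by blast
            have "\<psi> n (?c x) = 1" if "n \<ge> N" for n
            proof -
              have "real N * (?c x - cos (pi * b)) \<le> real n * (?c x - cos (pi * b))"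
                using that p by (intro mult_right_mono) auto
              then have "1 \<le> real n * (?c x - cos (pi * b))" using N by linarith
              then show ?thesis using p by (simp add: \<psi>_def min_absorb1)
            qed
            then have "\<forall>\<^sub>F n in sequentially. \<psi> n (?c x) = 1" using eventually_at_top_linorder by blast
            then show ?thesis using True x by (auto simp: indicator_def intro: tendsto_eventually)
          next
            case False
            then have "?c x - cos (pi * b) \<le> 0" using cos_arc_iff[OF 3 x] by simp
            then have "\<psi> n (?c x) = 0" for n by (simp add: \<psi>_def)
            then show ?thesis using False x by (auto simp: indicator_def)
          qed
          then show ?case by (intro tendsto_intros)
        qed
      qed
      moreover have "(LINT x|circ. \<psi> n (?c x) * g x) = 0" for n
        by (rule integral_continuous_cos_eq_0[OF g c\<psi>])
      ultimately show ?thesis by (simp add: LIMSEQ_const_iff)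
    qed
  qed
  then have "primitive (\<lambda>x. 0) g" using g(1) by (simp add: primitive_def)
  from primitive_unique_AE[OF this primitive_const[of 0]] show ?thesis by simp
qed

section \<open>The Riesz-Fischer theorem\<close>

definition trig_poly :: "(int \<Rightarrow> complex) \<Rightarrow> int set \<Rightarrow> real \<Rightarrow> complex" where
  "trig_poly c K x = (\<Sum>k\<in>K. c k * cis (2 * pi * real_of_int k * x))"

lemma continuous_trig_poly [continuous_intros]: "continuous_on S (trig_poly c K)"
  unfolding trig_poly_def[abs_def] by (intro continuous_intros)

lemma integrable_circ_continuous_complex:
  fixes f :: "real \<Rightarrow> complex"
  assumes "continuous_on {0..1} f"
  shows "integrable circ f"
proof -
  have "integrable circ (\<lambda>x. norm (f x))" 
    by (rule integrable_circ_continuous) (intro continuous_intros assms)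
  then show ?thesis using borel_measurable_circ_continuous[OF assms] integrable_norm_iff by blast
qed

lemma integral_cis:
  "(LINT x|circ. cis (2 * pi * real_of_int k * x)) = (if k = 0 then 1 else 0)"
proof (cases "k = 0")
  case True then show ?thesis by simp
next
  case False
  have i: "integrable circ (\<lambda>x. cis (2 * pi * real_of_int k * x))"
    by (intro integrable_circ_continuous_complex continuous_intros)
  let ?w = "2 * pi * real_of_int k"
  have w: "?w \<noteq> 0" using False by simp
  have c: "cos ?w = 1" "sin ?w = 0" using cos_int_2pin[of k] sin_int_2pin[of k] by (simp_all add: mult.commute)
  have "primitive (\<lambda>x. sin (?w * x) / ?w) (\<lambda>x. cos (?w * x))"
    by (rule primitive_of_continuous_deriv) (use w in \<open>auto intro!: derivative_eq_intros continuous_intros\<close>)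
  from primitive_integral[OF this] c have "(LINT x|circ. cos (?w * x)) = 0" by simp
  moreover have "primitive (\<lambda>x. - cos (?w * x) / ?w) (\<lambda>x. sin (?w * x))"
    by (rule primitive_of_continuous_deriv) (use w in \<open>auto intro!: derivative_eq_intros continuous_intros\<close>)
  from primitive_integral[OF this] c have "(LINT x|circ. sin (?w * x)) = 0" by simp
  ultimately show ?thesis
    using False integral_Re[OF i] integral_Im[OF i] by (simp add: complex_eq_iff)
qed

lemma integral_cis_mult:
  "(LINT x|circ. cis (2 * pi * real_of_int k * x) * cis (- (2 * pi * real_of_int l * x))) = (if k = l then 1 else 0)"
proof -
  have "cis (2 * pi * real_of_int k * x) * cis (- (2 * pi * real_of_int l * x)) = cis (2 * pi * real_of_int (k - l) * x)" for x
    unfolding cis_mult by (rule arg_cong[of _ _ cis]) (simp add: algebra_simps)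
  then show ?thesis using integral_cis[of "k - l"] by simp
qed

lemma integral_trig_poly_mult_cis:
  assumes "finite K"
  shows "(LINT x|circ. trig_poly c K x * cis (- (2 * pi * real_of_int l * x))) = (if l \<in> K then c l else 0)"
proof -
  have "(LINT x|circ. trig_poly c K x * cis (- (2 * pi * real_of_int l * x))) = 
     (\<Sum>k\<in>K. c k * (LINT x|circ. cis (2 * pi * real_of_int k * x) * cis (- (2 * pi * real_of_int l * x))))"
    unfolding trig_poly_def sum_distrib_right mult.assoc
    by (subst Bochner_Integration.integral_sum)
      (auto intro!: integrable_circ_continuous_complex continuous_intros)
  also have "\<dots> = (\<Sum>k\<in>K. if k = l then c k else 0)"
    unfolding integral_cis_mult by (intro sum.cong) auto
  also have "\<dots> = (if l \<in> K then c l else 0)" using assms by (simp add: sum.delta')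
  finally show ?thesis .
qed

lemma integral_trig_poly_norm_sq:
  assumes "finite K"
  shows "(LINT x|circ. (cmod (trig_poly c K x))\<^sup>2) = (\<Sum>k\<in>K. (cmod (c k))\<^sup>2)"
proof -
  have e: "complex_of_real ((cmod (trig_poly c K x))\<^sup>2) =
    (\<Sum>l\<in>K. cnj (c l) * (trig_poly c K x * cis (- (2 * pi * real_of_int l * x))))" for x
  proof -
    have "complex_of_real ((cmod (trig_poly c K x))\<^sup>2) = trig_poly c K x * cnj (trig_poly c K x)"
      by (rule complex_norm_square)
    also have "cnj (trig_poly c K x) = (\<Sum>l\<in>K. cnj (c l) * cis (- (2 * pi * real_of_int l * x)))"
      by (simp add: trig_poly_def cis_cnj)
    finally show ?thesis by (simp add: sum_distrib_left mult_ac)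
  qed
  have "complex_of_real (LINT x|circ. (cmod (trig_poly c K x))\<^sup>2) = 
     (LINT x|circ. (\<Sum>l\<in>K. cnj (c l) * (trig_poly c K x * cis (- (2 * pi * real_of_int l * x)))))"
    unfolding e[symmetric] by (simp only: integral_complex_of_real)
  also have "\<dots> = (\<Sum>l\<in>K. cnj (c l) * (LINT x|circ. trig_poly c K x * cis (- (2 * pi * real_of_int l * x))))"
    by (subst Bochner_Integration.integral_sum)
      (auto intro!: integrable_circ_continuous_complex continuous_intros)
  also have "\<dots> = (\<Sum>l\<in>K. cnj (c l) * c l)"
    unfolding integral_trig_poly_mult_cis[OF assms] by (intro sum.cong) auto
  also have "\<dots> = complex_of_real (\<Sum>k\<in>K. (cmod (c k))\<^sup>2)"
    by (simp add: complex_norm_square mult.commute del: of_real_power)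
  finally show ?thesis by (simp only: of_real_eq_iff)
qed

text \<open>
  Taking the real part only decreases the modulus; this gives the bound for sets of
  frequencies that need not be symmetric.
\<close>

lemma integral_Re_trig_poly_sq:
  assumes "finite K"
  shows "(LINT x|circ. (Re (trig_poly c K x))\<^sup>2) \<le> (\<Sum>k\<in>K. (cmod (c k))\<^sup>2)"
  unfolding integral_trig_poly_norm_sq[OF assms, symmetric]
proof (rule integral_mono)
  show "(Re (trig_poly c K x))\<^sup>2 \<le> (cmod (trig_poly c K x))\<^sup>2" for x
    using abs_Re_le_cmod[of "trig_poly c K x"] by (metis abs_le_square_iff abs_norm_cancel)
qed (auto intro!: integrable_circ_continuous continuous_intros)

lemma fourier_coeff_Re_trig_poly:
  assumes "finite K" "\<And>k. k \<in> K \<Longrightarrow> - k \<in> K" "\<And>k. c (- k) = cnj (c k)"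
  shows "fourier_coeff (\<lambda>x. Re (trig_poly c K x)) l = (if l \<in> K then c l else 0)"
proof -
  have "cnj (trig_poly c K x) = trig_poly c K x" for x
  proof -
    have "cnj (trig_poly c K x) = (\<Sum>k\<in>K. c (- k) * cis (2 * pi * real_of_int (- k) * x))"
      by (simp add: trig_poly_def cis_cnj assms(3))
    also have "\<dots> = trig_poly c K x"
      unfolding trig_poly_def
      by (rule sum.reindex_bij_witness[of _ uminus uminus]) (use assms(2) in auto)
    finally show ?thesis .
  qed
  then have "complex_of_real (Re (trig_poly c K x)) = trig_poly c K x" for x
    by (metis of_real_Re Reals_cnj_iff)
  then show ?thesis
    unfolding fourier_coeff_circ using integral_trig_poly_mult_cis[OF assms(1), of c l] by simp
qed


lemma summable_on_tail:
  fixes a :: "'b \<Rightarrow> real"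
  assumes "a summable_on UNIV" "\<And>k. a k \<ge> 0" "e > 0"
  obtains F where "finite F" "\<And>K. finite K \<Longrightarrow> K \<inter> F = {} \<Longrightarrow> sum a K \<le> e"
proof -
  obtain F where F: "finite F" "dist (sum a F) (infsum a UNIV) \<le> e"
    using has_sum_finite_approximation[OF has_sum_infsum[OF assms(1)] \<open>e > 0\<close>] by auto
  have "sum a K \<le> e" if "finite K" "K \<inter> F = {}" for K
  proof -
    have "sum a K + sum a F = sum a (K \<union> F)" using that F by (simp add: sum.union_disjoint)
    also have "\<dots> \<le> infsum a UNIV" using that F assms by (intro finite_sum_le_infsum) auto
    finally show ?thesis using F by (simp add: dist_real_def abs_le_iff)
  qed
  with F show ?thesis using that by blast
qed

text \<open>
  Completeness of the square-integrable functions. Partial sums along a sequence of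
  symmetric frequency sets \<open>E j\<close> are chosen so that consecutive ones differ by at most
  \<open>2\<^sup>-\<^sup>j\<close> in mean; they then converge almost everywhere and in mean, so that the limit has
  the prescribed coefficients, and Fatou's lemma bounds its square integral. The symmetry of
  \<open>c\<close> makes the function real-valued.
\<close>

lemma Riesz_Fischer:
  fixes c :: "int \<Rightarrow> complex"
  assumes sym: "\<And>k. c (- k) = cnj (c k)" and sm: "(\<lambda>k. (cmod (c k))\<^sup>2) summable_on UNIV"
  obtains g where "L2 g" "\<And>k. fourier_coeff g k = c k"
    "(LINT x|circ. (g x)\<^sup>2) \<le> (\<Sum>\<^sub>\<infinity>k. (cmod (c k))\<^sup>2)"
proof -
  define a where "a k = (cmod (c k))\<^sup>2" for k
  have a0: "a k \<ge> 0" for k by (simp add: a_def)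
  have asm: "a summable_on UNIV" using sm by (simp add: a_def[abs_def])
  have "\<exists>F. finite F \<and> (\<forall>K. finite K \<longrightarrow> K \<inter> F = {} \<longrightarrow> sum a K \<le> (1/4)^j)" for j :: nat
    using summable_on_tail[OF asm a0, of "(1/4)^j"] by (metis zero_less_divide_1_iff zero_less_numeral zero_less_power)
  then obtain F where F: "\<And>j. finite (F j)" "\<And>j K. finite K \<Longrightarrow> K \<inter> F j = {} \<Longrightarrow> sum a K \<le> (1/4)^j"
    by metis
  \<comment> \<open>the intervals make every frequency appear eventually, the reflections make \<open>E j\<close> symmetric,
    and the unions make the sequence increasing\<close>
  define E where "E j = (\<Union>i\<le>j. F i \<union> uminus ` F i) \<union> {- int j..int j}" for j
  have finE: "finite (E j)" for j using F(1) by (auto simp: E_def)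
  have symE: "- k \<in> E j" if "k \<in> E j" for k j using that by (auto simp: E_def image_iff)
  have monoE: "E j \<subseteq> E (Suc j)" for j by (auto simp: E_def le_Suc_eq)
  have FE: "F j \<subseteq> E j" for j by (auto simp: E_def)
  have inE: "k \<in> E j" if "nat \<bar>k\<bar> \<le> j" for k j using that by (auto simp: E_def)
  define S where "S j x = Re (trig_poly c (E j) x)" for j x
  define d where "d j x = S (Suc j) x - S j x" for j x
  have cS: "continuous_on {0..1} (S j)" for j unfolding S_def[abs_def] by (intro continuous_intros)
  have cd: "continuous_on {0..1} (d j)" for j unfolding d_def[abs_def] by (intro continuous_intros cS)
  have d_eq: "d j x = Re (trig_poly c (E (Suc j) - E j) x)" for j x
    unfolding d_def S_def trig_poly_def using sum_diff[OF finE monoE] by (metis (no_types, lifting) minus_complex.simps(1))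
  have d1: "(LINT x|circ. \<bar>d j x\<bar>) \<le> (1/2)^j" for j
  proof -
    have "(LINT x|circ. (d j x)\<^sup>2) \<le> sum a (E (Suc j) - E j)"
      unfolding d_eq a_def using finE by (intro integral_Re_trig_poly_sq) auto
    also have "\<dots> \<le> (1/4)^j" using F(2)[of "E (Suc j) - E j" j] FE[of j] finE by auto
    finally have "sqrt (LINT x|circ. (d j x)\<^sup>2) \<le> sqrt ((1/4)^j)" by (rule real_sqrt_le_mono)
    also have "sqrt ((1/4)^j) = (1/2::real)^j" by (simp add: real_sqrt_power real_sqrt_divide)
    finally show ?thesis using L2_integral_abs_le[OF L2_continuous[OF cd], of j] by linarith
  qed
  have id: "integrable circ (d j)" for j by (rule integrable_circ_continuous[OF cd])
  have [measurable]: "d j \<in> borel_measurable circ" "S j \<in> borel_measurable circ" for j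
    by (auto intro: borel_measurable_circ_continuous cd cS)
  have sumd1: "summable (\<lambda>j. LINT x|circ. \<bar>d j x\<bar>)"
    by (rule summable_comparison_test[of _ "\<lambda>j. (1/2)^j"]) (use d1 in \<open>auto simp: summable_geometric\<close>)
  have "(\<integral>\<^sup>+x. (\<Sum>j. ennreal \<bar>d j x\<bar>) \<partial>circ) = (\<Sum>j. \<integral>\<^sup>+x. ennreal \<bar>d j x\<bar> \<partial>circ)"
    by (rule nn_integral_suminf) measurable
  also have "\<dots> = (\<Sum>j. ennreal (LINT x|circ. \<bar>d j x\<bar>))"
    using id by (simp add: nn_integral_eq_integral)
  also have "\<dots> \<noteq> \<infinity>" using sumd1 by (simp add: ennreal_suminf_neq_top)
  finally have "AE x in circ. (\<Sum>j. ennreal \<bar>d j x\<bar>) \<noteq> \<infinity>"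
    by (intro nn_integral_PInf_AE) auto
  then have AEs: "AE x in circ. summable (\<lambda>j. \<bar>d j x\<bar>)"
    by eventually_elim (auto intro: summable_suminf_not_top)
  define g where "g x = S 0 x + (\<Sum>j. d j x)" for x
  have [measurable]: "g \<in> borel_measurable circ" unfolding g_def[abs_def] by measurable
  have ig: "integrable circ (\<lambda>x. \<Sum>j. d j x)"
    by (rule integrable_suminf) (use id AEs sumd1 in auto)
  have Slim: "AE x in circ. (\<lambda>j. S j x) \<longlonglongrightarrow> g x"
    using AEs
  proof eventually_elim
    case (elim x)
    then have "summable (\<lambda>j. d j x)" by (rule summable_rabs_cancel)
    then have "(\<lambda>n. \<Sum>j<n. d j x) \<longlonglongrightarrow> (\<Sum>j. d j x)" by (rule summable_LIMSEQ)
    then have "(\<lambda>n. S 0 x + (\<Sum>j<n. d j x)) \<longlonglongrightarrow> g x" unfolding g_def by (intro tendsto_intros)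
    also have "(\<lambda>n. S 0 x + (\<Sum>j<n. d j x)) = (\<lambda>n. S n x)"
      unfolding d_def using sum_lessThan_telescope[of "\<lambda>j. S j x"] by auto
    finally show ?case .
  qed
  have coS: "fourier_coeff (S j) k = (if k \<in> E j then c k else 0)" for j k
    unfolding S_def[abs_def] using finE symE sym by (intro fourier_coeff_Re_trig_poly) auto
  have cog: "fourier_coeff g k = c k" for k
  proof -
    let ?e = "\<lambda>x. cis (- (2 * pi * real_of_int k * x))"
    have "(\<lambda>j. LINT x|circ. complex_of_real (d j x) * ?e x) sums (LINT x|circ. (\<Sum>j. complex_of_real (d j x) * ?e x))"
    proof (rule sums_integral)
      show "integrable circ (\<lambda>x. complex_of_real (d j x) * ?e x)" for j by (rule fourier_integrable[OF id])
      show "AE x in circ. summable (\<lambda>j. cmod (complex_of_real (d j x) * ?e x))"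
        using AEs by eventually_elim (simp add: norm_mult)
      show "summable (\<lambda>j. LINT x|circ. cmod (complex_of_real (d j x) * ?e x))"
        using sumd1 by (simp add: norm_mult)
    qed
    also have "(LINT x|circ. (\<Sum>j. complex_of_real (d j x) * ?e x)) = fourier_coeff (\<lambda>x. \<Sum>j. d j x) k"
      unfolding fourier_coeff_circ
    proof (rule integral_cong_AE)
      have [measurable]: "?e \<in> borel_measurable circ"
        by (intro borel_measurable_circ_continuous continuous_intros)
      show "(\<lambda>x. \<Sum>j. complex_of_real (d j x) * ?e x) \<in> borel_measurable circ" by measurable
      show "(\<lambda>x. complex_of_real (\<Sum>j. d j x) * ?e x) \<in> borel_measurable circ" by measurable
      show "AE x in circ. (\<Sum>j. complex_of_real (d j x) * ?e x) = complex_of_real (\<Sum>j. d j x) * ?e x"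
        using AEs
      proof eventually_elim
        case (elim x)
        then have "summable (\<lambda>j. d j x)" by (rule summable_rabs_cancel)
        then show ?case by (simp add: suminf_mult2[symmetric] suminf_of_real summable_of_real)
      qed
    qed
    finally have "(\<lambda>j. fourier_coeff (S (Suc j)) k - fourier_coeff (S j) k) sums fourier_coeff (\<lambda>x. \<Sum>j. d j x) k"
      unfolding d_def[abs_def] fourier_coeff_circ[symmetric]
      using integrable_circ_continuous[OF cS] by (simp add: fourier_coeff_diff)
    moreover have "(\<lambda>j. fourier_coeff (S j) k) \<longlonglongrightarrow> c k"
    proof (rule tendsto_eventually)
      show "\<forall>\<^sub>F j in sequentially. fourier_coeff (S j) k = c k"
        using eventually_ge_at_top[of "nat \<bar>k\<bar>"] by eventually_elim (simp add: coS inE)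
    qed
    then have "(\<lambda>j. fourier_coeff (S (Suc j)) k - fourier_coeff (S j) k) sums (c k - fourier_coeff (S 0) k)"
      by (rule telescope_sums)
    ultimately have "fourier_coeff (\<lambda>x. \<Sum>j. d j x) k = c k - fourier_coeff (S 0) k" by (rule sums_unique2)
    then show ?thesis
      unfolding g_def[abs_def] using integrable_circ_continuous[OF cS] ig by (simp add: fourier_coeff_add)
  qed
  define s where "s = infsum a UNIV"
  have "(\<integral>\<^sup>+x. ennreal ((g x)\<^sup>2) \<partial>circ) = (\<integral>\<^sup>+x. liminf (\<lambda>j. ennreal ((S j x)\<^sup>2)) \<partial>circ)"
  proof (rule nn_integral_cong_AE)
    show "AE x in circ. ennreal ((g x)\<^sup>2) = liminf (\<lambda>j. ennreal ((S j x)\<^sup>2))"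
      using Slim
    proof eventually_elim
      case (elim x)
      then have "(\<lambda>j. ennreal ((S j x)\<^sup>2)) \<longlonglongrightarrow> ennreal ((g x)\<^sup>2)"
        by (intro tendsto_ennrealI tendsto_intros)
      then show ?case by (intro lim_imp_Liminf[symmetric]) auto
    qed
  qed
  also have "\<dots> \<le> liminf (\<lambda>j. \<integral>\<^sup>+x. ennreal ((S j x)\<^sup>2) \<partial>circ)"
    by (rule nn_integral_liminf) measurable
  also have "\<dots> \<le> ennreal s"
  proof -
    have "(\<integral>\<^sup>+x. ennreal ((S j x)\<^sup>2) \<partial>circ) \<le> ennreal s" for j
    proof -
      have "(\<integral>\<^sup>+x. ennreal ((S j x)\<^sup>2) \<partial>circ) = ennreal (LINT x|circ. (S j x)\<^sup>2)"
        by (intro nn_integral_eq_integral integrable_circ_continuous continuous_intros cS) auto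
      also have "(LINT x|circ. (S j x)\<^sup>2) \<le> sum a (E j)"
        unfolding S_def a_def by (rule integral_Re_trig_poly_sq[OF finE])
      also have "\<dots> \<le> s" unfolding s_def using asm finE a0 by (intro finite_sum_le_infsum) auto
      finally show ?thesis by (simp add: ennreal_leI)
    qed
    then have "liminf (\<lambda>j. \<integral>\<^sup>+x. ennreal ((S j x)\<^sup>2) \<partial>circ) \<le> liminf (\<lambda>j::nat. ennreal s)"
      by (intro Liminf_mono always_eventually allI)
    then show ?thesis by (simp add: Liminf_const)
  qed
  finally have le: "(\<integral>\<^sup>+x. ennreal ((g x)\<^sup>2) \<partial>circ) \<le> ennreal s" .
  have s0: "s \<ge> 0" unfolding s_def using a0 by (intro infsum_nonneg) auto
  have ig2: "integrable circ (\<lambda>x. (g x)\<^sup>2)"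
    by (rule integrableI_bounded) (use le in \<open>auto simp: less_top[symmetric] top_unique\<close>)
  have "(LINT x|circ. (g x)\<^sup>2) \<le> s"
    using le s0 nn_integral_eq_integral[OF ig2] by (simp add: ennreal_le_iff)
  moreover have "L2 g" using ig2 by (simp add: L2_def)
  ultimately show ?thesis using that[of g] cog by (simp add: s_def a_def[abs_def])
qed

section \<open>Sobolev functions on the circle\<close>

lemma sobolev_weight_mono: "r \<le> s \<Longrightarrow> sobolev_weight r k \<le> sobolev_weight s k"
  unfolding sobolev_weight_def by (rule powr_mono) auto

lemma sobolev_weight_0 [simp]: "sobolev_weight 0 k = 1"
  unfolding sobolev_weight_def by (simp add: add_nonneg_eq_0_iff)

lemma sobolev_weight_1: "sobolev_weight 1 k = 1 + (2 * pi * real_of_int k)\<^sup>2"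
  unfolding sobolev_weight_def by (simp add: add_nonneg_eq_0_iff)

lemma sobolev_weight_2: "sobolev_weight 2 k = (1 + (2 * pi * real_of_int k)\<^sup>2)\<^sup>2"
  unfolding sobolev_weight_def by (subst powr_numeral) (auto simp: add_nonneg_eq_0_iff)

lemma sobolev_weight_nonneg [simp]: "0 \<le> sobolev_weight s k"
  by (simp add: sobolev_weight_def)

lemma sobolev_L2: "f \<in> sobolev s \<Longrightarrow> L2 f"
  by (auto simp: sobolev_def L2_def set_integrable_circ borel_measurable_circ)

lemma sobolev_summable:
  assumes "f \<in> sobolev s" "r \<le> s"
  shows "(\<lambda>k. sobolev_weight r k * (cmod (fourier_coeff f k))\<^sup>2) summable_on UNIV"
proof (rule summable_on_comparison_test)
  show "(\<lambda>k. sobolev_weight s k * (cmod (fourier_coeff f k))\<^sup>2) summable_on UNIV"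
    using assms by (simp add: sobolev_def)
qed (use assms in \<open>auto intro!: mult_right_mono sobolev_weight_mono\<close>)

lemma sobolev_mono: "f \<in> sobolev s \<Longrightarrow> r \<le> s \<Longrightarrow> f \<in> sobolev r"
  using sobolev_summable[of f s r] by (auto simp: sobolev_def)

lemma sobolev_norm_sq:
  "(sobolev_norm s f)\<^sup>2 = (\<Sum>\<^sub>\<infinity>k\<in>UNIV. sobolev_weight s k * (cmod (fourier_coeff f k))\<^sup>2)"
  unfolding sobolev_norm_def by (intro real_sqrt_pow2 infsum_nonneg) auto

lemma sobolev_norm_nonneg: "0 \<le> sobolev_norm s f"
  unfolding sobolev_norm_def by (intro real_sqrt_ge_zero infsum_nonneg) auto

lemma sobolev_norm_mono:
  assumes "f \<in> sobolev s" "r \<le> s"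
  shows "sobolev_norm r f \<le> sobolev_norm s f"
  unfolding sobolev_norm_def
  by (intro real_sqrt_le_mono infsum_mono sobolev_summable[OF assms] sobolev_summable[OF assms(1)]
      mult_right_mono sobolev_weight_mono assms) auto

lemma sobolev_cmult:
  assumes "f \<in> sobolev s"
  shows "(\<lambda>x. c * f x) \<in> sobolev s"
proof -
  have "(\<lambda>k. c\<^sup>2 * (sobolev_weight s k * (cmod (fourier_coeff f k))\<^sup>2)) summable_on UNIV"
    using assms by (intro summable_on_cmult_right) (simp add: sobolev_def)
  then show ?thesis
    using L2_cmult[OF sobolev_L2[OF assms], of c] assms
    by (auto simp: sobolev_def L2_def set_integrable_circ fourier_coeff_cmult norm_mult power_mult_distrib mult_ac)
qed

lemma sobolev_add:
  assumes f: "f \<in> sobolev s" and g: "g \<in> sobolev s"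
  shows "(\<lambda>x. f x + g x) \<in> sobolev s"
proof -
  note L = sobolev_L2[OF f] sobolev_L2[OF g]
  have "(\<lambda>k. sobolev_weight s k * (cmod (fourier_coeff (\<lambda>x. f x + g x) k))\<^sup>2) summable_on UNIV"
  proof (rule summable_on_comparison_test)
    show "(\<lambda>k. 2 * (sobolev_weight s k * (cmod (fourier_coeff f k))\<^sup>2) + 2 * (sobolev_weight s k * (cmod (fourier_coeff g k))\<^sup>2)) summable_on UNIV"
      using f g by (intro summable_on_add summable_on_cmult_right) (simp_all add: sobolev_def)
    fix k :: int
    have "(cmod (fourier_coeff (\<lambda>x. f x + g x) k))\<^sup>2 \<le> (cmod (fourier_coeff f k) + cmod (fourier_coeff g k))\<^sup>2"
      using L by (intro power_mono) (auto simp: fourier_coeff_add L2_integrable norm_triangle_ineq)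
    also have "\<dots> \<le> 2 * (cmod (fourier_coeff f k))\<^sup>2 + 2 * (cmod (fourier_coeff g k))\<^sup>2"
      using sum_squares_bound[of "cmod (fourier_coeff f k)" "cmod (fourier_coeff g k)"]
      by (simp add: power2_sum)
    finally have "sobolev_weight s k * (cmod (fourier_coeff (\<lambda>x. f x + g x) k))\<^sup>2
       \<le> sobolev_weight s k * (2 * (cmod (fourier_coeff f k))\<^sup>2 + 2 * (cmod (fourier_coeff g k))\<^sup>2)"
      by (rule mult_left_mono) simp
    then show "sobolev_weight s k * (cmod (fourier_coeff (\<lambda>x. f x + g x) k))\<^sup>2 \<le> 
      2 * (sobolev_weight s k * (cmod (fourier_coeff f k))\<^sup>2) + 2 * (sobolev_weight s k * (cmod (fourier_coeff g k))\<^sup>2)"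
      by (simp add: algebra_simps)
  qed auto
  then show ?thesis using f g L2_add[OF L]
    by (auto simp: sobolev_def L2_def set_integrable_circ)
qed

lemma sobolev_diff:
  "f \<in> sobolev s \<Longrightarrow> g \<in> sobolev s \<Longrightarrow> (\<lambda>x. f x - g x) \<in> sobolev s"
  using sobolev_add[of f s "\<lambda>x. (-1) * g x"] sobolev_cmult[of g s "-1"] by simp

lemma sobolev_difference_quotient:
  "f \<in> sobolev s \<Longrightarrow> g \<in> sobolev s \<Longrightarrow> h \<in> sobolev s \<Longrightarrow> (\<lambda>x. (f x - g x) / c - h x) \<in> sobolev s"
  using sobolev_diff[OF sobolev_cmult[OF sobolev_diff[of f s g], of "1/c"], of h] by simp

text \<open>
  The half of Parseval's identity that is not Bessel's inequality: the function given by
  Riesz-Fischer for the coefficients of \<open>f\<close> is \<open>f\<close> itself.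
\<close>

lemma L2_norm_le_coeffs:
  assumes "L2 f" "(\<lambda>k. (cmod (fourier_coeff f k))\<^sup>2) summable_on UNIV"
  shows "(LINT x|circ. (f x)\<^sup>2) \<le> (\<Sum>\<^sub>\<infinity>k. (cmod (fourier_coeff f k))\<^sup>2)"
proof -
  obtain g where g: "L2 g" "\<And>k. fourier_coeff g k = fourier_coeff f k"
    "(LINT x|circ. (g x)\<^sup>2) \<le> (\<Sum>\<^sub>\<infinity>k. (cmod (fourier_coeff f k))\<^sup>2)"
    using Riesz_Fischer[of "fourier_coeff f"] assms fourier_coeff_uminus by blast
  have "AE x in circ. f x - g x = 0"
    using assms g by (intro fourier_coeff_unique) (auto simp: fourier_coeff_diff L2_integrable)
  then have "(LINT x|circ. (f x)\<^sup>2) = (LINT x|circ. (g x)\<^sup>2)"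
    using assms g by (intro integral_cong_AE) (auto simp: L2_measurable)
  with g show ?thesis by simp
qed

lemma sobolev_L2_norm_le:
  assumes "f \<in> sobolev s" "s \<ge> 0"
  shows "(LINT x|circ. (f x)\<^sup>2) \<le> (sobolev_norm s f)\<^sup>2"
proof -
  have "(LINT x|circ. (f x)\<^sup>2) \<le> (sobolev_norm 0 f)\<^sup>2"
    unfolding sobolev_norm_sq using L2_norm_le_coeffs[OF sobolev_L2[OF assms(1)]] sobolev_summable[OF assms] by simp
  also have "\<dots> \<le> (sobolev_norm s f)\<^sup>2"
    using sobolev_norm_mono[OF assms] sobolev_norm_nonneg by (intro power_mono)
  finally show ?thesis .
qed

lemma primitive_fourier_coeff:
  assumes F: "primitive F f" and per: "F 0 = F 1"
  shows "fourier_coeff f k = \<i> * of_real (2 * pi * real_of_int k) * fourier_coeff F k"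
proof -
  let ?w = "2 * pi * real_of_int k"
  have c: "cos ?w = 1" "sin ?w = 0" using cos_int_2pin[of k] sin_int_2pin[of k] by (simp_all add: mult.commute)
  note cF = primitive_continuous[OF F] and iF = primitive_integrable[OF F]
  have i1: "integrable circ (\<lambda>x. f x * cos (?w * x))" "integrable circ (\<lambda>x. f x * sin (?w * x))"
    using integrable_circ_mult_continuous[OF iF, of "\<lambda>x. cos (?w * x)"] 
      integrable_circ_mult_continuous[OF iF, of "\<lambda>x. sin (?w * x)"] 
    by (simp_all add: mult.commute[of "f _"] continuous_intros)
  have i2: "integrable circ (\<lambda>x. F x * cos (?w * x))" "integrable circ (\<lambda>x. F x * sin (?w * x))"
    by (auto intro!: integrable_circ_continuous continuous_intros cF)
  have "primitive (\<lambda>x. cos (?w * x)) (\<lambda>x. - ?w * sin (?w * x))"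
    by (rule primitive_of_continuous_deriv) (auto intro!: derivative_eq_intros continuous_intros)
  from primitive_integral[OF primitive_mult[OF F this]] per c
  have "(LINT x|circ. f x * cos (?w * x) - ?w * (F x * sin (?w * x))) = 0" by (simp add: mult_ac)
  then have A: "(LINT x|circ. f x * cos (?w * x)) = ?w * (LINT x|circ. F x * sin (?w * x))" using i1 i2 by simp
  have "primitive (\<lambda>x. sin (?w * x)) (\<lambda>x. ?w * cos (?w * x))"
    by (rule primitive_of_continuous_deriv) (auto intro!: derivative_eq_intros continuous_intros)
  from primitive_integral[OF primitive_mult[OF F this]] per c
  have "(LINT x|circ. f x * sin (?w * x) + ?w * (F x * cos (?w * x))) = 0" by (simp add: mult_ac)
  then have B: "(LINT x|circ. f x * sin (?w * x)) = - ?w * (LINT x|circ. F x * cos (?w * x))" using i1 i2 by simp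
  show ?thesis
    unfolding fourier_coeff_cos_sin[OF iF] fourier_coeff_cos_sin[OF integrable_circ_continuous[OF cF]] A B
    by (simp add: complex_eq_iff)
qed

text \<open>
  The oscillation of \<open>F\<close> is at most \<open>\<integral> \<bar>f\<bar> \<le> S\<close>, and so is the modulus of its mean.
\<close>

lemma primitive_bound:
  assumes F: "primitive F f" and f: "L2 f"
    and S: "(LINT x|circ. (f x)\<^sup>2) \<le> S\<^sup>2" "\<bar>LINT x|circ. F x\<bar> \<le> S" and x: "x \<in> {0..1}"
  shows "\<bar>F x\<bar> \<le> 2 * S"
proof -
  have S0: "S \<ge> 0" using S(2) by linarith
  have d: "\<bar>F y - F z\<bar> \<le> S" if "0 \<le> z" "z \<le> y" "y \<le> 1" for y z
  proof -
    have "\<bar>F y - F z\<bar> \<le> (LINT t|circ. \<bar>indicat_real {z..y} t * f t\<bar>)"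
      unfolding primitive_diff_integral[OF F that] by (rule integral_abs_bound)
    also have "\<dots> \<le> (LINT t|circ. \<bar>f t\<bar>)"
      using integrable_circ_indicator[OF L2_integrable[OF f]] L2_integrable[OF f]
      by (intro integral_mono) (auto simp: indicator_def)
    also have "\<dots> \<le> sqrt (LINT t|circ. (f t)\<^sup>2)" by (rule L2_integral_abs_le[OF f])
    also have "\<dots> \<le> sqrt (S\<^sup>2)" using S(1) by (rule real_sqrt_le_mono)
    finally show ?thesis using S0 by simp
  qed
  have d': "\<bar>F x - F y\<bar> \<le> S" if "y \<in> {0..1}" for y
    using d[of x y] d[of y x] x that by (cases "x \<le> y") (auto simp: abs_minus_commute)
  have iF: "integrable circ F" by (rule integrable_circ_continuous[OF primitive_continuous[OF F]])
  have "F x - (LINT y|circ. F y) = (LINT y|circ. F x - F y)" using iF by simp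
  also have "\<bar>\<dots>\<bar> \<le> (LINT y|circ. S)" by (rule integral_abs_bound_integral) (use iF d' in auto)
  finally have "\<bar>F x - (LINT y|circ. F y)\<bar> \<le> S" by simp
  with S(2) show ?thesis by linarith
qed

text \<open>
  The central embedding lemma. Riesz-Fischer provides a square-integrable \<open>g\<close> with the
  coefficients that a derivative of \<open>f\<close> must have; its primitive has, up to a constant, the coefficients
  of \<open>f\<close>, and uniqueness identifies it with \<open>f\<close> almost everywhere.
\<close>

lemma weak_derivative:
  assumes f: "L2 f" and sm: "(\<lambda>k. sobolev_weight 1 k * (cmod (fourier_coeff f k))\<^sup>2) summable_on UNIV"
    and S: "(\<Sum>\<^sub>\<infinity>k. sobolev_weight 1 k * (cmod (fourier_coeff f k))\<^sup>2) \<le> S\<^sup>2" "S \<ge> 0"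
  obtains F g where "primitive F g" "L2 g" "AE x in circ. f x = F x" "F 0 = F 1"
    "\<And>k. fourier_coeff g k = \<i> * of_real (2 * pi * real_of_int k) * fourier_coeff f k"
    "(LINT x|circ. (g x)\<^sup>2) \<le> S\<^sup>2" "\<And>x. x \<in> {0..1} \<Longrightarrow> \<bar>F x\<bar> \<le> 2 * S"
proof -
  define c where "c k = \<i> * of_real (2 * pi * real_of_int k) * fourier_coeff f k" for k
  have csq: "(cmod (c k))\<^sup>2 = (2 * pi * real_of_int k)\<^sup>2 * (cmod (fourier_coeff f k))\<^sup>2" for k
    by (simp add: c_def norm_mult power_mult_distrib)
  have cle: "(cmod (c k))\<^sup>2 \<le> sobolev_weight 1 k * (cmod (fourier_coeff f k))\<^sup>2" for k
    unfolding csq sobolev_weight_1 by (intro mult_right_mono) auto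
  have smc: "(\<lambda>k. (cmod (c k))\<^sup>2) summable_on UNIV"
    by (rule summable_on_comparison_test[OF sm]) (use cle in auto)
  have "c (- k) = cnj (c k)" for k by (simp add: c_def fourier_coeff_uminus)
  from Riesz_Fischer[OF this smc] obtain g where g: "L2 g" "\<And>k. fourier_coeff g k = c k"
    "(LINT x|circ. (g x)\<^sup>2) \<le> (\<Sum>\<^sub>\<infinity>k. (cmod (c k))\<^sup>2)" by metis
  have "(\<Sum>\<^sub>\<infinity>k. (cmod (c k))\<^sup>2) \<le> (\<Sum>\<^sub>\<infinity>k. sobolev_weight 1 k * (cmod (fourier_coeff f k))\<^sup>2)"
    by (intro infsum_mono smc sm cle)
  with g(3) S have gS: "(LINT x|circ. (g x)\<^sup>2) \<le> S\<^sup>2" by linarith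
  define G where "G x = (LINT y|circ. indicat_real {0..x} y * g y)" for x
  have "(LINT y|circ. indicat_real {0..0} y * g y) = (LINT y|circ. 0 * g y)"
  proof (rule integral_cong_AE)
    show "(\<lambda>y. indicat_real {0..0} y * g y) \<in> borel_measurable circ"
      using integrable_circ_indicator[OF L2_integrable[OF g(1)]] by blast
    show "AE x in circ. indicat_real {0..0} x * g x = 0 * g x"
      using AE_circ_neq[of 0] by eventually_elim simp
  qed simp
  then have G0: "G 0 = 0" by (simp add: G_def)
  have pG: "primitive G g" unfolding primitive_def using L2_integrable[OF g(1)] G0 by (simp add: G_def)
  have "fourier_coeff g 0 = 0" using g(2) by (simp add: c_def)
  then have G1: "G 1 = G 0" using primitive_integral[OF pG] fourier_coeff_0[of g] by simp
  note iG = integrable_circ_continuous[OF primitive_continuous[OF pG]]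
  have coG: "fourier_coeff G k = fourier_coeff f k" if "k \<noteq> 0" for k
    using primitive_fourier_coeff[OF pG G1[symmetric], of k] g(2)[of k] that by (simp add: c_def)
  \<comment> \<open>the constant that corrects the coefficient of frequency \<open>0\<close>\<close>
  define m where "m = (LINT x|circ. f x) - (LINT x|circ. G x)"
  define F where "F x = G x + m" for x
  have pF: "primitive F g" using primitive_add[OF pG primitive_const[of m]] by (simp add: F_def[abs_def])
  have "fourier_coeff (\<lambda>x. m) k = 0" if "k \<noteq> 0" for k
    using primitive_fourier_coeff[OF primitive_const[of m], of k] that by (simp add: fourier_coeff_circ)
  then have "fourier_coeff (\<lambda>x. f x - F x) k = 0" for k
    using coG[of k] iG L2_integrable[OF f] unfolding F_def
    by (cases "k = 0") (simp_all add: fourier_coeff_diff fourier_coeff_add fourier_coeff_0 m_def)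
  then have "AE x in circ. f x - F x = 0"
    using f iG L2_integrable[OF f] by (intro fourier_coeff_unique) (auto simp: F_def)
  then have AEF: "AE x in circ. f x = F x" by simp
  have "(LINT x|circ. F x) = (LINT x|circ. f x)" using iG by (simp add: F_def m_def)
  then have "(LINT x|circ. F x)\<^sup>2 = sobolev_weight 1 0 * (cmod (fourier_coeff f 0))\<^sup>2"
    by (simp add: fourier_coeff_0 sobolev_weight_1)
  also have "\<dots> = (\<Sum>k\<in>{0}. sobolev_weight 1 k * (cmod (fourier_coeff f k))\<^sup>2)" by simp
  also have "\<dots> \<le> (\<Sum>\<^sub>\<infinity>k. sobolev_weight 1 k * (cmod (fourier_coeff f k))\<^sup>2)"
    by (rule finite_sum_le_infsum[OF sm]) auto
  finally have "(LINT x|circ. F x)\<^sup>2 \<le> S\<^sup>2" using S by linarith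
  then have "\<bar>LINT x|circ. F x\<bar> \<le> S" using S(2) by (simp add: abs_le_square_iff[symmetric])
  from primitive_bound[OF pF g(1) gS this] have "\<And>x. x \<in> {0..1} \<Longrightarrow> \<bar>F x\<bar> \<le> 2 * S" .
  then show ?thesis using that[OF pF g(1) AEF] G1 g(2) gS by (simp add: F_def c_def)
qed

lemma sobolev_1_representative:
  assumes h: "h \<in> sobolev s" "s \<ge> 1"
  obtains F f where "primitive F f" "L2 f" "AE x in circ. h x = F x"
proof -
  have "(\<Sum>\<^sub>\<infinity>k. sobolev_weight 1 k * (cmod (fourier_coeff h k))\<^sup>2) \<le> (sobolev_norm 1 h)\<^sup>2" 
    by (simp add: sobolev_norm_sq)
  from sobolev_L2[OF h(1)] sobolev_summable[OF h] this sobolev_norm_nonneg show ?thesis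
    by (rule weak_derivative) (use that in blast)
qed

text \<open>
  Here \<open>F\<close> is a continuous representative of \<open>h\<close> that is already known, such as a difference
  quotient in time minus its expected limit, and \<open>weak_derivative\<close> only supplies the bounds.
\<close>

lemma sobolev_1_estimate:
  assumes h: "h \<in> sobolev s" "s \<ge> 1" and F: "primitive F f" "AE x in circ. h x = F x"
  shows "\<And>x. x \<in> {0..1} \<Longrightarrow> \<bar>F x\<bar> \<le> 2 * sobolev_norm s h" "L2 f"
    "(LINT x|circ. (f x)\<^sup>2) \<le> (sobolev_norm s h)\<^sup>2"
proof -
  have "(sobolev_norm 1 h)\<^sup>2 \<le> (sobolev_norm s h)\<^sup>2"
    using sobolev_norm_mono[OF h] sobolev_norm_nonneg by (intro power_mono)
  then have "(\<Sum>\<^sub>\<infinity>k. sobolev_weight 1 k * (cmod (fourier_coeff h k))\<^sup>2) \<le> (sobolev_norm s h)\<^sup>2" 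
    by (simp add: sobolev_norm_sq)
  from sobolev_L2[OF h(1)] sobolev_summable[OF h] this sobolev_norm_nonneg
  obtain G g where G: "primitive G g" "L2 g" "AE x in circ. h x = G x"
    "(LINT x|circ. (g x)\<^sup>2) \<le> (sobolev_norm s h)\<^sup>2" "\<And>x. x \<in> {0..1} \<Longrightarrow> \<bar>G x\<bar> \<le> 2 * (sobolev_norm s h)"
    by (rule weak_derivative) blast
  have AE: "AE x in circ. F x = G x" using F(2) G(3) by eventually_elim simp
  show "\<bar>F x\<bar> \<le> 2 * sobolev_norm s h" if "x \<in> {0..1}" for x
    using G(5)[OF that] AE_circ_eq_continuous[OF AE primitive_continuous[OF F(1)] primitive_continuous[OF G(1)] that] by simp
  have AE2: "AE x in circ. f x = g x" by (rule primitive_unique_AE[OF F(1) G(1) AE])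
  have [measurable]: "f \<in> borel_measurable circ" "g \<in> borel_measurable circ"
    using F(1) G(1) by (auto simp: primitive_def)
  have AE3: "AE x in circ. (f x)\<^sup>2 = (g x)\<^sup>2" using AE2 by eventually_elim simp
  have "integrable circ (\<lambda>x. (f x)\<^sup>2) \<longleftrightarrow> integrable circ (\<lambda>x. (g x)\<^sup>2)"
    by (rule integrable_cong_AE) (use AE3 in simp_all)
  then show "L2 f" using L2_sq_integrable[OF G(2)] by (simp add: L2_def)
  have "(LINT x|circ. (f x)\<^sup>2) = (LINT x|circ. (g x)\<^sup>2)"
    by (rule integral_cong_AE) (use AE3 in simp_all)
  then show "(LINT x|circ. (f x)\<^sup>2) \<le> (sobolev_norm s h)\<^sup>2" using G(4) by simp
qed

lemma sobolev_1_primitive: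
  assumes h: "h \<in> sobolev s" "s \<ge> 1" and c: "continuous_on UNIV h"
  obtains f where "primitive h f" "L2 f"
proof -
  obtain F f where F: "primitive F f" "L2 f" "AE x in circ. h x = F x" using sobolev_1_representative[OF h] by metis
  have "h x = F x" if "x \<in> {0..1}" for x
    by (rule AE_circ_eq_continuous[OF F(3) continuous_on_subset[OF c] primitive_continuous[OF F(1)] that]) simp
  then have "primitive h f" by (intro primitive_cong[OF F(1)]) (use F(2) in \<open>auto simp: L2_measurable\<close>)
  with F(2) that show ?thesis by blast
qed

text \<open>
  Two applications of the weak derivative. Periodicity yields the derivative at
  the end points \<open>0\<close> and \<open>1\<close> of the period from the one-sided derivatives there.
\<close>

lemma sobolev_2_primitive:
  assumes h: "h \<in> sobolev s" "s \<ge> 2" and c: "continuous_on UNIV h"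
  obtains p q where "primitive h p" "primitive p q" "L2 q"
    "\<And>x. x \<in> {0..1} \<Longrightarrow> (h has_real_derivative p x) (at x)"
    "\<And>x. x \<in> {0..1} \<Longrightarrow> \<bar>p x\<bar> \<le> 2 * sobolev_norm s h"
proof -
  have h1: "s \<ge> 1" using h by simp
  have "(\<Sum>\<^sub>\<infinity>k. sobolev_weight 1 k * (cmod (fourier_coeff h k))\<^sup>2) \<le> (sobolev_norm 1 h)\<^sup>2" 
    by (simp add: sobolev_norm_sq)
  from sobolev_L2[OF h(1)] sobolev_summable[OF h(1) h1] this sobolev_norm_nonneg
  obtain F g where F: "primitive F g" "L2 g" "AE x in circ. h x = F x" 
    "\<And>k. fourier_coeff g k = \<i> * of_real (2 * pi * real_of_int k) * fourier_coeff h k"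
    by (rule weak_derivative) blast
  have le: "sobolev_weight 1 k * (cmod (fourier_coeff g k))\<^sup>2 \<le> sobolev_weight s k * (cmod (fourier_coeff h k))\<^sup>2" for k
  proof -
    have "sobolev_weight 1 k * (cmod (fourier_coeff g k))\<^sup>2 = 
      sobolev_weight 1 k * (2 * pi * real_of_int k)\<^sup>2 * (cmod (fourier_coeff h k))\<^sup>2"
      by (simp add: F(4) norm_mult power_mult_distrib)
    also have "\<dots> \<le> sobolev_weight 2 k * (cmod (fourier_coeff h k))\<^sup>2"
      unfolding sobolev_weight_1 sobolev_weight_2 
      by (intro mult_right_mono) (auto simp: power2_eq_square[of "1 + _"] intro!: mult_left_mono)
    also have "\<dots> \<le> sobolev_weight s k * (cmod (fourier_coeff h k))\<^sup>2"
      by (intro mult_right_mono sobolev_weight_mono h) auto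
    finally show ?thesis .
  qed
  have smh: "(\<lambda>k. sobolev_weight s k * (cmod (fourier_coeff h k))\<^sup>2) summable_on UNIV"
    by (rule sobolev_summable[OF h(1)]) simp
  have smg: "(\<lambda>k. sobolev_weight 1 k * (cmod (fourier_coeff g k))\<^sup>2) summable_on UNIV"
    by (rule summable_on_comparison_test[OF smh]) (use le in auto)
  have gS: "(\<Sum>\<^sub>\<infinity>k. sobolev_weight 1 k * (cmod (fourier_coeff g k))\<^sup>2) \<le> (sobolev_norm s h)\<^sup>2"
    unfolding sobolev_norm_sq by (rule infsum_mono[OF smg smh le])
  obtain p q where p: "primitive p q" "L2 q" "AE x in circ. g x = p x" "p 0 = p 1"
    "\<And>x. x \<in> {0..1} \<Longrightarrow> \<bar>p x\<bar> \<le> 2 * sobolev_norm s h"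
    by (rule weak_derivative[OF F(2) smg gS sobolev_norm_nonneg]) blast
  have cp: "continuous_on {0..1} p" by (rule primitive_continuous[OF p(1)])
  have "h x = F x" if "x \<in> {0..1}" for x
    by (rule AE_circ_eq_continuous[OF F(3) continuous_on_subset[OF c] primitive_continuous[OF F(1)] that]) simp
  then have hp: "primitive h p" 
    by (intro primitive_cong[OF F(1)]) (use p(3) borel_measurable_circ_continuous[OF cp] in auto)
  have per: "h (x + 1) = h x" for x using h(1) by (simp add: sobolev_def)
  note w = primitive_deriv_at[OF hp cp]
  have left: "(h has_real_derivative p 0) (at_left 0)"
  proof -
    have img: "(\<lambda>x. x + 1) ` {..<0} = {..<1::real}"
      using image_iff[of _ "\<lambda>x. x + (1::real)" "{..<0}"] by (auto intro!: bexI[of _ "_ - 1"])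
    have "(h has_real_derivative p 1) (at (0 + 1) within (\<lambda>x. x + 1) ` {..<0})"
      unfolding img using w[of 1] by (simp add: at_within_Icc_at_left)
    moreover have "((\<lambda>x. x + 1) has_real_derivative 1) (at_left (0::real))"
      by (auto intro!: derivative_eq_intros)
    ultimately have "((\<lambda>x. h (x + 1)) has_real_derivative p 1) (at_left 0)"
      using DERIV_image_chain[of h "p 1" "\<lambda>x. x + 1" 0 "{..<0}" 1] by (simp add: o_def)
    then show ?thesis by (simp add: per p(4))
  qed
  moreover have "(h has_real_derivative p 0) (at_right 0)"
    using w[of 0] by (simp add: at_within_Icc_at_right)
  ultimately have "(h has_real_derivative p 0) (at 0)"
    by (simp add: has_field_derivative_iff filterlim_split_at)
  moreover have "(h has_real_derivative p x) (at x)" if "0 < x" "x < 1" for x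
    using w[of x] that by (simp add: at_within_Icc_at)
  moreover have "(h has_real_derivative p 1) (at 1)"
    using \<open>(h has_real_derivative p 0) (at 0)\<close> DERIV_shift[of h "p 0" 0 1] by (simp add: per p(4))
  ultimately have "(h has_real_derivative p x) (at x)" if "x \<in> {0..1}" for x
    using that by (cases "x = 0 \<or> x = 1") auto
  then show ?thesis using that[OF hp p(1,2) _ p(5)] by blast
qed

lemma sobolev_2_estimate:
  assumes h: "h \<in> sobolev s" "s \<ge> 2" "continuous_on UNIV h"
    and p: "primitive h p" "continuous_on {0..1} p" and x: "x \<in> {0..1}"
  shows "\<bar>p x\<bar> \<le> 2 * sobolev_norm s h"
proof -
  obtain p' q where p': "primitive h p'" "primitive p' q" "\<And>x. x \<in> {0..1} \<Longrightarrow> \<bar>p' x\<bar> \<le> 2 * sobolev_norm s h"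
    using sobolev_2_primitive[OF h] by metis
  have "AE x in circ. p x = p' x" by (rule primitive_unique_AE[OF p(1) p'(1)]) simp
  from AE_circ_eq_continuous[OF this p(2) primitive_continuous[OF p'(2)] x] p'(3)[OF x] show ?thesis by simp
qed

section \<open>Differential inequalities and curves of functions\<close>

lemma gronwall:
  fixes y :: "real \<Rightarrow> real"
  assumes "0 \<le> t1" and c: "continuous_on {0..t1} y"
    and d: "\<And>t. 0 < t \<Longrightarrow> t < t1 \<Longrightarrow> \<exists>D. (y has_real_derivative D) (at t) \<and> D \<le> B * y t"
  shows "y t1 \<le> y 0 * exp (B * t1)"
proof (cases "t1 = 0")
  case False
  have "y t1 * exp (- B * t1) \<le> y 0 * exp (- B * 0)"
  proof (rule DERIV_nonpos_imp_decreasing_open[where f="\<lambda>t. y t * exp (- B * t)"])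
    fix t assume t: "0 < t" "t < t1"
    obtain D where D: "(y has_real_derivative D) (at t)" "D \<le> B * y t" using d[OF t] by blast
    have "((\<lambda>t. y t * exp (- B * t)) has_real_derivative (D - B * y t) * exp (- B * t)) (at t)"
      by (auto intro!: derivative_eq_intros D(1) simp: algebra_simps)
    moreover have "(D - B * y t) * exp (- B * t) \<le> 0" using D(2) by (simp add: mult_le_0_iff)
    ultimately show "\<exists>D. ((\<lambda>t. y t * exp (- B * t)) has_real_derivative D) (at t) \<and> D \<le> 0" by blast
  qed (use False assms(1) in \<open>auto intro!: continuous_intros c\<close>)
  then have "y t1 * exp (- B * t1) * exp (B * t1) \<le> y 0 * exp (B * t1)"
    by (intro mult_right_mono) auto
  then show ?thesis by (simp add: mult.assoc flip: exp_add)
qed simp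

lemma L2_integral_sq_sum_le:
  assumes "L2 f" "L2 g"
  shows "(LINT x|circ. (f x + g x)\<^sup>2) \<le> 2 * (LINT x|circ. (f x)\<^sup>2) + 2 * (LINT x|circ. (g x)\<^sup>2)"
proof -
  have "(LINT x|circ. (f x + g x)\<^sup>2) \<le> (LINT x|circ. 2 * (f x)\<^sup>2 + 2 * (g x)\<^sup>2)"
  proof (rule integral_mono)
    show "(f x + g x)\<^sup>2 \<le> 2 * (f x)\<^sup>2 + 2 * (g x)\<^sup>2" for x
      using sum_squares_bound[of "f x" "g x"] by (simp add: power2_sum)
  qed (use L2_sq_integrable[OF assms(1)] L2_sq_integrable[OF assms(2)] L2_sq_integrable[OF L2_add[OF assms]] in auto)
  then show ?thesis using L2_sq_integrable[OF assms(1)] L2_sq_integrable[OF assms(2)] by simp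
qed

text \<open>
  The curve \<open>f\<close> has the derivative \<open>f'\<close> at time \<open>t\<close>, relative to \<open>J\<close>, in the sense of
  square-mean convergence.
\<close>

definition L2_deriv :: "(real \<Rightarrow> real \<Rightarrow> real) \<Rightarrow> (real \<Rightarrow> real) \<Rightarrow> real \<Rightarrow> real set \<Rightarrow> bool" where
  "L2_deriv f f' t J \<longleftrightarrow> t \<in> J \<and> (\<forall>r\<in>J. L2 (f r)) \<and> L2 f' \<and>
     ((\<lambda>r. LINT x|circ. ((f r x - f t x) / (r - t) - f' x)\<^sup>2) \<longlongrightarrow> 0) (at t within J)"

text \<open>
  With the difference quotient written as \<open>f' + e\<close>, the difference quotient of
  \<open>\<integral> \<phi> f\<^sup>2\<close> is \<open>2 \<integral> \<phi> f f'\<close> plus a term linear in \<open>e\<close>, which is small by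
  Cauchy-Schwarz, plus a term with the factor \<open>r - t\<close>.
\<close>

lemma L2_deriv_weighted_square:
  assumes d: "L2_deriv f f' t J"
    and w: "\<phi> \<in> borel_measurable circ" "\<And>x. x \<in> {0..1} \<Longrightarrow> \<bar>\<phi> x\<bar> \<le> B"
  shows "((\<lambda>r. LINT x|circ. \<phi> x * (f r x)\<^sup>2) has_real_derivative (LINT x|circ. 2 * \<phi> x * f t x * f' x)) (at t within J)"
proof -
  define e where "e r x = (f r x - f t x) / (r - t) - f' x" for r x
  define N where "N r = (LINT x|circ. (e r x)\<^sup>2)" for r
  have tJ: "t \<in> J" and Lf: "\<And>r. r \<in> J \<Longrightarrow> L2 (f r)" and Lf': "L2 f'" and N0: "(N \<longlongrightarrow> 0) (at t within J)"
    using d unfolding L2_deriv_def N_def e_def by auto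
  have B0: "0 \<le> B" using w(2)[of 0] by simp
  have Le: "L2 (e r)" if "r \<in> J" for r unfolding e_def[abs_def] by (intro L2_diff L2_divide Lf that tJ Lf')
  have L\<phi>: "L2 (\<lambda>x. \<phi> x * g x)" if "L2 g" for g using L2_mult_bounded[OF that w] .
  define D where "D = (LINT x|circ. 2 * \<phi> x * f t x * f' x)"
  define A where "A = (LINT x|circ. (\<phi> x * f t x)\<^sup>2)"
  define C where "C = (LINT x|circ. (f' x)\<^sup>2)"
  have est: "\<bar>((LINT x|circ. \<phi> x * (f r x)\<^sup>2) - (LINT x|circ. \<phi> x * (f t x)\<^sup>2)) / (r - t) - D\<bar>
     \<le> 2 * (sqrt A * sqrt (N r)) + \<bar>r - t\<bar> * (B * (2 * N r + 2 * C))" if r: "r \<in> J" "r \<noteq> t" for r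
  proof -
    have pw: "(\<phi> x * (f r x)\<^sup>2 - \<phi> x * (f t x)\<^sup>2) / (r - t) = 
      2 * (\<phi> x * f t x * f' x) + 2 * (\<phi> x * f t x * e r x) + (r - t) * (\<phi> x * (e r x + f' x) * (e r x + f' x))" for x
    proof -
      define q where "q = e r x + f' x"
      have q: "f r x = f t x + (r - t) * q" using r by (simp add: q_def e_def)
      have e: "e r x = q - f' x" by (simp add: q_def)
      show ?thesis unfolding q e using r by (simp add: field_simps power2_eq_square)
    qed
    note i1 = L2_mult_integrable[OF L\<phi>[OF Lf[OF tJ]] Lf'] and i2 = L2_mult_integrable[OF L\<phi>[OF Lf[OF tJ]] Le[OF r(1)]]
      and Lq = L2_add[OF Le[OF r(1)] Lf']
    note i3 = L2_mult_integrable[OF L\<phi>[OF Lq] Lq]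
    have i4: "integrable circ (\<lambda>x. \<phi> x * (f r x)\<^sup>2)" if "r \<in> J" for r
      using L2_mult_integrable[OF L\<phi>[OF Lf[OF that]] Lf[OF that]] by (simp add: power2_eq_square mult.assoc)
    have "((LINT x|circ. \<phi> x * (f r x)\<^sup>2) - (LINT x|circ. \<phi> x * (f t x)\<^sup>2)) / (r - t) =
       (LINT x|circ. (\<phi> x * (f r x)\<^sup>2 - \<phi> x * (f t x)\<^sup>2) / (r - t))"
      using i4[OF r(1)] i4[OF tJ] by simp
    also have "\<dots> = D + 2 * (LINT x|circ. \<phi> x * f t x * e r x) + (r - t) * (LINT x|circ. \<phi> x * (e r x + f' x) * (e r x + f' x))"
      unfolding pw D_def using i1 i2 i3 by (simp add: mult.assoc)
    finally have eq: "((LINT x|circ. \<phi> x * (f r x)\<^sup>2) - (LINT x|circ. \<phi> x * (f t x)\<^sup>2)) / (r - t) - D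
       = 2 * (LINT x|circ. \<phi> x * f t x * e r x) + (r - t) * (LINT x|circ. \<phi> x * (e r x + f' x) * (e r x + f' x))" by simp
    have b1: "\<bar>LINT x|circ. \<phi> x * f t x * e r x\<bar> \<le> sqrt A * sqrt (N r)"
      unfolding A_def N_def by (rule L2_Cauchy_Schwarz[OF L\<phi>[OF Lf[OF tJ]] Le[OF r(1)]])
    have "\<bar>LINT x|circ. \<phi> x * (e r x + f' x) * (e r x + f' x)\<bar> \<le> (LINT x|circ. B * (e r x + f' x)\<^sup>2)"
    proof (rule integral_abs_bound_integral[OF i3])
      show "integrable circ (\<lambda>x. B * (e r x + f' x)\<^sup>2)" using L2_sq_integrable[OF Lq] by simp
      fix x assume "x \<in> space circ"
      then have "\<bar>\<phi> x\<bar> * (e r x + f' x)\<^sup>2 \<le> B * (e r x + f' x)\<^sup>2" using w(2)[of x] by (intro mult_right_mono) auto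
      then show "\<bar>\<phi> x * (e r x + f' x) * (e r x + f' x)\<bar> \<le> B * (e r x + f' x)\<^sup>2"
        by (simp add: abs_mult power2_eq_square mult.assoc)
    qed
    also have "\<dots> \<le> B * (2 * N r + 2 * C)"
      using mult_left_mono[OF L2_integral_sq_sum_le[OF Le[OF r(1)] Lf'] B0] by (simp add: N_def C_def)
    finally have b2: "\<bar>(r - t) * (LINT x|circ. \<phi> x * (e r x + f' x) * (e r x + f' x))\<bar> \<le> \<bar>r - t\<bar> * (B * (2 * N r + 2 * C))"
      by (simp add: abs_mult mult_left_mono)
    show ?thesis unfolding eq using b1 b2 by linarith
  qed
  have "((\<lambda>r. ((LINT x|circ. \<phi> x * (f r x)\<^sup>2) - (LINT x|circ. \<phi> x * (f t x)\<^sup>2)) / (r - t) - D) \<longlongrightarrow> 0) (at t within J)"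
  proof (rule Lim_null_comparison)
    show "\<forall>\<^sub>F r in at t within J. norm (((LINT x|circ. \<phi> x * (f r x)\<^sup>2) - (LINT x|circ. \<phi> x * (f t x)\<^sup>2)) / (r - t) - D)
      \<le> 2 * (sqrt A * sqrt (N r)) + \<bar>r - t\<bar> * (B * (2 * N r + 2 * C))"
      unfolding eventually_at_filter using est by (intro always_eventually) auto
    have "((\<lambda>r. 2 * (sqrt A * sqrt (N r)) + \<bar>r - t\<bar> * (B * (2 * N r + 2 * C))) \<longlongrightarrow>
       2 * (sqrt A * sqrt 0) + \<bar>t - t\<bar> * (B * (2 * 0 + 2 * C))) (at t within J)"
      by (intro tendsto_intros N0)
    then show "((\<lambda>r. 2 * (sqrt A * sqrt (N r)) + \<bar>r - t\<bar> * (B * (2 * N r + 2 * C))) \<longlongrightarrow> 0) (at t within J)" by simp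
  qed
  then show ?thesis unfolding has_field_derivative_iff D_def[symmetric] by (rule LIM_zero_cancel)
qed

text \<open>
  Continuous curves in the space of continuous functions on the period; the modulus of continuity
  \<open>b\<close> is what the Sobolev norms provide.
\<close>

definition uniform_curve :: "real set \<Rightarrow> (real \<Rightarrow> real \<Rightarrow> real) \<Rightarrow> bool" where
  "uniform_curve J f \<longleftrightarrow> (\<forall>t\<in>J. continuous_on {0..1} (f t) \<and>
     (\<exists>b. (b \<longlongrightarrow> 0) (at t within J) \<and> (\<forall>r\<in>J. \<forall>x\<in>{0..1}. \<bar>f r x - f t x\<bar> \<le> b r)))"

lemma uniform_curve_continuous_at:
  assumes "uniform_curve J f" "x \<in> {0..1}"
  shows "continuous_on J (\<lambda>t. f t x)"
  unfolding continuous_on_def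
proof
  fix t assume t: "t \<in> J"
  obtain b where b: "(b \<longlongrightarrow> 0) (at t within J)" "\<And>r. r \<in> J \<Longrightarrow> \<bar>f r x - f t x\<bar> \<le> b r"
    using assms t unfolding uniform_curve_def by metis
  have "((\<lambda>r. f r x - f t x) \<longlongrightarrow> 0) (at t within J)"
    by (rule Lim_null_comparison[OF _ b(1)]) (use b(2) in \<open>auto simp: eventually_at_filter\<close>)
  then show "((\<lambda>r. f r x) \<longlongrightarrow> f t x) (at t within J)" by (rule LIM_zero_cancel)
qed

lemma uniform_curve_bounded:
  assumes f: "uniform_curve J f" and K: "compact K" "K \<subseteq> J"
  obtains B where "0 \<le> B" "\<And>t x. t \<in> K \<Longrightarrow> x \<in> {0..1} \<Longrightarrow> \<bar>f t x\<bar> \<le> B"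
proof -
  have "\<exists>U B. open U \<and> t \<in> U \<and> (\<forall>r\<in>U \<inter> J. \<forall>x\<in>{0..1}. \<bar>f r x\<bar> \<le> B)" if t: "t \<in> K" for t
  proof -
    have tJ: "t \<in> J" using t K by auto
    obtain b where b: "(b \<longlongrightarrow> 0) (at t within J)" "\<And>r x. r \<in> J \<Longrightarrow> x \<in> {0..1} \<Longrightarrow> \<bar>f r x - f t x\<bar> \<le> b r"
      and c: "continuous_on {0..1} (f t)"
      using f tJ unfolding uniform_curve_def by metis
    obtain B where B: "0 \<le> B" "\<And>x. x \<in> {0..1} \<Longrightarrow> \<bar>f t x\<bar> \<le> B" using continuous_bounded_unit[OF c] by metis
    have "\<forall>\<^sub>F r in at t within J. b r < 1" using order_tendstoD(2)[OF b(1), of 1] by simp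
    then obtain U where U: "open U" "t \<in> U" "\<And>r. r \<in> U \<Longrightarrow> r \<noteq> t \<Longrightarrow> r \<in> J \<Longrightarrow> b r < 1"
      unfolding eventually_at_topological by metis
    have "\<bar>f r x\<bar> \<le> B + 1" if "r \<in> U \<inter> J" "x \<in> {0..1}" for r x
    proof (cases "r = t")
      case True then show ?thesis using B(2)[OF that(2)] by simp
    next
      case False
      then show ?thesis using B(2)[OF that(2)] b(2)[of r x] U(3)[of r] that by auto
    qed
    with U show ?thesis by blast
  qed
  then obtain U B where U: "\<And>t. t \<in> K \<Longrightarrow> open (U t)" "\<And>t. t \<in> K \<Longrightarrow> t \<in> U t"
    "\<And>t r x. t \<in> K \<Longrightarrow> r \<in> U t \<inter> J \<Longrightarrow> x \<in> {0..1} \<Longrightarrow> \<bar>f r x\<bar> \<le> B t" by metis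
  have "K \<subseteq> (\<Union>t\<in>K. U t)" using U(2) by blast
  then obtain D where D: "D \<subseteq> K" "finite D" "K \<subseteq> (\<Union>t\<in>D. U t)"
    using compactE_image[OF K(1), of K U] U(1) by metis
  define M where "M = (\<Sum>t\<in>D. \<bar>B t\<bar>)"
  have "\<bar>f r x\<bar> \<le> M" if rx: "r \<in> K" "x \<in> {0..1}" for r x
  proof -
    obtain t where t: "t \<in> D" "r \<in> U t" using D(3) rx by blast
    have "\<bar>f r x\<bar> \<le> \<bar>B t\<bar>" using U(3)[of t r x] t D(1) K(2) rx by force
    also have "\<dots> \<le> M" unfolding M_def using t(1) D(2) by (intro member_le_sum) auto
    finally show ?thesis .
  qed
  moreover have "0 \<le> M" by (simp add: M_def sum_nonneg)
  ultimately show ?thesis using that by blast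
qed

section \<open>Regularity of solutions\<close>

text \<open>
  A solution for \<open>\<alpha> = -1\<close> on a time interval \<open>J\<close> that starts at \<open>0\<close> and is open to the right,
  together with its time derivatives \<open>ut\<close> and \<open>\<rho>t\<close>. Oddness of the datum enters as \<open>u 0 0 = 0\<close>.
\<close>

locale hs_flow =
  fixes \<kappa> s :: real and J :: "real set" and u \<rho> ut \<rho>t :: "real \<Rightarrow> real \<Rightarrow> real"
  assumes s2: "2 \<le> s"
    and J0: "0 \<in> J" and Jpos: "\<And>t. t \<in> J \<Longrightarrow> 0 \<le> t"
    and Jdown: "\<And>t r. t \<in> J \<Longrightarrow> 0 \<le> r \<Longrightarrow> r \<le> t \<Longrightarrow> r \<in> J"
    and Jup: "\<And>t. t \<in> J \<Longrightarrow> \<exists>r\<in>J. t < r"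
    and cont_u: "\<And>t. t \<in> J \<Longrightarrow> continuous_on UNIV (u t)"
    and cont_\<rho>: "\<And>t. t \<in> J \<Longrightarrow> continuous_on UNIV (\<rho> t)"
    and curve_u: "continuous_into_sobolev s J u"
    and curve_\<rho>: "continuous_into_sobolev (s - 1) J \<rho>"
    and C1_u: "C1_into_sobolev (s - 1) J u ut"
    and C1_\<rho>: "C1_into_sobolev (s - 2) J \<rho> \<rho>t"
    and eq_u: "\<And>t. t \<in> J \<Longrightarrow> t \<noteq> 0 \<Longrightarrow> AE x in lborel. ut t x + u t x * deriv (u t) x =
              (LBINT y=ereal 0..ereal x. \<kappa> / 2 * (\<rho> t y)\<^sup>2
                 + (- 1 + 2) / 2 * (deriv (u t) y)\<^sup>2 + hs_a (- 1) \<kappa> (u t) (\<rho> t))"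
    and eq_\<rho>: "\<And>t. t \<in> J \<Longrightarrow> t \<noteq> 0 \<Longrightarrow>
       AE x in lborel. \<rho>t t x + u t x * deriv (\<rho> t) x = - 1 * deriv (u t) x * \<rho> t x"
    and u0_0: "u 0 0 = 0"
begin

lemma u_sobolev: "t \<in> J \<Longrightarrow> u t \<in> sobolev s"
  and \<rho>_sobolev: "t \<in> J \<Longrightarrow> \<rho> t \<in> sobolev (s - 1)"
  and ut_sobolev: "t \<in> J \<Longrightarrow> ut t \<in> sobolev (s - 1)"
  and \<rho>t_sobolev: "t \<in> J \<Longrightarrow> \<rho>t t \<in> sobolev (s - 2)"
  using curve_u curve_\<rho> C1_u C1_\<rho> by (auto simp: C1_into_sobolev_def continuous_into_sobolev_def)

text \<open>
  \<open>ux\<close> is the continuous spatial derivative of \<open>u\<close>, and \<open>uxx\<close> its weak derivative.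
\<close>

definition ux_pair :: "real \<Rightarrow> (real \<Rightarrow> real) \<times> (real \<Rightarrow> real)" where
  "ux_pair t = (SOME (p, q). primitive (u t) p \<and> primitive p q \<and> L2 q \<and>
     (\<forall>x\<in>{0..1}. (u t has_real_derivative p x) (at x)))"

definition ux :: "real \<Rightarrow> real \<Rightarrow> real" where "ux t = fst (ux_pair t)"
definition uxx :: "real \<Rightarrow> real \<Rightarrow> real" where "uxx t = snd (ux_pair t)"

lemma ux: 
  assumes "t \<in> J"
  shows "primitive (u t) (ux t)" "primitive (ux t) (uxx t)" "L2 (uxx t)"
    "\<And>x. x \<in> {0..1} \<Longrightarrow> (u t has_real_derivative ux t x) (at x)"
proof -
  obtain p q where "primitive (u t) p" "primitive p q" "L2 q"
    "\<And>x. x \<in> {0..1} \<Longrightarrow> (u t has_real_derivative p x) (at x)"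
    by (rule sobolev_2_primitive[OF u_sobolev[OF assms] s2 cont_u[OF assms]]) (rule that, assumption+)
  then have "\<exists>pq. (case pq of (p, q) \<Rightarrow> primitive (u t) p \<and> primitive p q \<and> L2 q \<and>
     (\<forall>x\<in>{0..1}. (u t has_real_derivative p x) (at x)))"
    by (intro exI[of _ "(p, q)"]) simp
  from someI_ex[OF this] show "primitive (u t) (ux t)" "primitive (ux t) (uxx t)" "L2 (uxx t)"
    "\<And>x. x \<in> {0..1} \<Longrightarrow> (u t has_real_derivative ux t x) (at x)"
    unfolding ux_def uxx_def ux_pair_def by (auto simp: case_prod_unfold)
qed

definition \<rho>x :: "real \<Rightarrow> real \<Rightarrow> real" where "\<rho>x t = (SOME f. primitive (\<rho> t) f \<and> L2 f)"

lemma \<rho>x: 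
  assumes "t \<in> J"
  shows "primitive (\<rho> t) (\<rho>x t)" "L2 (\<rho>x t)"
proof -
  have "1 \<le> s - 1" using s2 by simp
  then have "\<exists>f. primitive (\<rho> t) f \<and> L2 f"
    by (rule sobolev_1_primitive[OF \<rho>_sobolev[OF assms] _ cont_\<rho>[OF assms]]) blast
  from someI_ex[OF this] show "primitive (\<rho> t) (\<rho>x t)" "L2 (\<rho>x t)" unfolding \<rho>x_def by auto
qed

text \<open>
  \<open>uc\<close> is the continuous representative of the class \<open>ut\<close> of time derivatives, and \<open>utx\<close> its
  weak spatial derivative.
\<close>

definition uc_pair :: "real \<Rightarrow> (real \<Rightarrow> real) \<times> (real \<Rightarrow> real)" where
  "uc_pair t = (SOME (F, f). primitive F f \<and> L2 f \<and> (AE x in circ. ut t x = F x))"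

definition uc :: "real \<Rightarrow> real \<Rightarrow> real" where "uc t = fst (uc_pair t)"
definition utx :: "real \<Rightarrow> real \<Rightarrow> real" where "utx t = snd (uc_pair t)"

lemma uc:
  assumes "t \<in> J"
  shows "primitive (uc t) (utx t)" "L2 (utx t)" "AE x in circ. ut t x = uc t x"
proof -
  have "1 \<le> s - 1" using s2 by simp
  then have "\<exists>pq. (case pq of (F, f) \<Rightarrow> primitive F f \<and> L2 f \<and> (AE x in circ. ut t x = F x))"
    by (rule sobolev_1_representative[OF ut_sobolev[OF assms]]) auto
  from someI_ex[OF this] show "primitive (uc t) (utx t)" "L2 (utx t)" "AE x in circ. ut t x = uc t x"
    unfolding uc_def utx_def uc_pair_def by (auto simp: case_prod_unfold)
qed

lemma cont_u01: "t \<in> J \<Longrightarrow> continuous_on {0..1} (u t)"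
  by (rule primitive_continuous[OF ux(1)])

lemma cont_\<rho>01: "t \<in> J \<Longrightarrow> continuous_on {0..1} (\<rho> t)"
  by (rule primitive_continuous[OF \<rho>x(1)])

lemma cont_ux: "t \<in> J \<Longrightarrow> continuous_on {0..1} (ux t)"
  by (rule primitive_continuous[OF ux(2)])

lemma cont_uc: "t \<in> J \<Longrightarrow> continuous_on {0..1} (uc t)"
  by (rule primitive_continuous[OF uc(1)])

lemma u_1: "t \<in> J \<Longrightarrow> u t 1 = u t 0"
proof -
  assume "t \<in> J"
  then have "u t (0 + 1) = u t 0" using u_sobolev[of t] unfolding sobolev_def by blast
  then show ?thesis by simp
qed

lemma uniform_curveI:
  assumes "continuous_into_sobolev r J f" "\<And>t. t \<in> J \<Longrightarrow> continuous_on {0..1} (g t)"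
    "\<And>t t' x. t \<in> J \<Longrightarrow> t' \<in> J \<Longrightarrow> x \<in> {0..1} \<Longrightarrow> \<bar>g t x - g t' x\<bar> \<le> 2 * sobolev_norm r (\<lambda>x. f t x - f t' x)"
  shows "uniform_curve J g"
  unfolding uniform_curve_def
proof (intro ballI conjI exI)
  fix t assume t: "t \<in> J"
  have "((\<lambda>r'. sobolev_norm r (\<lambda>x. f r' x - f t x)) \<longlongrightarrow> 0) (at t within J)"
    using assms(1) t unfolding continuous_into_sobolev_def by blast
  from tendsto_mult[OF tendsto_const[of 2] this]
  show "((\<lambda>r'. 2 * sobolev_norm r (\<lambda>x. f r' x - f t x)) \<longlongrightarrow> 0) (at t within J)" by simp
qed (use assms in auto)

lemma curve_ux: "uniform_curve J ux"
proof (rule uniform_curveI[OF curve_u cont_ux])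
  fix t t' x assume t: "t \<in> J" "t' \<in> J" and x: "x \<in> {0..1::real}"
  show "\<bar>ux t x - ux t' x\<bar> \<le> 2 * sobolev_norm s (\<lambda>x. u t x - u t' x)"
    using sobolev_2_estimate[OF sobolev_diff[OF u_sobolev[OF t(1)] u_sobolev[OF t(2)]] s2 
        continuous_on_diff[OF cont_u[OF t(1)] cont_u[OF t(2)]] primitive_diff[OF ux(1)[OF t(1)] ux(1)[OF t(2)]]
        continuous_on_diff[OF cont_ux[OF t(1)] cont_ux[OF t(2)]] x] by simp
qed

lemma curve_\<rho>01: "uniform_curve J \<rho>"
proof (rule uniform_curveI[OF curve_\<rho> cont_\<rho>01])
  fix t t' x assume t: "t \<in> J" "t' \<in> J" and x: "x \<in> {0..1::real}"
  show "\<bar>\<rho> t x - \<rho> t' x\<bar> \<le> 2 * sobolev_norm (s - 1) (\<lambda>x. \<rho> t x - \<rho> t' x)"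
    using sobolev_1_estimate(1)[OF sobolev_diff[OF \<rho>_sobolev[OF t(1)] \<rho>_sobolev[OF t(2)]] _ 
        primitive_diff[OF \<rho>x(1)[OF t(1)] \<rho>x(1)[OF t(2)]] _ x] s2 by simp
qed

lemma difference_quotient_primitive:
  assumes "t \<in> J" "r \<in> J"
  shows "primitive (\<lambda>x. (u r x - u t x) / (r - t) - uc t x) (\<lambda>x. (ux r x - ux t x) / (r - t) - utx t x)"
  using primitive_diff[OF primitive_cmult[OF primitive_diff[OF ux(1)[OF assms(2)] ux(1)[OF assms(1)]], of "1 / (r - t)"]
    uc(1)[OF assms(1)]] by simp

lemma difference_quotient_norm_tendsto:
  assumes "t \<in> J"
  shows "((\<lambda>r. sobolev_norm (s - 1) (\<lambda>x. (u r x - u t x) / (r - t) - ut t x)) \<longlongrightarrow> 0) (at t within J)"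
  using assms C1_u by (simp add: C1_into_sobolev_def)

text \<open>
  Convergence of the difference quotients of \<open>u\<close> in Sobolev norm of order at least one
  controls them uniformly, and controls those of \<open>ux\<close> in square mean.
\<close>

lemma difference_quotient_estimate:
  assumes t: "t \<in> J" "r \<in> J"
  defines "N \<equiv> sobolev_norm (s - 1) (\<lambda>x. (u r x - u t x) / (r - t) - ut t x)"
  shows "\<And>x. x \<in> {0..1} \<Longrightarrow> \<bar>(u r x - u t x) / (r - t) - uc t x\<bar> \<le> 2 * N"
    "(LINT x|circ. ((ux r x - ux t x) / (r - t) - utx t x)\<^sup>2) \<le> N\<^sup>2"
proof -
  have us: "u r \<in> sobolev (s - 1)" if "r \<in> J" for r using sobolev_mono[OF u_sobolev[OF that]] by simp
  have s1: "1 \<le> s - 1" using s2 by simp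
  have "AE x in circ. (u r x - u t x) / (r - t) - ut t x = (u r x - u t x) / (r - t) - uc t x"
    using uc(3)[OF t(1)] by eventually_elim simp
  note e = sobolev_1_estimate[OF sobolev_difference_quotient[OF us[OF t(2)] us[OF t(1)] ut_sobolev[OF t(1)], of "r - t"] 
      s1 difference_quotient_primitive[OF t] this]
  show "\<bar>(u r x - u t x) / (r - t) - uc t x\<bar> \<le> 2 * N" if "x \<in> {0..1}" for x
    using e(1)[OF that] by (simp add: N_def)
  show "(LINT x|circ. ((ux r x - ux t x) / (r - t) - utx t x)\<^sup>2) \<le> N\<^sup>2" using e(3) by (simp add: N_def)
qed

lemma u_time_deriv:
  assumes t: "t \<in> J" and x: "x \<in> {0..1}"
  shows "((\<lambda>r. u r x) has_real_derivative uc t x) (at t within J)"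
  unfolding has_field_derivative_iff
proof (rule LIM_zero_cancel, rule Lim_null_comparison)
  show "((\<lambda>r. 2 * sobolev_norm (s - 1) (\<lambda>x. (u r x - u t x) / (r - t) - ut t x)) \<longlongrightarrow> 0) (at t within J)"
    using tendsto_mult[OF tendsto_const[of 2] difference_quotient_norm_tendsto[OF t]] by simp
  show "\<forall>\<^sub>F r in at t within J. norm ((u r x - u t x) / (r - t) - uc t x)
    \<le> 2 * sobolev_norm (s - 1) (\<lambda>x. (u r x - u t x) / (r - t) - ut t x)"
    unfolding eventually_at_filter using difference_quotient_estimate(1)[OF t _ x] by (intro always_eventually) auto
qed

lemma ux_L2_deriv:
  assumes t: "t \<in> J"
  shows "L2_deriv ux (utx t) t J"
  unfolding L2_deriv_def
proof (intro conjI ballI)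
  have "((\<lambda>r. (sobolev_norm (s - 1) (\<lambda>x. (u r x - u t x) / (r - t) - ut t x))\<^sup>2) \<longlongrightarrow> 0) (at t within J)"
    using tendsto_power[OF difference_quotient_norm_tendsto[OF t], of 2] by simp
  then show "((\<lambda>r. LINT x|circ. ((ux r x - ux t x) / (r - t) - utx t x)\<^sup>2) \<longlongrightarrow> 0) (at t within J)"
    by (rule Lim_null_comparison[rotated])
      (use difference_quotient_estimate(2)[OF t] in \<open>auto simp: eventually_at_filter intro!: always_eventually\<close>)
qed (use t uc(2) cont_ux in \<open>auto intro: L2_continuous\<close>)

lemma \<rho>_L2_deriv:
  assumes t: "t \<in> J"
  shows "L2_deriv \<rho> (\<rho>t t) t J"
  unfolding L2_deriv_def
proof (intro conjI ballI)
  have \<rho>s: "\<rho> r \<in> sobolev (s - 2)" if "r \<in> J" for r using sobolev_mono[OF \<rho>_sobolev[OF that]] by simp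
  have "((\<lambda>r. sobolev_norm (s - 2) (\<lambda>x. (\<rho> r x - \<rho> t x) / (r - t) - \<rho>t t x)) \<longlongrightarrow> 0) (at t within J)"
    using t C1_\<rho> by (simp add: C1_into_sobolev_def)
  from tendsto_power[OF this, of 2]
  have lim: "((\<lambda>r. (sobolev_norm (s - 2) (\<lambda>x. (\<rho> r x - \<rho> t x) / (r - t) - \<rho>t t x))\<^sup>2) \<longlongrightarrow> 0) (at t within J)" by simp
  have le: "(LINT x|circ. ((\<rho> r x - \<rho> t x) / (r - t) - \<rho>t t x)\<^sup>2) \<le> 
      (sobolev_norm (s - 2) (\<lambda>x. (\<rho> r x - \<rho> t x) / (r - t) - \<rho>t t x))\<^sup>2" if "r \<in> J" for r
    using sobolev_L2_norm_le[OF sobolev_difference_quotient[OF \<rho>s[OF that] \<rho>s[OF t] \<rho>t_sobolev[OF t]]] s2 by simp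
  show "((\<lambda>r. LINT x|circ. ((\<rho> r x - \<rho> t x) / (r - t) - \<rho>t t x)\<^sup>2) \<longlongrightarrow> 0) (at t within J)"
    by (rule Lim_null_comparison[OF _ lim]) (use le in \<open>auto simp: eventually_at_filter intro!: always_eventually\<close>)
  show "L2 (\<rho>t t)" by (rule sobolev_L2[OF \<rho>t_sobolev[OF t]])
qed (use t cont_\<rho>01 in \<open>auto intro: L2_continuous\<close>)

section \<open>The equations at fixed time\<close>

definition a :: "real \<Rightarrow> real" where "a t = hs_a (- 1) \<kappa> (u t) (\<rho> t)"

text \<open>
  The right-hand side of the first equation is \<open>source_int\<close>, the integral of \<open>source\<close> from \<open>0\<close>.
\<close>

definition source :: "real \<Rightarrow> real \<Rightarrow> real" where
  "source t x = \<kappa> / 2 * (\<rho> t x)\<^sup>2 + (ux t x)\<^sup>2 / 2 + a t"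

definition source_int :: "real \<Rightarrow> real \<Rightarrow> real" where
  "source_int t x = (LINT y|circ. indicat_real {0..x} y * source t y)"

lemma cont_source: "t \<in> J \<Longrightarrow> continuous_on {0..1} (source t)"
  unfolding source_def[abs_def] by (intro continuous_intros cont_\<rho>01 cont_ux) auto

lemma deriv_u: "t \<in> J \<Longrightarrow> x \<in> {0..1} \<Longrightarrow> deriv (u t) x = ux t x"
  using ux(4) by (blast intro: DERIV_imp_deriv)

lemma AE_deriv_u: 
  assumes "t \<in> J" shows "AE x in circ. deriv (u t) x = ux t x"
  using AE_space[of circ] by eventually_elim (use deriv_u[OF assms] in auto)

lemma AE_deriv_\<rho>: 
  assumes "t \<in> J" shows "AE x in circ. deriv (\<rho> t) x = \<rho>x t x"
  using primitive_AE_deriv[OF \<rho>x(1)[OF assms]] by eventually_elim (rule DERIV_imp_deriv)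

lemma a_eq: 
  assumes "t \<in> J"
  shows "a t = - (\<kappa> / 2) * (LINT x|circ. (\<rho> t x)\<^sup>2) - (LINT x|circ. (ux t x)\<^sup>2) / 2"
proof -
  have "(LBINT x:{0..1}. (deriv (u t) x)\<^sup>2) = (LBINT x:{0..1}. (ux t x)\<^sup>2)"
    by (rule set_lebesgue_integral_cong) (use deriv_u[OF assms] in auto)
  then show ?thesis
    unfolding a_def hs_a_def set_integral_circ by simp
qed

lemma source_int_0:
  assumes "t \<in> J" shows "source_int t 0 = 0"
proof -
  have "source_int t 0 = integral {0..0} (source t)"
    unfolding source_int_def using integral_circ_indicator_HK(1)[OF _ _ integrable_circ_continuous[OF cont_source[OF assms]], of 0 0]
    by (simp del: atLeastAtMost_singleton)
  then show ?thesis by simp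
qed

lemma primitive_source: 
  assumes "t \<in> J" shows "primitive (source_int t) (source t)"
  unfolding primitive_def using integrable_circ_continuous[OF cont_source[OF assms]] source_int_0[OF assms] by (simp add: source_int_def)

text \<open>
  Both sides are continuous in \<open>x\<close>, so the equation holds everywhere on the period and may be
  evaluated at the origin.
\<close>

lemma uc_eq:
  assumes t: "t \<in> J" "t \<noteq> 0" and x: "x \<in> {0..1}"
  shows "uc t x = - (u t x * ux t x) + source_int t x"
proof -
  have "AE x in circ. uc t x = - (u t x * ux t x) + source_int t x"
    using AE_circI[OF eq_u[OF t]] uc(3)[OF t(1)] AE_deriv_u[OF t(1)] AE_space[of circ]
  proof eventually_elim
    case (elim x)
    then have x: "0 \<le> x" "x \<le> 1" by auto
    let ?f = "\<lambda>y. \<kappa> / 2 * (\<rho> t y)\<^sup>2 + (- 1 + 2) / 2 * (deriv (u t) y)\<^sup>2 + hs_a (- 1) \<kappa> (u t) (\<rho> t)"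
    have eqf: "?f y = source t y" if "y \<in> {0..1}" for y
      using deriv_u[OF t(1) that] by (simp add: source_def a_def)
    have "(LBINT y=ereal 0..ereal x. ?f y) = (LBINT y:{0..x}. ?f y)"
      using x by (simp add: interval_integral_Icc)
    also have "\<dots> = (LBINT y:{0..x}. source t y)"
      by (rule set_lebesgue_integral_cong) (use eqf x in auto)
    also have "\<dots> = source_int t x" unfolding source_int_def using x by (simp add: integral_circ_indicator_lborel)
    finally show ?case using elim by simp
  qed
  then show ?thesis
    by (rule AE_circ_eq_continuous)
      (use x t in \<open>auto intro!: continuous_intros cont_uc cont_u01 cont_ux primitive_continuous[OF primitive_source]\<close>)
qed

lemma utx_eq:
  assumes t: "t \<in> J" "t \<noteq> 0"
  shows "AE x in circ. utx t x = - (ux t x * ux t x + u t x * uxx t x) + source t x"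
proof (rule primitive_unique_AE[OF uc(1)[OF t(1)]])
  show "primitive (\<lambda>x. - (u t x * ux t x) + source_int t x) (\<lambda>x. - (ux t x * ux t x + u t x * uxx t x) + source t x)"
    using primitive_add[OF primitive_cmult[OF primitive_mult[OF ux(1,2)[OF t(1)]], of "-1"] primitive_source[OF t(1)]] by simp
  show "AE x in circ. uc t x = - (u t x * ux t x) + source_int t x"
    using AE_space[of circ] by eventually_elim (use uc_eq[OF t] in auto)
qed

lemma \<rho>t_eq:
  assumes t: "t \<in> J" "t \<noteq> 0"
  shows "AE x in circ. \<rho>t t x = - (u t x * \<rho>x t x) - ux t x * \<rho> t x"
  using AE_circI[OF eq_\<rho>[OF t]] AE_deriv_u[OF t(1)] AE_deriv_\<rho>[OF t(1)] by eventually_elim simp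

lemma at_within_J:
  assumes "t \<in> J" "0 < t" shows "at t within J = at t"
proof -
  obtain r where r: "r \<in> J" "t < r" using Jup[OF assms(1)] by blast
  have "{0<..<r} \<subseteq> J" using Jdown[OF r(1)] by auto
  then show ?thesis using at_within_open_subset[of t "{0<..<r}" J] assms r by simp
qed

lemma Icc_subset_J: "t \<in> J \<Longrightarrow> {0..t} \<subseteq> J"
  using Jdown by auto

text \<open>
  At \<open>x = 0\<close> the source integral vanishes, and \<open>m t = u t 0\<close> satisfies \<open>m' = - ux t 0 * m\<close>;
  Gronwall's inequality is applied to \<open>m\<^sup>2\<close>, which starts at \<open>0\<close>.
\<close>

lemma u_0:
  assumes t: "t \<in> J" shows "u t 0 = 0"
proof -
  obtain B where B: "0 \<le> B" "\<And>r x. r \<in> {0..t} \<Longrightarrow> x \<in> {0..1} \<Longrightarrow> \<bar>ux r x\<bar> \<le> B"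
    using uniform_curve_bounded[OF curve_ux _ Icc_subset_J[OF t]] by blast
  have "(u t 0)\<^sup>2 \<le> (u 0 0)\<^sup>2 * exp (2 * B * t)"
  proof (rule gronwall)
    show "0 \<le> t" by (rule Jpos[OF t])
    have "continuous_on J (\<lambda>r. u r 0)"
      using u_time_deriv[of _ 0] by (intro continuous_on_eq_continuous_within[THEN iffD2]) (auto intro: DERIV_continuous)
    then show "continuous_on {0..t} (\<lambda>r. (u r 0)\<^sup>2)"
      using Icc_subset_J[OF t] by (intro continuous_intros) (rule continuous_on_subset)
    fix r assume r: "0 < r" "r < t"
    then have rJ: "r \<in> J" using Jdown[OF t] by auto
    have "((\<lambda>r. u r 0) has_real_derivative uc r 0) (at r)"
      using u_time_deriv[OF rJ, of 0] at_within_J[OF rJ r(1)] by simp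
    then have "((\<lambda>r. (u r 0)\<^sup>2) has_real_derivative 2 * u r 0 * uc r 0) (at r)"
      by (auto intro!: derivative_eq_intros)
    moreover have "2 * u r 0 * uc r 0 \<le> 2 * B * (u r 0)\<^sup>2"
    proof -
      have "- ux r 0 * (u r 0)\<^sup>2 \<le> B * (u r 0)\<^sup>2" using B(2)[of r 0] r by (intro mult_right_mono) auto
      then show ?thesis using uc_eq[OF rJ, of 0] r source_int_0[OF rJ] by (simp add: power2_eq_square algebra_simps)
    qed
    ultimately show "\<exists>D. ((\<lambda>r. (u r 0)\<^sup>2) has_real_derivative D) (at r) \<and> D \<le> 2 * B * (u r 0)\<^sup>2" by blast
  qed
  then show ?thesis by (simp add: u0_0)
qed

section \<open>Conservation of energy\<close>

text \<open>
  The second equation says \<open>\<rho>\<^sub>t = - (u \<rho>)\<^sub>x\<close>. The term \<open>2 \<phi> u \<rho> \<rho>\<^sub>x = \<phi> u (\<rho>\<^sup>2)\<^sub>x\<close> is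
  integrated by parts; there is no boundary contribution since \<open>u\<close> vanishes at \<open>0\<close> and \<open>1\<close>, so
  the weight need not be periodic.
\<close>

lemma weighted_\<rho>_deriv:
  assumes t: "t \<in> J" "0 < t"
    and w: "\<And>x. x \<in> {0..1} \<Longrightarrow> (\<phi> has_real_derivative \<phi>' x) (at x within {0..1})" "continuous_on {0..1} \<phi>'"
  shows "((\<lambda>r. LINT x|circ. \<phi> x * (\<rho> r x)\<^sup>2) has_real_derivative
     (LINT x|circ. (\<phi>' x * u t x - \<phi> x * ux t x) * (\<rho> t x)\<^sup>2)) (at t)"
proof -
  have p\<phi>: "primitive \<phi> \<phi>'" by (rule primitive_of_continuous_deriv[OF w])
  have c\<phi>: "continuous_on {0..1} \<phi>" by (rule primitive_continuous[OF p\<phi>])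
  obtain B where "\<And>x. x \<in> {0..1} \<Longrightarrow> \<bar>\<phi> x\<bar> \<le> B" using continuous_bounded_unit[OF c\<phi>] by metis
  from L2_deriv_weighted_square[OF \<rho>_L2_deriv[OF t(1)] borel_measurable_circ_continuous[OF c\<phi>] this]
  have d: "((\<lambda>r. LINT x|circ. \<phi> x * (\<rho> r x)\<^sup>2) has_real_derivative (LINT x|circ. 2 * \<phi> x * \<rho> t x * \<rho>t t x)) (at t)"
    using at_within_J[OF t] by simp
  note cs = cont_u01[OF t(1)] cont_\<rho>01[OF t(1)] cont_ux[OF t(1)] c\<phi> w(2)
  \<comment> \<open>the derivative of \<open>\<phi> u \<rho>\<^sup>2\<close>, whose integral over the period vanishes\<close>
  define R where "R x = (\<phi>' x * u t x + \<phi> x * ux t x) * (\<rho> t x * \<rho> t x) + \<phi> x * u t x * (\<rho>x t x * \<rho> t x + \<rho> t x * \<rho>x t x)" for x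
  have pR: "primitive (\<lambda>x. \<phi> x * u t x * (\<rho> t x * \<rho> t x)) R"
    unfolding R_def[abs_def]
    by (intro primitive_mult p\<phi> ux(1)[OF t(1)] \<rho>x(1)[OF t(1)])
  from primitive_integral[OF pR] have R0: "(LINT x|circ. R x) = 0"
    using u_0[OF t(1)] u_1[OF t(1)] by simp
  have iR: "integrable circ R" by (rule primitive_integrable[OF pR])
  have i2: "integrable circ (\<lambda>x. (\<phi>' x * u t x - \<phi> x * ux t x) * (\<rho> t x)\<^sup>2)"
    by (intro integrable_circ_continuous continuous_intros cs)
  have "(LINT x|circ. 2 * \<phi> x * \<rho> t x * \<rho>t t x) = (LINT x|circ. (\<phi>' x * u t x - \<phi> x * ux t x) * (\<rho> t x)\<^sup>2 - R x)"
  proof (rule integral_cong_AE)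
    show "(\<lambda>x. (\<phi>' x * u t x - \<phi> x * ux t x) * (\<rho> t x)\<^sup>2 - R x) \<in> borel_measurable circ"
      using i2 iR by measurable
    show "(\<lambda>x. 2 * \<phi> x * \<rho> t x * \<rho>t t x) \<in> borel_measurable circ"
      using borel_measurable_circ_continuous[OF c\<phi>] borel_measurable_circ_continuous[OF cont_\<rho>01[OF t(1)]]
        L2_measurable[OF sobolev_L2[OF \<rho>t_sobolev[OF t(1)]]] by measurable
    show "AE x in circ. 2 * \<phi> x * \<rho> t x * \<rho>t t x = (\<phi>' x * u t x - \<phi> x * ux t x) * (\<rho> t x)\<^sup>2 - R x"
      using \<rho>t_eq[OF t(1) less_imp_neq[OF t(2), symmetric]]
    proof eventually_elim
      case (elim x)
      show ?case unfolding elim R_def by (simp add: algebra_simps power2_eq_square)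
    qed
  qed
  also have "\<dots> = (LINT x|circ. (\<phi>' x * u t x - \<phi> x * ux t x) * (\<rho> t x)\<^sup>2)" using i2 iR R0 by simp
  finally show ?thesis using d by simp
qed

definition energy :: "real \<Rightarrow> real" where
  "energy t = (LINT x|circ. (ux t x)\<^sup>2) + \<kappa> * (LINT x|circ. (\<rho> t x)\<^sup>2)"

lemma a_energy:
  assumes "t \<in> J" shows "a t = - energy t / 2"
  unfolding a_eq[OF assms] energy_def by (simp add: field_simps)

lemma ux_sq_deriv:
  assumes t: "t \<in> J"
  shows "((\<lambda>r. LINT x|circ. (ux r x)\<^sup>2) has_real_derivative (LINT x|circ. 2 * ux t x * utx t x)) (at t within J)"
  using L2_deriv_weighted_square[OF ux_L2_deriv[OF t] borel_measurable_const[of 1], of 1]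
  unfolding mult_1 mult_1_right by (simp only: abs_one order_refl simp_thms)

lemma \<rho>_sq_deriv:
  assumes t: "t \<in> J"
  shows "((\<lambda>r. LINT x|circ. (\<rho> r x)\<^sup>2) has_real_derivative (LINT x|circ. 2 * \<rho> t x * \<rho>t t x)) (at t within J)"
  using L2_deriv_weighted_square[OF \<rho>_L2_deriv[OF t] borel_measurable_const[of 1], of 1]
  unfolding mult_1 mult_1_right by (simp only: abs_one order_refl simp_thms)

text \<open>
  Substituting \<open>u\<^sub>t\<^sub>x = - u\<^sub>x\<^sup>2 - u u\<^sub>x\<^sub>x + source\<close>, the cubic terms combine to
  \<open>- (u u\<^sub>x\<^sup>2)\<^sub>x\<close>. This cancellation is special to \<open>\<alpha> = -1\<close>.
\<close>

lemma ux_utx_integral: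
  assumes t: "t \<in> J" "0 < t"
  shows "(LINT x|circ. 2 * ux t x * utx t x) = \<kappa> * (LINT x|circ. ux t x * (\<rho> t x)\<^sup>2)"
proof -
  note cs = cont_u01[OF t(1)] cont_\<rho>01[OF t(1)] cont_ux[OF t(1)]
  define R where "R x = ux t x * (ux t x * ux t x) + u t x * (uxx t x * ux t x + ux t x * uxx t x)" for x
  have pR: "primitive (\<lambda>x. u t x * (ux t x * ux t x)) R"
    unfolding R_def[abs_def]
    by (rule primitive_mult[OF ux(1)[OF t(1)] primitive_mult[OF ux(2)[OF t(1)] ux(2)[OF t(1)]]])
  from primitive_integral[OF pR] have R0: "(LINT x|circ. R x) = 0"
    using u_0[OF t(1)] u_1[OF t(1)] by simp
  have iR: "integrable circ R" by (rule primitive_integrable[OF pR])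
  have i0: "integrable circ (\<lambda>x. ux t x * (\<rho> t x)\<^sup>2)"
    by (intro integrable_circ_continuous continuous_intros cs)
  have i1: "integrable circ (\<lambda>x. \<kappa> * (ux t x * (\<rho> t x)\<^sup>2))" "integrable circ (\<lambda>x. 2 * a t * ux t x)"
    using i0 integrable_circ_continuous[OF cs(3)] by simp_all
  have ux0: "(LINT x|circ. ux t x) = 0" using primitive_integral[OF ux(1)[OF t(1)]] u_1[OF t(1)] by simp
  have "(LINT x|circ. 2 * ux t x * utx t x) = (LINT x|circ. \<kappa> * (ux t x * (\<rho> t x)\<^sup>2) + 2 * a t * ux t x - R x)"
  proof (rule integral_cong_AE)
    show "(\<lambda>x. \<kappa> * (ux t x * (\<rho> t x)\<^sup>2) + 2 * a t * ux t x - R x) \<in> borel_measurable circ"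
      using i1 iR by measurable
    show "(\<lambda>x. 2 * ux t x * utx t x) \<in> borel_measurable circ"
      using borel_measurable_circ_continuous[OF cs(3)] L2_measurable[OF uc(2)[OF t(1)]] by measurable
    show "AE x in circ. 2 * ux t x * utx t x = \<kappa> * (ux t x * (\<rho> t x)\<^sup>2) + 2 * a t * ux t x - R x"
      using utx_eq[OF t(1) less_imp_neq[OF t(2), symmetric]]
    proof eventually_elim
      case (elim x)
      show ?case unfolding elim R_def source_def by (simp add: field_simps power2_eq_square)
    qed
  qed
  also have "\<dots> = \<kappa> * (LINT x|circ. ux t x * (\<rho> t x)\<^sup>2)" using i1 iR R0 ux0 by simp
  finally show ?thesis .
qed

text \<open>
  The production \<open>\<kappa> \<integral> u\<^sub>x \<rho>\<^sup>2\<close> of the first part of the energy is exactly the loss of the second.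
\<close>

lemma energy_const:
  assumes t: "t \<in> J" shows "energy t = energy 0"
proof (cases "t = 0")
  case False
  then have t0: "0 < t" using Jpos[OF t] by simp
  have dJ: "(energy has_real_derivative (LINT x|circ. 2 * ux r x * utx r x) + \<kappa> * (LINT x|circ. 2 * \<rho> r x * \<rho>t r x)) (at r within J)"
    if "r \<in> J" for r
    unfolding energy_def[abs_def] by (intro DERIV_add DERIV_cmult ux_sq_deriv \<rho>_sq_deriv that)
  then have "continuous_on J energy"
    by (intro continuous_on_eq_continuous_within[THEN iffD2]) (auto intro: DERIV_continuous)
  then have c: "continuous_on {0..t} energy" using Icc_subset_J[OF t] by (rule continuous_on_subset)
  show ?thesis
  proof (rule DERIV_isconst_end[OF t0 c])
    fix r assume r: "0 < r" "r < t"
    then have rJ: "r \<in> J" using Jdown[OF t] by auto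
    have "((\<lambda>r. LINT x|circ. (\<rho> r x)\<^sup>2) has_real_derivative - (LINT x|circ. ux r x * (\<rho> r x)\<^sup>2)) (at r)"
      using weighted_\<rho>_deriv[OF rJ r(1), of "\<lambda>_. 1" "\<lambda>_. 0"] by (simp add: continuous_on_const)
    moreover have "((\<lambda>r. LINT x|circ. (ux r x)\<^sup>2) has_real_derivative \<kappa> * (LINT x|circ. ux r x * (\<rho> r x)\<^sup>2)) (at r)"
      using ux_sq_deriv[OF rJ] ux_utx_integral[OF rJ r(1)] at_within_J[OF rJ r(1)] by simp
    ultimately show "(energy has_real_derivative 0) (at r)"
      unfolding energy_def[abs_def] by (auto intro!: derivative_eq_intros)
  qed
qed simp

lemma a_const:
  assumes "t \<in> J" shows "a t = a 0"
  unfolding a_energy[OF assms] a_energy[OF J0] energy_const[OF assms] ..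

section \<open>The density at the origin\<close>

text \<open>
  The integral of \<open>\<rho>\<^sup>2\<close> against the weight \<open>1 / (x + \<delta>)\<close> is bounded uniformly in \<open>\<delta>\<close> if
  \<open>\<rho>\<^sup>2 = O(x)\<close>, and diverges as \<open>\<delta> \<rightarrow> 0\<close> if \<open>\<rho>\<close> is nonzero at the origin. The logarithmic derivative
  of the weight
  is at most \<open>1 / x\<close> in modulus, which is compensated by \<open>\<bar>u\<bar> \<le> B x\<close>, so that the Gronwall constant
  \<open>2 B\<close> does not depend on \<open>\<delta>\<close>.
\<close>

lemma \<rho>_0:
  assumes \<rho>00: "\<rho> 0 0 = 0" and t: "t \<in> J"
  shows "\<rho> t 0 = 0"
proof (rule ccontr)
  assume ne: "\<rho> t 0 \<noteq> 0"
  obtain B where B: "0 \<le> B" "\<And>r x. r \<in> {0..t} \<Longrightarrow> x \<in> {0..1} \<Longrightarrow> \<bar>ux r x\<bar> \<le> B"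
    using uniform_curve_bounded[OF curve_ux _ Icc_subset_J[OF t]] by blast
  define M where "M = (LINT y|circ. (\<rho>x 0 y)\<^sup>2)"
  define L where "L = M * exp (2 * B * t)"
  define K where "K \<delta> r = (LINT x|circ. 1 / (x + \<delta>) * (\<rho> r x)\<^sup>2)" for \<delta> r
  have c\<delta>: "continuous_on {0..1} (\<lambda>x. 1 / (x + \<delta>))" if "0 < \<delta>" for \<delta> :: real
    using that by (intro continuous_intros) auto
  have K0: "K \<delta> 0 \<le> M" if \<delta>: "0 < \<delta>" for \<delta>
    unfolding K_def
  proof (rule integral_circ_le_const)
    show "integrable circ (\<lambda>x. 1 / (x + \<delta>) * (\<rho> 0 x)\<^sup>2)"
      by (intro integrable_circ_continuous continuous_on_mult c\<delta> \<delta> continuous_on_power cont_\<rho>01 J0)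
    fix x :: real assume x: "x \<in> {0..1}"
    have "M \<ge> 0" by (simp add: M_def)
    have "(\<rho> 0 x)\<^sup>2 \<le> x * M"
      unfolding M_def by (rule primitive_Hoelder_0[OF \<rho>x[OF J0] \<rho>00 x])
    also have "\<dots> \<le> (x + \<delta>) * M" using \<delta> \<open>M \<ge> 0\<close> by (intro mult_right_mono) auto
    finally show "1 / (x + \<delta>) * (\<rho> 0 x)\<^sup>2 \<le> M"
      using x \<delta> by (simp add: pos_divide_le_eq mult.commute)
  qed
  have Kt: "K \<delta> t \<le> L" if \<delta>: "0 < \<delta>" for \<delta>
  proof -
    have "K \<delta> t \<le> K \<delta> 0 * exp (2 * B * t)"
    proof (rule gronwall)
      show "0 \<le> t" by (rule Jpos[OF t])
      obtain D where D: "\<And>x. x \<in> {0..1} \<Longrightarrow> \<bar>1 / (x + \<delta>)\<bar> \<le> D"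
        using continuous_bounded_unit[OF c\<delta>[OF \<delta>]] by metis
      have "\<exists>K'. (K \<delta> has_real_derivative K') (at r within J)" if "r \<in> J" for r
        unfolding K_def[abs_def]
        using L2_deriv_weighted_square[OF \<rho>_L2_deriv[OF that] borel_measurable_circ_continuous[OF c\<delta>[OF \<delta>]] D] by blast
      then have "continuous_on J (K \<delta>)"
        by (intro continuous_on_eq_continuous_within[THEN iffD2]) (auto intro: DERIV_continuous)
      then show "continuous_on {0..t} (K \<delta>)" using Icc_subset_J[OF t] by (rule continuous_on_subset)
      fix r assume r: "0 < r" "r < t"
      then have rJ: "r \<in> J" using Jdown[OF t] by auto
      have "((\<lambda>x. 1 / (x + \<delta>)) has_real_derivative - 1 / (x + \<delta>)\<^sup>2) (at x within {0..1})" if "x \<in> {0..1}" for x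
        using that \<delta> by (auto intro!: derivative_eq_intros simp: power2_eq_square)
      moreover have "continuous_on {0..1} (\<lambda>x. - 1 / (x + \<delta>)\<^sup>2)"
        using \<delta> by (intro continuous_intros) auto
      ultimately have "(K \<delta> has_real_derivative
         (LINT x|circ. (- 1 / (x + \<delta>)\<^sup>2 * u r x - 1 / (x + \<delta>) * ux r x) * (\<rho> r x)\<^sup>2)) (at r)"
        unfolding K_def[abs_def] by (rule weighted_\<rho>_deriv[OF rJ r(1)])
      moreover have "(LINT x|circ. (- 1 / (x + \<delta>)\<^sup>2 * u r x - 1 / (x + \<delta>) * ux r x) * (\<rho> r x)\<^sup>2)
         \<le> (LINT x|circ. 2 * B * (1 / (x + \<delta>) * (\<rho> r x)\<^sup>2))"
      proof (rule integral_mono)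
        show "integrable circ (\<lambda>x. (- 1 / (x + \<delta>)\<^sup>2 * u r x - 1 / (x + \<delta>) * ux r x) * (\<rho> r x)\<^sup>2)"
          using \<delta> by (intro integrable_circ_continuous continuous_intros cont_u01 cont_ux cont_\<rho>01 rJ) auto
        show "integrable circ (\<lambda>x. 2 * B * (1 / (x + \<delta>) * (\<rho> r x)\<^sup>2))"
          using \<delta> by (intro integrable_circ_continuous continuous_intros cont_\<rho>01 rJ) auto
        fix x assume "x \<in> space circ"
        then have x: "x \<in> {0..1}" by simp
        have uB: "\<bar>u r x\<bar> \<le> B * x"
          by (rule primitive_Lipschitz_0[OF ux(1)[OF rJ] u_0[OF rJ] _ x]) (use B(2) r in auto)
        also have "\<dots> \<le> B * (x + \<delta>)" using B(1) \<delta> by (intro mult_left_mono) auto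
        finally have "\<bar>u r x\<bar> / (x + \<delta>)\<^sup>2 \<le> B * (x + \<delta>) / (x + \<delta>)\<^sup>2" by (rule divide_right_mono) simp
        also have "\<dots> = B * (1 / (x + \<delta>))" using x \<delta> by (simp add: power2_eq_square)
        finally have 1: "- 1 / (x + \<delta>)\<^sup>2 * u r x \<le> B * (1 / (x + \<delta>))"
          using abs_ge_minus_self[of "u r x / (x + \<delta>)\<^sup>2"] by (simp add: abs_divide)
        have "- ux r x \<le> B" using B(2)[of r x] r x by auto
        then have 2: "1 / (x + \<delta>) * (- ux r x) \<le> 1 / (x + \<delta>) * B" using x \<delta> by (intro mult_left_mono) auto
        have "- 1 / (x + \<delta>)\<^sup>2 * u r x - 1 / (x + \<delta>) * ux r x \<le> 2 * B * (1 / (x + \<delta>))"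
        proof -
          define k where "k = 1 / (x + \<delta>)"
          have "k * (- ux r x) + B * k \<le> k * B + B * k" using 2 by (simp add: k_def)
          with 1 show ?thesis unfolding k_def[symmetric] by (simp add: mult_ac)
        qed
        then have "(- 1 / (x + \<delta>)\<^sup>2 * u r x - 1 / (x + \<delta>) * ux r x) * (\<rho> r x)\<^sup>2 \<le> 2 * B * (1 / (x + \<delta>)) * (\<rho> r x)\<^sup>2"
          by (rule mult_right_mono) simp
        then show "(- 1 / (x + \<delta>)\<^sup>2 * u r x - 1 / (x + \<delta>) * ux r x) * (\<rho> r x)\<^sup>2 \<le> 2 * B * (1 / (x + \<delta>) * (\<rho> r x)\<^sup>2)"
          by (simp only: mult.assoc)
      qed
      moreover have "(LINT x|circ. 2 * B * (1 / (x + \<delta>) * (\<rho> r x)\<^sup>2)) = 2 * B * K \<delta> r"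
        unfolding K_def by (rule integral_mult_right_zero)
      ultimately show "\<exists>D. (K \<delta> has_real_derivative D) (at r) \<and> D \<le> 2 * B * K \<delta> r" by auto
    qed
    also have "\<dots> \<le> L" unfolding L_def using K0[OF \<delta>] by (intro mult_right_mono) auto
    finally show ?thesis .
  qed
  define c where "c = (\<rho> t 0)\<^sup>2 / 2"
  have c: "0 < c" using ne by (simp add: c_def)
  have "continuous_on {0..1} (\<lambda>x. (\<rho> t x)\<^sup>2)" by (intro continuous_intros cont_\<rho>01 t)
  then obtain d where d: "0 < d" "\<And>x. x \<in> {0..1} \<Longrightarrow> dist x 0 < d \<Longrightarrow> dist ((\<rho> t x)\<^sup>2) ((\<rho> t 0)\<^sup>2) < c"
    using c unfolding continuous_on_iff by (metis atLeastAtMost_iff order_refl zero_le_one)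
  define \<eta> where "\<eta> = min 1 (d / 2)"
  have \<eta>: "0 < \<eta>" "\<eta> \<le> 1" "\<eta> < d" using d(1) by (auto simp: \<eta>_def)
  have low: "c \<le> (\<rho> t x)\<^sup>2" if "x \<in> {0..\<eta>}" for x
  proof -
    have "dist ((\<rho> t x)\<^sup>2) ((\<rho> t 0)\<^sup>2) < c" using d(2)[of x] that \<eta> by (simp add: dist_real_def)
    then show ?thesis unfolding dist_real_def c_def by linarith
  qed
  \<comment> \<open>\<open>\<delta>\<close> is so small that the logarithmic lower bound \<open>c R\<close> exceeds the upper bound \<open>L\<close>\<close>
  define R where "R = (L + 1) / c"
  define \<delta> where "\<delta> = \<eta> * exp (- R)"
  have \<delta>: "0 < \<delta>" using \<eta> by (simp add: \<delta>_def)
  have int1: "(LINT x|circ. indicat_real {0..\<eta>} x * (1 / (x + \<delta>))) = ln (\<eta> + \<delta>) - ln \<delta>"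
  proof -
    have "((\<lambda>x. 1 / (x + \<delta>)) has_integral (ln (\<eta> + \<delta>) - ln (0 + \<delta>))) {0..\<eta>}"
      by (rule fundamental_theorem_of_calculus)
        (use \<eta> \<delta> in \<open>auto intro!: derivative_eq_intros simp flip: has_real_derivative_iff_has_vector_derivative\<close>)
    then show ?thesis
      using integral_circ_indicator_HK(1)[OF _ \<eta>(2) integrable_circ_continuous[OF c\<delta>[OF \<delta>]], of 0]
      by (simp add: integral_unique)
  qed
  have "c * (ln (\<eta> + \<delta>) - ln \<delta>) = (LINT x|circ. c * (indicat_real {0..\<eta>} x * (1 / (x + \<delta>))))"
    unfolding int1[symmetric] by (rule integral_mult_right_zero[symmetric])
  also have "\<dots> \<le> K \<delta> t"
    unfolding K_def
  proof (rule integral_mono)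
    show "integrable circ (\<lambda>x. c * (indicat_real {0..\<eta>} x * (1 / (x + \<delta>))))"
      by (intro integrable_mult_right integrable_circ_indicator integrable_circ_continuous c\<delta> \<delta>)
    show "integrable circ (\<lambda>x. 1 / (x + \<delta>) * (\<rho> t x)\<^sup>2)"
      by (intro integrable_circ_continuous continuous_on_mult c\<delta> \<delta> continuous_on_power cont_\<rho>01 t)
    fix x assume "x \<in> space circ"
    then have x: "0 < x + \<delta>" using \<delta> by simp
    show "c * (indicat_real {0..\<eta>} x * (1 / (x + \<delta>))) \<le> 1 / (x + \<delta>) * (\<rho> t x)\<^sup>2"
      using low[of x] x by (auto simp: indicator_def divide_right_mono)
  qed
  also have "\<dots> \<le> L" by (rule Kt[OF \<delta>])
  finally have "c * (ln (\<eta> + \<delta>) - ln \<delta>) \<le> L" .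
  moreover have "R \<le> ln (\<eta> + \<delta>) - ln \<delta>"
  proof -
    have "ln \<delta> = ln \<eta> - R" unfolding \<delta>_def using \<eta> by (simp add: ln_mult)
    moreover have "ln \<eta> \<le> ln (\<eta> + \<delta>)" using \<eta> \<delta> by simp
    ultimately show ?thesis by linarith
  qed
  then have "c * R \<le> c * (ln (\<eta> + \<delta>) - ln \<delta>)" using c by (intro mult_left_mono) auto
  moreover have "c * R = L + 1" using c by (simp add: R_def)
  ultimately show False by linarith
qed

section \<open>The Riccati equation at the origin\<close>

text \<open>
  The derivative of the first equation at \<open>x = 0\<close> is taken as a limit of the quotients
  \<open>u \<tau> h / h\<close>, integrated in time: these have the time derivative
  \<open>- (u / h) u\<^sub>x + source_int / h\<close>, which stays bounded and tends to
  \<open>- w\<^sup>2 + w\<^sup>2 / 2 + A\<close> pointwise, so dominated convergence applies.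
\<close>

lemma riccati_integral:
  assumes \<rho>00: "\<rho> 0 0 = 0" and t: "t \<in> J"
  shows "((\<lambda>\<tau>. - (ux \<tau> 0)\<^sup>2 / 2 + a 0) has_integral (ux t 0 - ux 0 0)) {0..t}"
proof -
  define h where "h n = inverse (real (Suc n))" for n
  have h: "0 < h n" "h n \<le> 1" for n by (auto simp: h_def inverse_le_1_iff)
  have h01: "h n \<in> {0..1}" for n using h[of n] by simp
  define w' where "w' \<tau> = - (ux \<tau> 0)\<^sup>2 / 2 + a 0" for \<tau>
  \<comment> \<open>the equation is available for positive times only; the value at \<open>\<tau> = 0\<close> is chosen to converge\<close>
  define f where "f n \<tau> = (if \<tau> = 0 then w' 0 else uc \<tau> (h n) / h n)" for n \<tau>
  have f_int: "(f n has_integral (u t (h n) / h n - u 0 (h n) / h n)) {0..t}" for n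
  proof (rule has_integral_spike_finite[of "{0}"])
    show "((\<lambda>\<tau>. uc \<tau> (h n) / h n) has_integral (u t (h n) / h n - u 0 (h n) / h n)) {0..t}"
    proof (rule fundamental_theorem_of_calculus[OF Jpos[OF t]])
      fix \<tau> assume "\<tau> \<in> {0..t}"
      then have \<tau>: "\<tau> \<in> J" using Icc_subset_J[OF t] by blast
      have "((\<lambda>r. u r (h n) / h n) has_real_derivative uc \<tau> (h n) / h n) (at \<tau> within {0..t})"
        by (rule DERIV_cdivide[OF has_field_derivative_subset[OF u_time_deriv[OF \<tau> h01] Icc_subset_J[OF t]]])
      then show "((\<lambda>r. u r (h n) / h n) has_vector_derivative uc \<tau> (h n) / h n) (at \<tau> within {0..t})"
        by (simp add: has_real_derivative_iff_has_vector_derivative)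
    qed
  qed (auto simp: f_def)
  obtain B where B: "0 \<le> B" "\<And>r x. r \<in> {0..t} \<Longrightarrow> x \<in> {0..1} \<Longrightarrow> \<bar>ux r x\<bar> \<le> B"
    using uniform_curve_bounded[OF curve_ux _ Icc_subset_J[OF t]] by blast
  obtain C where C: "0 \<le> C" "\<And>r x. r \<in> {0..t} \<Longrightarrow> x \<in> {0..1} \<Longrightarrow> \<bar>\<rho> r x\<bar> \<le> C"
    using uniform_curve_bounded[OF curve_\<rho>01 _ Icc_subset_J[OF t]] by blast
  define Q where "Q = \<bar>\<kappa>\<bar> / 2 * C\<^sup>2 + B\<^sup>2 / 2 + \<bar>a 0\<bar>"
  have sourceQ: "\<bar>source r x\<bar> \<le> Q" if "r \<in> {0..t}" "x \<in> {0..1}" for r x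
  proof -
    have rJ: "r \<in> J" using that Icc_subset_J[OF t] by blast
    have "(ux r x)\<^sup>2 \<le> B\<^sup>2" "(\<rho> r x)\<^sup>2 \<le> C\<^sup>2"
      using B(2)[OF that] C(2)[OF that] by (metis abs_ge_zero power_mono power2_abs)+
    moreover from this(2) have "\<bar>\<kappa> / 2 * (\<rho> r x)\<^sup>2\<bar> \<le> \<bar>\<kappa>\<bar> / 2 * C\<^sup>2"
      by (simp add: abs_mult mult_left_mono)
    ultimately show ?thesis
      unfolding source_def a_const[OF rJ] Q_def using zero_le_power2[of "ux r x"] by linarith
  qed
  have Q0: "0 \<le> Q" by (simp add: Q_def)
  have bound: "norm (f n \<tau>) \<le> \<bar>w' 0\<bar> + B\<^sup>2 + Q" if \<tau>: "\<tau> \<in> {0..t}" for n \<tau>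
  proof (cases "\<tau> = 0")
    case True
    then show ?thesis using Q0 by (simp add: f_def)
  next
    case False
    have \<tau>J: "\<tau> \<in> J" using \<tau> Icc_subset_J[OF t] by blast
    have "\<bar>u \<tau> (h n)\<bar> \<le> B * h n"
      by (rule primitive_Lipschitz_0[OF ux(1)[OF \<tau>J] u_0[OF \<tau>J] _ h01]) (use B(2)[OF \<tau>] in auto)
    then have "\<bar>u \<tau> (h n)\<bar> * \<bar>ux \<tau> (h n)\<bar> \<le> B * h n * B"
      using B(1) B(2)[OF \<tau> h01] h[of n] by (intro mult_mono) auto
    moreover have "\<bar>source_int \<tau> (h n)\<bar> \<le> Q * h n"
      by (rule primitive_Lipschitz_0[OF primitive_source[OF \<tau>J] source_int_0[OF \<tau>J] _ h01]) (use sourceQ[OF \<tau>] in auto)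
    ultimately have "\<bar>uc \<tau> (h n)\<bar> \<le> (B\<^sup>2 + Q) * h n"
      unfolding uc_eq[OF \<tau>J False h01] using abs_triangle_ineq[of "- (u \<tau> (h n) * ux \<tau> (h n))" "source_int \<tau> (h n)"]
      by (simp add: abs_mult power2_eq_square algebra_simps)
    then have "\<bar>uc \<tau> (h n)\<bar> / h n \<le> B\<^sup>2 + Q" using h[of n] by (simp add: pos_divide_le_eq)
    then show ?thesis using False h[of n] by (simp add: f_def abs_divide)
  qed
  have lim: "(\<lambda>n. f n \<tau>) \<longlonglongrightarrow> w' \<tau>" if \<tau>: "\<tau> \<in> {0..t}" for \<tau>
  proof (cases "\<tau> = 0")
    case True
    then show ?thesis by (simp add: f_def)
  next
    case False
    have \<tau>J: "\<tau> \<in> J" using \<tau> Icc_subset_J[OF t] by blast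
    have "h \<longlonglongrightarrow> 0" unfolding h_def[abs_def] by (rule LIMSEQ_inverse_real_of_nat)
    then have "filterlim h (at 0 within {0..1}) sequentially"
      unfolding filterlim_at using h by (auto intro!: always_eventually simp: less_imp_neq[symmetric] less_imp_le)
    moreover have "(ux \<tau> \<longlongrightarrow> ux \<tau> 0) (at 0 within {0..1})"
      using cont_ux[OF \<tau>J] by (auto simp: continuous_on_def)
    ultimately have l1: "(\<lambda>n. ux \<tau> (h n)) \<longlonglongrightarrow> ux \<tau> 0" by (rule filterlim_compose[rotated])
    have l2: "(\<lambda>n. u \<tau> (h n) / h n) \<longlonglongrightarrow> ux \<tau> 0"
      unfolding h_def by (rule primitive_quotient_tendsto[OF ux(1)[OF \<tau>J] u_0[OF \<tau>J] cont_ux[OF \<tau>J]])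
    have l3: "(\<lambda>n. source_int \<tau> (h n) / h n) \<longlonglongrightarrow> source \<tau> 0"
      unfolding h_def by (rule primitive_quotient_tendsto[OF primitive_source[OF \<tau>J] source_int_0[OF \<tau>J] cont_source[OF \<tau>J]])
    have "(\<lambda>n. - (u \<tau> (h n) / h n * ux \<tau> (h n)) + source_int \<tau> (h n) / h n) \<longlonglongrightarrow> - (ux \<tau> 0 * ux \<tau> 0) + source \<tau> 0"
      by (intro tendsto_intros l1 l2 l3)
    also have "(\<lambda>n. - (u \<tau> (h n) / h n * ux \<tau> (h n)) + source_int \<tau> (h n) / h n) = (\<lambda>n. f n \<tau>)"
      using False by (auto simp: f_def uc_eq[OF \<tau>J False h01] add_divide_distrib diff_divide_distrib)
    also have "- (ux \<tau> 0 * ux \<tau> 0) + source \<tau> 0 = w' \<tau>"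
      using \<rho>_0[OF \<rho>00 \<tau>J] a_const[OF \<tau>J] by (simp add: source_def w'_def power2_eq_square)
    finally show ?thesis .
  qed
  have int: "w' integrable_on {0..t}" and ilim: "(\<lambda>n. integral {0..t} (f n)) \<longlonglongrightarrow> integral {0..t} w'"
    using dominated_convergence[of f "{0..t}" "\<lambda>_. \<bar>w' 0\<bar> + B\<^sup>2 + Q" w'] f_int bound lim
    by (auto simp: has_integral_integrable)
  have "(\<lambda>n. u r (h n) / h n) \<longlonglongrightarrow> ux r 0" if "r \<in> J" for r
    unfolding h_def by (rule primitive_quotient_tendsto[OF ux(1)[OF that] u_0[OF that] cont_ux[OF that]])
  then have "(\<lambda>n. u t (h n) / h n - u 0 (h n) / h n) \<longlonglongrightarrow> ux t 0 - ux 0 0"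
    using t J0 by (intro tendsto_diff)
  moreover have "integral {0..t} (f n) = u t (h n) / h n - u 0 (h n) / h n" for n
    by (rule integral_unique[OF f_int])
  ultimately have "integral {0..t} w' = ux t 0 - ux 0 0"
    using ilim by (simp add: LIMSEQ_unique)
  then have "(w' has_integral (ux t 0 - ux 0 0)) {0..t}" using int by (simp add: has_integral_integral)
  then show ?thesis by (simp add: w'_def[abs_def])
qed

lemma continuous_ux_0: "continuous_on J (\<lambda>t. ux t 0)"
  by (rule uniform_curve_continuous_at[OF curve_ux]) simp

lemma riccati:
  assumes \<rho>00: "\<rho> 0 0 = 0" and t: "t \<in> J" "0 < t"
  shows "((\<lambda>t. ux t 0) has_real_derivative (- (ux t 0)\<^sup>2 / 2 + a 0)) (at t)"
proof -
  obtain r where r: "r \<in> J" "t < r" using Jup[OF t(1)] by blast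
  let ?w = "\<lambda>\<tau>. - (ux \<tau> 0)\<^sup>2 / 2 + a 0"
  have "continuous_on {0..r} ?w"
    by (intro continuous_intros continuous_on_subset[OF continuous_ux_0 Icc_subset_J[OF r(1)]]) simp
  from integral_has_real_derivative[OF this, of t] t r
  have "((\<lambda>x. integral {0..x} ?w) has_real_derivative ?w t) (at t within {0..r})" by simp
  then have "((\<lambda>x. ux 0 0 + integral {0..x} ?w) has_real_derivative ?w t) (at t within {0..r})"
    by (auto intro!: derivative_eq_intros)
  then have "((\<lambda>x. ux 0 0 + integral {0..x} ?w) has_real_derivative ?w t) (at t)"
    using t r by (simp add: at_within_Icc_at)
  then show ?thesis
  proof (rule has_field_derivative_transform_within_open)
    show "ux 0 0 + integral {0..x} ?w = ux x 0" if "x \<in> {0<..<r}" for x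
      using integral_unique[OF riccati_integral[OF \<rho>00]] that Jdown[OF r(1)] by auto
  qed (use t r in auto)
qed

end

section \<open>Blow-up\<close>

text \<open>
  For \<open>A < 0\<close> and \<open>c\<^sup>2 = - A / 2\<close> the solution is \<open>- 2 c cot (c (T\<^sub>0 - t))\<close>; the initial value
  determines \<open>T\<^sub>0\<close> through \<open>cot (c T\<^sub>0) = - w\<^sub>0 / (2 c)\<close>.
\<close>

lemma riccati_explicit_solution:
  fixes w0 A :: real
  assumes "w0 < 0" "A \<le> 0"
  obtains T0 W where "0 < T0" "W 0 = w0"
    "\<And>t. t < T0 \<Longrightarrow> 0 \<le> t \<Longrightarrow> (W has_real_derivative (- (W t)\<^sup>2 / 2 + A)) (at t)"
    "((\<lambda>t. (T0 - t) * W t) \<longlongrightarrow> -2) (at_left T0)"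
proof (cases "A = 0")
  case True
  define T0 where "T0 = - 2 / w0"
  define W where "W t = - 2 / (T0 - t)" for t
  show ?thesis
  proof (rule that[of T0 W])
    show "0 < T0" "W 0 = w0" using assms by (auto simp: T0_def W_def divide_simps)
    show "(W has_real_derivative (- (W t)\<^sup>2 / 2 + A)) (at t)" if "t < T0" "0 \<le> t" for t
    proof -
      have "(W has_real_derivative - 2 / (T0 - t)\<^sup>2) (at t)"
        unfolding W_def[abs_def] using that
        by (auto intro!: derivative_eq_intros simp: power2_eq_square)
      also have "- 2 / (T0 - t)\<^sup>2 = - (W t)\<^sup>2 / 2 + A" by (simp add: W_def True power_divide)
      finally show ?thesis .
    qed
    have "(T0 - t) * W t = -2" if "t < T0" for t
      using that by (simp add: W_def divide_simps)
    then have "\<forall>\<^sub>F t in at_left T0. (T0 - t) * W t = -2"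
      unfolding eventually_at_filter by (intro always_eventually) auto
    then show "((\<lambda>t. (T0 - t) * W t) \<longlongrightarrow> -2) (at_left T0)" by (rule tendsto_eventually)
  qed
next
  case False
  define c where "c = sqrt (- A / 2)"
  have c: "0 < c" "c\<^sup>2 = - A / 2" using False assms by (auto simp: c_def)
  define m where "m = - w0 / (2 * c)"
  have m: "0 < m" using assms c by (simp add: m_def divide_neg_pos)
  define T0 where "T0 = (pi / 2 - arctan m) / c"
  have cT: "c * T0 = pi / 2 - arctan m" using c by (simp add: T0_def)
  have T0: "0 < T0" using arctan_ubound[of m] c by (simp add: T0_def)
  define W where "W t = - 2 * c * (cos (c * (T0 - t)) / sin (c * (T0 - t)))" for t
  show ?thesis
  proof (rule that[of T0 W])
    show "0 < T0" by (rule T0)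
    have "cos (c * T0) / sin (c * T0) = tan (arctan m)"
      unfolding cT by (simp add: tan_def cos_diff sin_diff)
    then show "W 0 = w0" using c by (simp add: W_def m_def tan_arctan)
    show "(W has_real_derivative (- (W t)\<^sup>2 / 2 + A)) (at t)" if t: "t < T0" "0 \<le> t" for t
    proof -
      have "c * (T0 - t) \<le> c * T0" using t c by simp
      also have "\<dots> < pi" unfolding cT using arctan_lbound[of m] pi_gt_zero by linarith
      finally have s: "0 < sin (c * (T0 - t))" using t c by (intro sin_gt_zero) auto
      let ?s = "sin (c * (T0 - t))" and ?k = "cos (c * (T0 - t))"
      have "((\<lambda>t. cos (c * (T0 - t)) / sin (c * (T0 - t))) has_real_derivative
          (c * ?s * ?s + ?k * c * ?k) / (?s * ?s)) (at t)"
        using s by (auto intro!: derivative_eq_intros simp: algebra_simps)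
      then have "(W has_real_derivative (- 2 * c * ((c * ?s * ?s + ?k * c * ?k) / (?s * ?s)))) (at t)"
        unfolding W_def[abs_def] by (rule DERIV_cmult)
      also have "- 2 * c * ((c * ?s * ?s + ?k * c * ?k) / (?s * ?s)) = - 2 * c\<^sup>2 + - 2 * c\<^sup>2 * (?k / ?s)\<^sup>2"
        using s by (simp add: field_simps power2_eq_square)
      also have "\<dots> = - (W t)\<^sup>2 / 2 + A"
        unfolding W_def power_mult_distrib using c(2) by simp
      finally show ?thesis .
    qed
    have "((\<lambda>y. sin y / y) \<longlongrightarrow> 1) (at (0::real))"
      using DERIV_sin[of 0] by (simp add: has_field_derivative_iff)
    moreover have "filterlim (\<lambda>t. c * (T0 - t)) (at 0) (at_left T0)"
      unfolding filterlim_at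
    proof
      show "\<forall>\<^sub>F t in at_left T0. c * (T0 - t) \<in> UNIV \<and> c * (T0 - t) \<noteq> 0"
        unfolding eventually_at_filter using c by (intro always_eventually) auto
      have "((\<lambda>t. c * (T0 - t)) \<longlongrightarrow> c * (T0 - T0)) (at_left T0)" by (intro tendsto_intros)
      then show "((\<lambda>t. c * (T0 - t)) \<longlongrightarrow> 0) (at_left T0)" by simp
    qed
    ultimately have l: "((\<lambda>t. sin (c * (T0 - t)) / (c * (T0 - t))) \<longlongrightarrow> 1) (at_left T0)"
      by (rule filterlim_compose)
    have "((\<lambda>t. - 2 * (cos (c * (T0 - t)) / (sin (c * (T0 - t)) / (c * (T0 - t))))) \<longlongrightarrow> - 2 * (cos (c * (T0 - T0)) / 1)) (at_left T0)"
      by (intro tendsto_intros l) auto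
    then show "((\<lambda>t. (T0 - t) * W t) \<longlongrightarrow> -2) (at_left T0)" by (simp add: W_def mult_ac)
  qed
qed

lemma at_bot_of_rate:
  fixes W :: "real \<Rightarrow> real"
  assumes "((\<lambda>t. (T0 - t) * W t) \<longlongrightarrow> -2) (at_left T0)"
  shows "filterlim W at_bot (at_left T0)"
proof -
  have "filterlim (\<lambda>t. inverse (T0 - t)) at_top (at_left T0)"
  proof (rule filterlim_inverse_at_top)
    have "((\<lambda>t. T0 - t) \<longlongrightarrow> T0 - T0) (at_left T0)" by (intro tendsto_intros)
    then show "((\<lambda>t. T0 - t) \<longlongrightarrow> 0) (at_left T0)" by simp
    show "\<forall>\<^sub>F t in at_left T0. 0 < T0 - t" unfolding eventually_at_filter by (intro always_eventually) auto
  qed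
  from filterlim_tendsto_neg_mult_at_bot[OF assms _ this]
  have "filterlim (\<lambda>t. (T0 - t) * W t * inverse (T0 - t)) at_bot (at_left T0)" by simp
  then show ?thesis
    by (rule filterlim_cong[THEN iffD1, OF refl refl, rotated])
      (auto simp: eventually_at_filter intro!: always_eventually)
qed

text \<open>
  The difference of two solutions solves a linear equation with the coefficient
  \<open>- (v + W) / 2\<close>, which is bounded on a compact time interval.
\<close>

lemma riccati_unique:
  fixes v W :: "real \<Rightarrow> real"
  assumes t: "0 \<le> t" and cv: "continuous_on {0..t} v" and cW: "continuous_on {0..t} W" and init: "v 0 = W 0"
    and dv: "\<And>r. 0 < r \<Longrightarrow> r < t \<Longrightarrow> (v has_real_derivative (- (v r)\<^sup>2 / 2 + A)) (at r)"
    and dW: "\<And>r. 0 < r \<Longrightarrow> r < t \<Longrightarrow> (W has_real_derivative (- (W r)\<^sup>2 / 2 + A)) (at r)"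
  shows "v t = W t"
proof -
  have "compact ((\<lambda>r. v r + W r) ` {0..t})"
    by (intro compact_continuous_image continuous_intros cv cW) simp
  then have "\<exists>B. \<forall>y\<in>(\<lambda>r. v r + W r) ` {0..t}. norm y \<le> B"
    by (auto dest!: compact_imp_bounded simp: bounded_iff)
  then obtain B where B: "\<And>r. r \<in> {0..t} \<Longrightarrow> \<bar>v r + W r\<bar> \<le> B" by force
  have "(v t - W t)\<^sup>2 \<le> (v 0 - W 0)\<^sup>2 * exp (B * t)"
  proof (rule gronwall[OF t])
    show "continuous_on {0..t} (\<lambda>r. (v r - W r)\<^sup>2)" by (intro continuous_intros cv cW)
    fix r assume r: "0 < r" "r < t"
    have "((\<lambda>r. (v r - W r)\<^sup>2) has_real_derivative - (v r + W r) * (v r - W r)\<^sup>2) (at r)"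
      by (rule derivative_eq_intros dv[OF r] dW[OF r] refl)+ (simp add: field_simps power2_eq_square)
    moreover have "- (v r + W r) * (v r - W r)\<^sup>2 \<le> B * (v r - W r)\<^sup>2"
      using B[of r] r by (intro mult_right_mono) auto
    ultimately show "\<exists>D. ((\<lambda>r. (v r - W r)\<^sup>2) has_real_derivative D) (at r) \<and> D \<le> B * (v r - W r)\<^sup>2" by blast
  qed
  with init show ?thesis by simp
qed

theorem proposition2p1:
  fixes \<alpha> \<kappa> s :: real and T :: ereal
    and u0 \<rho>0 :: "real \<Rightarrow> real" and u \<rho> :: "real \<Rightarrow> real \<Rightarrow> real"
  assumes "\<alpha> = -1" and "\<kappa> < 0" and "s \<ge> 2"
    and "u0 \<in> sobolev s" and "\<rho>0 \<in> sobolev (s - 1)"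
    and "hs_solution \<alpha> \<kappa> s T u0 \<rho>0 u \<rho>"
    and "\<forall>x. u0 (- x) = - u0 x" and "deriv u0 0 < 0"
    and "\<forall>x. \<rho>0 (- x) = \<rho>0 x" and "\<rho>0 0 = 0"
    and "(l2_norm (deriv u0))\<^sup>2 + \<kappa> * (l2_norm \<rho>0)\<^sup>2 \<ge> 0"
  shows "\<exists>T0 :: real. \<exists>w :: real \<Rightarrow> real.
      0 < T0 \<and> T \<le> ereal T0 \<and>
      (\<forall>t\<in>time_interval T. (u t has_real_derivative w t) (at 0)) \<and>
      (\<forall>t\<in>{0..<T0}. (w has_real_derivative (\<alpha> / 2 * (w t)\<^sup>2 + hs_a \<alpha> \<kappa> u0 \<rho>0))
                       (at t within {0..<T0})) \<and>
      filterlim w at_bot (at_left T0) \<and>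
      ((\<lambda>t. (T0 - t) * w t) \<longlongrightarrow> -2) (at_left T0) \<and>
      (T = ereal T0 \<longrightarrow>
         filterlim (\<lambda>t. deriv (u t) 0) at_bot (at_left T0) \<and>
         ((\<lambda>t. (T0 - t) * deriv (u t) 0) \<longlongrightarrow> -2) (at_left T0))"
proof -
  have \<alpha>: "\<alpha> = -1" by fact
  define J where "J = time_interval T"
  have sol: "0 < T" "u 0 = u0" "\<rho> 0 = \<rho>0"
    and cont: "\<And>t. t \<in> J \<Longrightarrow> continuous_on UNIV (u t)" "\<And>t. t \<in> J \<Longrightarrow> continuous_on UNIV (\<rho> t)"
    and curves: "continuous_into_sobolev s J u" "continuous_into_sobolev (s - 1) J \<rho>"
    using assms(6) unfolding hs_solution_def J_def[symmetric] by blast+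
  have "\<exists>ut \<rho>t. hs_flow \<kappa> s J u \<rho> ut \<rho>t"
  proof -
    obtain ut \<rho>t where ut: "C1_into_sobolev (s - 1) J u ut" "C1_into_sobolev (s - 2) J \<rho> \<rho>t"
      and eqs: "\<And>t. t \<in> J - {0} \<Longrightarrow> (AE x in lborel. ut t x + u t x * deriv (u t) x =
              (LBINT y=ereal 0..ereal x. \<kappa> / 2 * (\<rho> t y)\<^sup>2
                 + (- 1 + 2) / 2 * (deriv (u t) y)\<^sup>2 + hs_a (- 1) \<kappa> (u t) (\<rho> t)))"
        "\<And>t. t \<in> J - {0} \<Longrightarrow> (AE x in lborel. \<rho>t t x + u t x * deriv (\<rho> t) x = - 1 * deriv (u t) x * \<rho> t x)"
      using assms(6) unfolding hs_solution_def J_def[symmetric] \<alpha> by blast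
    have "hs_flow \<kappa> s J u \<rho> ut \<rho>t"
    proof
      show "\<exists>r\<in>J. t < r" if "t \<in> J" for t
      proof -
        have "ereal t < T" "0 \<le> t" using that by (auto simp: J_def time_interval_def)
        then obtain r where "ereal t < ereal r" "ereal r < T" using ereal_dense2 by blast
        then show ?thesis using \<open>0 \<le> t\<close> by (intro bexI[of _ r]) (auto simp: J_def time_interval_def)
      qed
      show "r \<in> J" if "t \<in> J" "0 \<le> r" "r \<le> t" for t r
        using that le_less_trans[of "ereal r" "ereal t" T] by (auto simp: J_def time_interval_def)
      show "u 0 0 = 0" using assms(7)[rule_format, of 0] sol by simp
      show "0 \<in> J" using sol(1) by (simp add: J_def time_interval_def zero_ereal_def[symmetric])
      show "0 \<le> t" if "t \<in> J" for t using that by (simp add: J_def time_interval_def)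
    qed (use assms(3) cont curves ut eqs in \<open>blast+\<close>)
    then show ?thesis by blast
  qed
  then obtain ut \<rho>t where "hs_flow \<kappa> s J u \<rho> ut \<rho>t" by blast
  then interpret hs_flow \<kappa> s J u \<rho> ut \<rho>t .
  define A where "A = hs_a \<alpha> \<kappa> u0 \<rho>0"
  have a0: "a 0 = A" by (simp add: a_def A_def \<alpha> sol)
  have sq: "(l2_norm f)\<^sup>2 = (LBINT x:{0..1}. (f x)\<^sup>2)" for f
    unfolding l2_norm_def set_integral_circ by (intro real_sqrt_pow2) simp
  have A0: "A \<le> 0" using assms(11) unfolding sq A_def hs_a_def \<alpha> by simp
  have w0: "ux 0 0 = deriv u0 0" using deriv_u[OF J0, of 0] sol by simp
  obtain T0 W where W: "0 < T0" "W 0 = deriv u0 0"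
    "\<And>t. t < T0 \<Longrightarrow> 0 \<le> t \<Longrightarrow> (W has_real_derivative (- (W t)\<^sup>2 / 2 + A)) (at t)"
    "((\<lambda>t. (T0 - t) * W t) \<longlongrightarrow> -2) (at_left T0)"
    using riccati_explicit_solution[OF assms(8) A0] by metis
  have bot: "filterlim W at_bot (at_left T0)" by (rule at_bot_of_rate[OF W(4)])
  have \<rho>00: "\<rho> 0 0 = 0" using assms(10) sol by simp
  have eqW: "ux t 0 = W t" if t: "t \<in> J" "t < T0" for t
  proof (rule riccati_unique[where A=A and v="\<lambda>t. ux t 0"])
    show "0 \<le> t" by (rule Jpos[OF t(1)])
    show "continuous_on {0..t} (\<lambda>t. ux t 0)"
      by (rule continuous_on_subset[OF continuous_ux_0 Icc_subset_J[OF t(1)]])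
    show "continuous_on {0..t} W"
      by (intro continuous_at_imp_continuous_on ballI DERIV_isCont[OF W(3)]) (use t in auto)
    show "ux 0 0 = W 0" using w0 W(2) by simp
    show "((\<lambda>t. ux t 0) has_real_derivative - (ux r 0)\<^sup>2 / 2 + A) (at r)" if "0 < r" "r < t" for r
      using riccati[OF \<rho>00, of r] Jdown[OF t(1), of r] that a0 by simp
    show "(W has_real_derivative - (W r)\<^sup>2 / 2 + A) (at r)" if "0 < r" "r < t" for r
      using W(3)[of r] that t by simp
  qed
  have T: "T \<le> ereal T0"
  proof (rule ccontr)
    assume "\<not> T \<le> ereal T0"
    then have T0J: "T0 \<in> J" using W(1) by (simp add: J_def time_interval_def)
    have "((\<lambda>t. ux t 0) \<longlongrightarrow> ux T0 0) (at_left T0)"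
      using DERIV_isCont[OF riccati[OF \<rho>00 T0J W(1)]] by (simp add: isCont_def filterlim_at_split)
    moreover have "\<forall>\<^sub>F t in at_left T0. ux t 0 = W t"
      unfolding eventually_at_left_field using W(1) Jdown[OF T0J] by (intro exI[of _ 0]) (auto intro!: eqW)
    ultimately have "(W \<longlongrightarrow> ux T0 0) (at_left T0)" by (rule Lim_transform_eventually)
    then show False
      using not_tendsto_and_filterlim_at_infinity[OF _ _ filterlim_at_bot_imp_at_infinity[OF bot]] by simp
  qed
  have below: "t < T0" if "t \<in> J" for t
    using that T less_le_trans[of "ereal t" T "ereal T0"] by (simp add: J_def time_interval_def)
  have der: "(u t has_real_derivative W t) (at 0)" if "t \<in> J" for t
    using ux(4)[OF that, of 0] eqW[OF that below[OF that]] by simp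
  have end_case: "filterlim (\<lambda>t. deriv (u t) 0) at_bot (at_left T0) \<and>
         ((\<lambda>t. (T0 - t) * deriv (u t) 0) \<longlongrightarrow> -2) (at_left T0)" if "T = ereal T0"
  proof -
    have "deriv (u t) 0 = W t" if "0 < t" "t < T0" for t
      by (rule DERIV_imp_deriv[OF der]) (use that \<open>T = ereal T0\<close> in \<open>auto simp: J_def time_interval_def\<close>)
    then have ev: "\<forall>\<^sub>F t in at_left T0. W t = deriv (u t) 0"
      unfolding eventually_at_left_field using W(1) by (intro exI[of _ 0]) auto
    have "filterlim (\<lambda>t. deriv (u t) 0) at_bot (at_left T0)"
      using filterlim_cong[OF refl refl ev] bot by blast
    moreover have "((\<lambda>t. (T0 - t) * deriv (u t) 0) \<longlongrightarrow> -2) (at_left T0)"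
      by (rule Lim_transform_eventually[OF W(4)]) (use ev in eventually_elim, simp)
    ultimately show ?thesis by blast
  qed
  show ?thesis
  proof (intro exI[of _ T0] exI[of _ W] conjI ballI impI)
    show "(u t has_real_derivative W t) (at 0)" if "t \<in> time_interval T" for t
      using der that by (simp add: J_def)
    show "(W has_real_derivative \<alpha> / 2 * (W t)\<^sup>2 + hs_a \<alpha> \<kappa> u0 \<rho>0) (at t within {0..<T0})" if "t \<in> {0..<T0}" for t
      using has_field_derivative_at_within[OF W(3), of t "{0..<T0}"] that by (simp add: A_def \<alpha>)
  qed (use W(1) T bot W(4) end_case in auto)
qed

end
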